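(* Let $t\ge 1$ be an integer and let $\mathcal F\subseteq\Sigma_n$ be a $t$-intersecting family. Suppose that $$\gamma_t(\mathcal F)=\sum_{i=0}^{t}(-1)^i\binom{t}{i}(n-2t-i)!$$ and $n\ge 130(t+1)(8t)^t$. Then $\mathcal F$ has one of the following structures. 1. There is a partial permutation $X$ of size $3t$ such that $$\{F\in\Sigma_n:|F\cap X|=2t\}\subseteq\mathcal F\subseteq\{F\in\Sigma_n:|F\cap X|\ge 2t\}.$$ 2. $t=2$, and there is a Fano plane $(V,\mathcal L)$ whose point set $V$ is a $7$-point partial permutation such that $$\{F\in\Sigma_n: F\supseteq V\setminus L\text{ and }|F\cap L|\le 1\text{ for some }L\in\mathcal L\}\subseteq\mathcal F\subseteq\{F\in\Sigma_n:F\supseteq V\setminus L\text{ for some }L\in\mathcal L\}.$$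
   Context: $[n]=\{1,\dots,n\}$ and $\Sigma_n$ is the set of all permutations of $[n]$. A permutation $\sigma\in\Sigma_n$ is identified with the $n$-element set $\{(i,\sigma(i)):i\in[n]\}\subset[n]\times[n]$. A family $\mathcal F\subseteq\Sigma_n$ is $t$-intersecting if $|F\cap F'|\ge t$ for all $F,F'\in\mathcal F$. A set $S\subset[n]\times[n]$ is a partial permutation if it is contained in some permutation $\sigma\in\Sigma_n$. For $\mathcal F\subseteq\Sigma_n$ and a partial permutation $T$, $\mathcal F(\overline T)=\{F\in\mathcal F:F\cap T=\emptyset\}$. The $t$-diversity of $\mathcal F\subseteq\Sigma_n$ is $$\gamma_t(\mathcal F)=\min\{|\mathcal F(\overline T)|: T\text{ is a partial permutation with }|T|=t\}.$$ A Fano plane $(V,\mathcal L)$ is a projective plane of order $2$: $|V|=7$, $\mathcal L$ is a set of seven $3$-subsets (lines) of $V$, and every two distinct points of $V$ lie on exactly one line. *)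

theory Defs
  imports Complex_Main "HOL-Combinatorics.Permutations"
begin

text \<open>Permutations of \<open>[n] = {1..n}\<close>, each identified with its graph, a subset of \<open>[n] \<times> [n]\<close>.\<close>

definition perm_sets :: "nat \<Rightarrow> (nat \<times> nat) set set" where
  "perm_sets n = {(\<lambda>i. (i, \<sigma> i)) ` {1..n} | \<sigma>. \<sigma> permutes {1..n}}"

definition partial_perm :: "nat \<Rightarrow> (nat \<times> nat) set \<Rightarrow> bool" where
  "partial_perm n S \<longleftrightarrow> (\<exists>F \<in> perm_sets n. S \<subseteq> F)"

definition t_intersecting :: "nat \<Rightarrow> 'a set set \<Rightarrow> bool" where
  "t_intersecting t \<F> \<longleftrightarrow> (\<forall>F \<in> \<F>. \<forall>F' \<in> \<F>. t \<le> card (F \<inter> F'))"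

definition avoiding :: "'a set set \<Rightarrow> 'a set \<Rightarrow> 'a set set" where
  "avoiding \<F> T = {F \<in> \<F>. F \<inter> T = {}}"

text \<open>The minimum ranges over a finite set, which is nonempty exactly when \<open>t \<le> n\<close>; for
  \<open>n < t\<close> the value is unspecified.\<close>

definition diversity :: "nat \<Rightarrow> nat \<Rightarrow> (nat \<times> nat) set set \<Rightarrow> nat" where
  "diversity n t \<F> = Min {card (avoiding \<F> T) | T. partial_perm n T \<and> card T = t}"

definition fano_plane :: "'a set \<Rightarrow> 'a set set \<Rightarrow> bool" where
  "fano_plane V \<L> \<longleftrightarrow>
     card V = 7 \<and> card \<L> = 7 \<and> (\<forall>L \<in> \<L>. L \<subseteq> V \<and> card L = 3) \<and>
     (\<forall>x \<in> V. \<forall>y \<in> V. x \<noteq> y \<longrightarrow> (\<exists>!L. L \<in> \<L> \<and> x \<in> L \<and> y \<in> L))"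

end

theory Submission
  imports Defs "HOL-Probability.Hoeffding"
begin

text \<open>Call a set S of cells robust if, among the members of \<open>\<F>\<close> containing S, no further cell is
  much more frequent than it is in a random permutation. The number of these members disjoint
  outside S from a random permutation F is concentrated around its mean, by Azuma's inequality with
  F exposed row by row. As \<open>\<F>\<close> is t-intersecting, all but very few members of \<open>\<F>\<close> therefore meet S
  in at least t cells. Robust sets are found by maximizing a density potential, and large diversity
  provides one avoiding any given t-set T. Two rounds of this cover almost all members avoiding T by
  a number of 2t-sets depending on t only, so that one of these is heavy: \<open>\<F>\<close> contains a constant
  proportion of the permutations through it. A sunflower of robust sets with a heavy kernel shows that almost all
  members meet a heavy set in at least t cells.

  Heavy sets thus form a t-intersecting family of 2t-sets in which every half of a member is avoided
  by another member. Such a family contains all 2t-subsets of a 3t-set or, for t = 2, the complements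
  of the lines of a Fano plane. The halves determine their partners, so every heavy set is almost
  full, and then no member of \<open>\<F>\<close> can meet it in fewer than t cells. This bounds \<open>\<F>\<close> from above;
  the diversity hypothesis makes the bound on the members avoiding T an equality.\<close>

section \<open>Partial permutations\<close>

text \<open>The prescribed diversity is the number of permutations that contain a 2t-set
  \<open>Y\<close> and miss a t-set \<open>T\<close>, where \<open>Y \<union> T\<close> is a partial
  permutation. It is at least 999/1000 of (n - 2t)!, and this bound drives everything before the
  final equality argument. The obstacle is that a robust set may a priori have about log n cells, so
  that a naive cover uses a number of 2t-sets growing with n. It is overcome at the \<open>T\<close>
  whose robust set is largest: the maximal potential of this set bounds every term of the cover of
  the members avoiding \<open>T\<close>, which forces size at most 2t + 3 there and hence for all
  t-sets at once. The spread constant grows like 3^t as a compromise. The size argument needs its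
  fourth power to exceed (2t+4 choose t)^2, roughly 16^t, while the concentration error exp(-c n /
  w^2) has to beat powers up to n^(3t), which needs w^2, roughly 9^t, well below the rate 48^t that
  is guaranteed for n.\<close>

definition matching :: "nat \<Rightarrow> (nat \<times> nat) set \<Rightarrow> bool" where
  "matching n S \<longleftrightarrow> S \<subseteq> {1..n} \<times> {1..n} \<and> inj_on fst S \<and> inj_on snd S"

definition extensions :: "nat \<Rightarrow> (nat \<times> nat) set \<Rightarrow> (nat \<times> nat) set set" where
  "extensions n S = {F \<in> perm_sets n. S \<subseteq> F}"

lemma matching_subset: "matching n S \<Longrightarrow> S' \<subseteq> S \<Longrightarrow> matching n S'"
  unfolding matching_def by (auto intro: inj_on_subset)

lemma matching_finite: "matching n S \<Longrightarrow> finite S"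
  unfolding matching_def by (metis finite_SigmaI finite_atLeastAtMost finite_subset)

lemma matching_card_fst: "matching n S \<Longrightarrow> card (fst ` S) = card S"
  unfolding matching_def by (auto intro: card_image)

lemma matching_card_snd: "matching n S \<Longrightarrow> card (snd ` S) = card S"
  unfolding matching_def by (auto intro: card_image)

lemma matching_fst_subset: "matching n S \<Longrightarrow> fst ` S \<subseteq> {1..n}"
  unfolding matching_def by auto

lemma matching_snd_subset: "matching n S \<Longrightarrow> snd ` S \<subseteq> {1..n}"
  unfolding matching_def by auto

lemma matching_card_le: "matching n S \<Longrightarrow> card S \<le> n"
  using card_mono[OF _ matching_fst_subset, of n S] matching_card_fst[of n S] by simp

lemma matching_empty [simp]: "matching n {}"
  unfolding matching_def by simp

lemma matching_insert_iff:
  assumes "matching n S" "(i, j) \<notin> S"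
  shows "matching n (insert (i, j) S) \<longleftrightarrow> i \<in> {1..n} - fst ` S \<and> j \<in> {1..n} - snd ` S"
proof -
  obtain "S \<subseteq> {1..n} \<times> {1..n}" "inj_on fst S" "inj_on snd S"
    using assms(1) unfolding matching_def by auto
  then have "matching n (insert (i, j) S) \<longleftrightarrow>
      (i, j) \<in> {1..n} \<times> {1..n} \<and> i \<notin> fst ` (S - {(i, j)}) \<and> j \<notin> snd ` (S - {(i, j)})"
    unfolding matching_def by (auto simp: inj_on_insert simp del: insert_Diff_single)
  then show ?thesis using assms(2) by auto
qed

lemma matching_same_row: "matching n S \<Longrightarrow> (i, j) \<in> S \<Longrightarrow> (i, j') \<in> S \<Longrightarrow> j = j'"
  unfolding matching_def inj_on_def by fastforce

lemma matching_same_column: "matching n S \<Longrightarrow> (i, j) \<in> S \<Longrightarrow> (i', j) \<in> S \<Longrightarrow> i = i'"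
  unfolding matching_def inj_on_def by fastforce

text \<open>The conditions in \<open>matching\<close> involve at most two cells at a time. The point
  set of an extremal structure is recognized as a partial permutation in this way, since any two of
  its points lie in a common heavy set.\<close>

lemma matchingI_pairs:
  assumes "\<And>x y. x \<in> S \<Longrightarrow> y \<in> S \<Longrightarrow> matching n {x, y}"
  shows "matching n S"
  unfolding matching_def
proof (intro conjI subsetI inj_onI)
  fix x assume "x \<in> S"
  then show "x \<in> {1..n} \<times> {1..n}" using assms[of x x] unfolding matching_def by auto
next
  fix x y assume xy: "x \<in> S" "y \<in> S" and eq: "fst x = fst y"
  have "inj_on fst {x, y}" using assms[OF xy] by (simp add: matching_def)
  then show "x = y" by (rule inj_onD) (use eq in simp_all)
next
  fix x y assume xy: "x \<in> S" "y \<in> S" and eq: "snd x = snd y"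
  have "inj_on snd {x, y}" using assms[OF xy] by (simp add: matching_def)
  then show "x = y" by (rule inj_onD) (use eq in simp_all)
qed

lemma perm_sets_iff: "F \<in> perm_sets n \<longleftrightarrow> matching n F \<and> card F = n"
proof
  assume "F \<in> perm_sets n"
  then obtain \<sigma> where s: "\<sigma> permutes {1..n}" "F = (\<lambda>i. (i, \<sigma> i)) ` {1..n}"
    unfolding perm_sets_def by auto
  have "card F = n" unfolding s by (subst card_image) (auto simp: inj_on_def)
  moreover have "matching n F"
    using permutes_in_image[OF s(1)] permutes_inj[OF s(1)]
    unfolding matching_def s by (auto simp: inj_on_def)
  ultimately show "matching n F \<and> card F = n" by simp
next
  assume a: "matching n F \<and> card F = n"
  then have m: "matching n F" and c: "card F = n" by auto
  have f1: "fst ` F = {1..n}"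
    using matching_fst_subset[OF m] matching_card_fst[OF m] c
    by (intro card_subset_eq) auto
  have f2: "snd ` F = {1..n}"
    using matching_snd_subset[OF m] matching_card_snd[OF m] c
    by (intro card_subset_eq) auto
  \<comment> \<open>The identity outside \<open>{1..n}\<close>, as \<open>permutes\<close>
    demands.\<close>
  define \<sigma> where "\<sigma> i = (if i \<in> {1..n} then (THE j. (i, j) \<in> F) else i)" for i
  have s: "\<sigma> i = j" if "(i, j) \<in> F" for i j
  proof -
    have "i \<in> {1..n}" using that f1 by (metis fst_conv image_eqI)
    moreover have "(THE j. (i, j) \<in> F) = j"
      using that matching_same_row[OF m] by blast
    ultimately show ?thesis unfolding \<sigma>_def by simp
  qed
  have F: "F = (\<lambda>i. (i, \<sigma> i)) ` {1..n}"
  proof (intro set_eqI iffI)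
    fix x assume "x \<in> F"
    then show "x \<in> (\<lambda>i. (i, \<sigma> i)) ` {1..n}"
      using s f1 by (cases x) force
  next
    fix x assume "x \<in> (\<lambda>i. (i, \<sigma> i)) ` {1..n}"
    then obtain i where i: "i \<in> {1..n}" "x = (i, \<sigma> i)" by auto
    then obtain j where "(i, j) \<in> F" using f1 by force
    then show "x \<in> F" using s i by auto
  qed
  have "\<sigma> ` {1..n} = {1..n}"
    using f2 unfolding F image_image by simp
  then have "bij_betw \<sigma> {1..n} {1..n}"
    by (simp add: bij_betw_def finite_surj_inj)
  then have "\<sigma> permutes {1..n}"
    by (rule bij_imp_permutes) (auto simp: \<sigma>_def)
  with F show "F \<in> perm_sets n" unfolding perm_sets_def by auto
qed

lemma perm_sets_finite_mem: "F \<in> perm_sets n \<Longrightarrow> finite F"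
  unfolding perm_sets_iff using matching_finite by blast

lemma finite_perm_sets [simp]: "finite (perm_sets n)"
proof (rule finite_subset)
  show "perm_sets n \<subseteq> Pow ({1..n} \<times> {1..n})"
    unfolding perm_sets_iff matching_def subset_iff[of "perm_sets n"] by blast
qed simp

lemma finite_extensions [simp]: "finite (extensions n S)"
  unfolding extensions_def by simp

lemma extensions_empty [simp]: "extensions n {} = perm_sets n"
  unfolding extensions_def by simp

lemma perm_sets_row:
  assumes "F \<in> perm_sets n" "i \<in> {1..n}"
  shows "\<exists>!j. (i, j) \<in> F"
proof -
  have m: "matching n F" "card F = n" using assms(1) by (auto simp: perm_sets_iff)
  have "fst ` F = {1..n}"
    using matching_fst_subset[OF m(1)] matching_card_fst[OF m(1)] m
    by (intro card_subset_eq) auto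
  then obtain j where "(i, j) \<in> F" using assms(2) by force
  then show ?thesis using matching_same_row[OF m(1)] by blast
qed

lemma extensions_split_row:
  assumes S: "matching n S" and i: "i \<in> {1..n} - fst ` S"
  shows "extensions n S = (\<Union>j\<in>{1..n} - snd ` S. extensions n (insert (i, j) S))"
proof (intro set_eqI iffI)
  fix F assume F: "F \<in> extensions n S"
  then obtain j where j: "(i, j) \<in> F"
    using perm_sets_row[of F n i] i unfolding extensions_def by blast
  have m: "matching n (insert (i, j) S)"
    using F j by (auto simp: extensions_def perm_sets_iff elim!: matching_subset)
  have "(i, j) \<notin> S" using i by force
  then have "j \<in> {1..n} - snd ` S" using matching_insert_iff[OF S] m by simp
  then show "F \<in> (\<Union>j\<in>{1..n} - snd ` S. extensions n (insert (i, j) S))"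
    using F j by (auto simp: extensions_def)
qed (auto simp: extensions_def)

lemma extensions_row_disjoint:
  "j \<noteq> j' \<Longrightarrow> extensions n (insert (i, j) S) \<inter> extensions n (insert (i, j') S) = {}"
  using matching_same_row[of n] by (auto simp: extensions_def perm_sets_iff)

lemma sum_extensions_split_row:
  assumes S: "matching n S" and i: "i \<in> {1..n} - fst ` S"
  shows "sum g (extensions n S) = (\<Sum>j\<in>{1..n} - snd ` S. sum g (extensions n (insert (i, j) S)))"
  unfolding extensions_split_row[OF S i]
  by (rule sum.UNION_disjoint) (auto dest: extensions_row_disjoint)

lemma matching_card_free:
  "matching n S \<Longrightarrow> card ({1..n} - snd ` S) = n - card S"
  "matching n S \<Longrightarrow> card ({1..n} - fst ` S) = n - card S"
  using matching_snd_subset[of n S] matching_fst_subset[of n S]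
    matching_card_snd[of n S] matching_card_fst[of n S]
  by (auto simp: card_Diff_subset finite_subset[OF _ finite_atLeastAtMost])

lemma extensions_full:
  assumes "matching n S" "card S = n"
  shows "extensions n S = {S}"
proof -
  have "F = S" if "F \<in> extensions n S" for F
  proof -
    have "S \<subseteq> F" "card F = n" "finite F"
      using that by (auto simp: extensions_def perm_sets_iff matching_finite)
    then show ?thesis using assms(2) by (metis card_subset_eq)
  qed
  then show ?thesis using assms by (auto simp: extensions_def perm_sets_iff)
qed

lemma matching_free_row:
  assumes "matching n S" "card S < n"
  obtains i where "i \<in> {1..n} - fst ` S"
  using matching_card_free(2)[OF assms(1)] assms(2)
  by (metis card.empty ex_in_conv zero_less_diff less_irrefl)

lemma card_extensions:
  assumes "matching n S"
  shows "card (extensions n S) = fact (n - card S)"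
  using assms
proof (induction "n - card S" arbitrary: S)
  case 0
  then have "card S = n" using matching_card_le[of n S] by simp
  then show ?case using extensions_full 0 by simp
next
  case (Suc m)
  obtain i where i: "i \<in> {1..n} - fst ` S"
    by (rule matching_free_row[OF Suc(3)]) (use Suc(2) in simp_all)
  have *: "card (extensions n (insert (i, j) S)) = fact m" if j: "j \<in> {1..n} - snd ` S" for j
  proof -
    have ij: "(i, j) \<notin> S" using i by force
    have "matching n (insert (i, j) S)"
      using matching_insert_iff[OF Suc(3) ij] i j by simp
    moreover have "card (insert (i, j) S) = Suc (card S)"
      using ij matching_finite[OF Suc(3)] by simp
    moreover have "m = n - Suc (card S)" using Suc(2) by simp
    ultimately show ?thesis using Suc(1)[of "insert (i, j) S"] by simp
  qed
  have "card (extensions n S) = (\<Sum>j\<in>{1..n} - snd ` S. card (extensions n (insert (i, j) S)))"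
    using sum_extensions_split_row[OF Suc(3) i, of "\<lambda>_. 1 :: nat"] by simp
  also have "\<dots> = (n - card S) * fact m"
    using * matching_card_free(1)[OF Suc(3)] by simp
  finally show ?case using Suc(2) by (metis fact_Suc of_nat_id)
qed

lemma extensions_nonempty: "matching n S \<Longrightarrow> extensions n S \<noteq> {}"
  using card_extensions[of n S] by auto

lemma partial_perm_iff: "partial_perm n S \<longleftrightarrow> matching n S"
proof
  assume "partial_perm n S"
  then obtain F where "F \<in> perm_sets n" "S \<subseteq> F"
    unfolding partial_perm_def by blast
  then show "matching n S" unfolding perm_sets_iff using matching_subset by blast
next
  assume "matching n S"
  from extensions_nonempty[OF this] show "partial_perm n S"
    unfolding partial_perm_def extensions_def by blast
qed

lemma card_extensions_le: "card (extensions n S) \<le> fact (n - card S)"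
proof (cases "matching n S")
  case False
  then have "extensions n S = {}"
    using matching_subset[of n _ S] by (auto simp: extensions_def perm_sets_iff)
  then show ?thesis by simp
qed (simp add: card_extensions)

section \<open>Factorial moments and inclusion-exclusion over extensions\<close>

lemma sum_choose_inter:
  fixes \<G> :: "'a set set"
  assumes "finite \<G>" "finite D"
  shows "(\<Sum>F\<in>\<G>. card (F \<inter> D) choose k) = (\<Sum>U | U \<subseteq> D \<and> card U = k. card {F \<in> \<G>. U \<subseteq> F})"
proof -
  have "card (F \<inter> D) choose k = card {U. U \<subseteq> D \<and> card U = k \<and> U \<subseteq> F}" for F
  proof -
    have "{U. U \<subseteq> D \<and> card U = k \<and> U \<subseteq> F} = {U. U \<subseteq> F \<inter> D \<and> card U = k}" by auto
    then show ?thesis using n_subsets[of "F \<inter> D" k] assms(2) by simp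
  qed
  then have "(\<Sum>F\<in>\<G>. card (F \<inter> D) choose k)
      = (\<Sum>F\<in>\<G>. \<Sum>U | U \<subseteq> D \<and> card U = k. if U \<subseteq> F then 1 else 0)"
    using assms(2) by (auto simp: sum.If_cases Int_def conj_assoc intro!: sum.cong)
  also have "\<dots> = (\<Sum>U | U \<subseteq> D \<and> card U = k. \<Sum>F\<in>\<G>. if U \<subseteq> F then 1 else 0)"
    by (rule sum.swap)
  also have "\<dots> = (\<Sum>U | U \<subseteq> D \<and> card U = k. card {F \<in> \<G>. U \<subseteq> F})"
    using assms(1) by (intro sum.cong) (auto simp: sum.If_cases Int_def)
  finally show ?thesis .
qed

text \<open>Each \<open>k\<close>-subset \<open>U\<close> of \<open>D\<close> contributes the
  extensions of \<open>H \<union> U\<close>. When \<open>H \<union> D\<close> is a full permutation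
  and \<open>k \<le> card D\<close>, this says that the \<open>k\<close>-th factorial moment of
  \<open>card (F \<inter> D)\<close> is 1.\<close>

lemma sum_choose_extensions:
  assumes "matching n (H \<union> D)" "H \<inter> D = {}"
  shows "(\<Sum>F\<in>extensions n H. card (F \<inter> D) choose k) = (card D choose k) * fact (n - card H - k)"
proof -
  have fD: "finite D" "finite H" using matching_finite[OF assms(1)] by auto
  have "(\<Sum>F\<in>extensions n H. card (F \<inter> D) choose k)
      = (\<Sum>U | U \<subseteq> D \<and> card U = k. card {F \<in> extensions n H. U \<subseteq> F})"
    by (rule sum_choose_inter) (use fD in auto)
  also have "\<dots> = (\<Sum>U | U \<subseteq> D \<and> card U = k. fact (n - card H - k))"
  proof (rule sum.cong[OF refl])
    fix U assume "U \<in> {U. U \<subseteq> D \<and> card U = k}"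
    then have U: "U \<subseteq> D" "card U = k" by auto
    have "{F \<in> extensions n H. U \<subseteq> F} = extensions n (H \<union> U)" by (auto simp: extensions_def)
    moreover have "card (H \<union> U) = card H + k"
      using U assms(2) fD by (subst card_Un_disjoint) (auto intro: finite_subset)
    ultimately show "card {F \<in> extensions n H. U \<subseteq> F} = fact (n - card H - k)"
      using card_extensions[of n "H \<union> U"] matching_subset[OF assms(1), of "H \<union> U"] U(1) by auto
  qed
  also have "\<dots> = (card D choose k) * fact (n - card H - k)"
    using n_subsets[OF fD(1), of k] by simp
  finally show ?thesis .
qed

text \<open>The alternating binomial sum is the indicator of \<open>F \<inter> T = {}\<close>. For
  \<open>card Y = 2 * t\<close> the right side is the diversity prescribed in the theorem.\<close>

lemma card_extensions_avoiding:
  assumes "matching n (Y \<union> T)" "Y \<inter> T = {}" "card T = t"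
  shows "int (card {F \<in> extensions n Y. F \<inter> T = {}})
    = (\<Sum>i=0..t. (-1) ^ i * int (t choose i) * fact (n - card Y - i))"
proof -
  have fT: "finite T" using matching_finite[OF assms(1)] by auto
  have alt: "(\<Sum>i=0..t. (-1) ^ i * int (card (F \<inter> T) choose i)) = (if F \<inter> T = {} then 1 else 0)" for F
  proof -
    have le: "card (F \<inter> T) \<le> t" using assms(3) fT by (metis Int_lower2 card_mono)
    have "(\<Sum>i=0..t. (-1) ^ i * int (card (F \<inter> T) choose i))
        = (\<Sum>i\<le>card (F \<inter> T). (-1) ^ i * int (card (F \<inter> T) choose i))"
      by (rule sum.mono_neutral_right) (use le in auto)
    then show ?thesis using choose_alternating_sum[of "card (F \<inter> T)", where 'a = int] fT
      by (auto simp: card_gt_0_iff)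
  qed
  have "int (card {F \<in> extensions n Y. F \<inter> T = {}})
      = (\<Sum>F\<in>extensions n Y. if F \<inter> T = {} then 1 else 0)"
    by (simp add: sum.If_cases Int_def)
  also have "\<dots> = (\<Sum>F\<in>extensions n Y. \<Sum>i=0..t. (-1) ^ i * int (card (F \<inter> T) choose i))"
    by (simp add: alt)
  also have "\<dots> = (\<Sum>i=0..t. \<Sum>F\<in>extensions n Y. (-1) ^ i * int (card (F \<inter> T) choose i))"
    by (rule sum.swap)
  also have "\<dots> = (\<Sum>i=0..t. (-1) ^ i * int (\<Sum>F\<in>extensions n Y. card (F \<inter> T) choose i))"
    by (simp add: sum_distrib_left)
  also have "\<dots> = (\<Sum>i=0..t. (-1) ^ i * int (t choose i) * fact (n - card Y - i))"
    unfolding sum_choose_extensions[OF assms(1,2)] assms(3) by (simp add: mult.assoc)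
  finally show ?thesis .
qed

text \<open>For \<open>x > 0\<close> the truncated sum equals -(x - 1 choose 5), which is
  nonpositive because the last index is odd. With five terms the resulting constant 11/30 is already
  close to 1/e.\<close>

lemma bonferroni_five:
  "(\<Sum>k\<le>5. (-1) ^ k * real (x choose k)) \<le> (if x = 0 then 1 else 0)"
proof (cases x)
  case (Suc y)
  have "(\<Sum>k\<le>5. (-1) ^ k * real (x choose k)) = (\<Sum>k\<le>5. (real x gchoose k) * (-1) ^ k)"
    by (simp add: binomial_gbinomial mult.commute)
  also have "\<dots> = - (real x - 1 gchoose 5)"
    by (subst gbinomial_sum_lower_neg) simp
  also have "real x - 1 = real y" using Suc by simp
  finally show ?thesis using Suc by (simp flip: binomial_gbinomial)
qed (simp add: numeral_eq_Suc)

text \<open>A random permutation meets a fixed one in a number of cells whose first factorial moments are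
  all 1, and 1 - 1 + 1/2 - 1/6 + 1/24 - 1/120 = 11/30.\<close>

lemma card_avoiding_ge:
  assumes H: "matching n H" and B: "matching n B" and large: "n - card H \<ge> 5"
  shows "11 / 30 * fact (n - card H) \<le> real (card {F \<in> extensions n H. F \<inter> B \<subseteq> H})"
proof -
  define m where "m = n - card H"
  \<comment> \<open>An extension of \<open>H\<close> can use a cell of \<open>B\<close> outside
    \<open>H\<close> only in a free row and a free column. Completing \<open>H \<union> B'\<close>
    to a permutation \<open>G\<close> makes avoidance harder but the moments exact.\<close>
  define B' where "B' = {x \<in> B. fst x \<notin> fst ` H \<and> snd x \<notin> snd ` H}"
  have HB: "matching n (H \<union> B')"
    unfolding matching_def
  proof (intro conjI)
    show "H \<union> B' \<subseteq> {1..n} \<times> {1..n}" using H B unfolding matching_def B'_def by blast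
    have "inj_on fst B'" "inj_on snd B'"
      using B unfolding matching_def B'_def by (auto intro: inj_on_subset)
    moreover have "inj_on fst H" "inj_on snd H" using H unfolding matching_def by auto
    moreover have free: "fst ` (H - B') \<inter> fst ` (B' - H) = {}" "snd ` (H - B') \<inter> snd ` (B' - H) = {}"
    proof -
      have "x \<in> H \<Longrightarrow> y \<in> B' \<Longrightarrow> fst x \<noteq> fst y \<and> snd x \<noteq> snd y" for x y
        unfolding B'_def by (metis (no_types, lifting) image_eqI mem_Collect_eq)
      then show "fst ` (H - B') \<inter> fst ` (B' - H) = {}" "snd ` (H - B') \<inter> snd ` (B' - H) = {}"
        by blast+
    qed
    ultimately show "inj_on fst (H \<union> B')" "inj_on snd (H \<union> B')"
      unfolding inj_on_Un using free by blast+
  qed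
  obtain G where G: "G \<in> perm_sets n" "H \<union> B' \<subseteq> G"
    using extensions_nonempty[OF HB] unfolding extensions_def by blast
  define D where "D = G - H"
  have GD: "H \<union> D = G" "H \<inter> D = {}" using G unfolding D_def by auto
  have mG: "matching n (H \<union> D)" "card G = n" "finite G"
    using perm_sets_finite_mem[OF G(1)] G(1) GD(1) by (simp_all add: perm_sets_iff)
  have cD: "card D = m"
    unfolding D_def m_def using mG G(2) by (subst card_Diff_subset) (auto intro: finite_subset)
  have sub: "{F \<in> extensions n H. F \<inter> D = {}} \<subseteq> {F \<in> extensions n H. F \<inter> B \<subseteq> H}"
  proof safe
    fix F a b assume F: "F \<in> extensions n H" "F \<inter> D = {}" "(a, b) \<in> F" "(a, b) \<in> B"
    have mF: "matching n F" "H \<subseteq> F" using F(1) unfolding extensions_def perm_sets_iff by auto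
    show "(a, b) \<in> H"
    proof (rule ccontr)
      assume nH: "(a, b) \<notin> H"
      have "a \<notin> fst ` H" using matching_same_row[OF mF(1) F(3)] mF(2) nH by fastforce
      moreover have "b \<notin> snd ` H" using matching_same_column[OF mF(1) F(3)] mF(2) nH by fastforce
      ultimately have "(a, b) \<in> B'" using F(4) unfolding B'_def by simp
      then have "(a, b) \<in> D" using G(2) nH unfolding D_def by blast
      then show False using F(2,3) by auto
    qed
  qed
  have fD: "finite D" using mG(3) unfolding D_def by auto
  have "11 / 30 * fact m = (\<Sum>k\<le>5. (-1) ^ k * (fact m / fact k :: real))"
    by (simp add: numeral_eq_Suc algebra_simps)
  also have "\<dots> = (\<Sum>k\<le>5. (-1) ^ k * real ((m choose k) * fact (m - k)))"
    using large unfolding m_def[symmetric]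
    by (intro sum.cong) (auto simp: binomial_fact)
  also have "\<dots> = (\<Sum>k\<le>5. (-1) ^ k * real (\<Sum>F\<in>extensions n H. card (F \<inter> D) choose k))"
    unfolding sum_choose_extensions[OF mG(1) GD(2)] cD m_def by simp
  also have "\<dots> = (\<Sum>k\<le>5. \<Sum>F\<in>extensions n H. (-1) ^ k * real (card (F \<inter> D) choose k))"
    by (simp add: sum_distrib_left)
  also have "\<dots> = (\<Sum>F\<in>extensions n H. \<Sum>k\<le>5. (-1) ^ k * real (card (F \<inter> D) choose k))"
    by (rule sum.swap)
  also have "\<dots> \<le> (\<Sum>F\<in>extensions n H. if card (F \<inter> D) = 0 then 1 else 0)"
    by (rule sum_mono) (rule bonferroni_five)
  also have "\<dots> = real (card {F \<in> extensions n H. F \<inter> D = {}})"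
    using fD by (simp add: sum.If_cases Int_def)
  also have "\<dots> \<le> real (card {F \<in> extensions n H. F \<inter> B \<subseteq> H})"
    using sub by (simp add: card_mono)
  finally show ?thesis unfolding m_def .
qed

section \<open>Concentration on the symmetric group\<close>

text \<open>Hoeffding's lemma for the uniform distribution on \<open>J\<close>. Only pairwise
  differences are bounded, which is what a column swap provides.\<close>

lemma sum_exp_le_hoeffding:
  fixes x :: "'a \<Rightarrow> real"
  assumes J: "finite J" "J \<noteq> {}" and l: "l > 0"
    and c: "\<And>j k. j \<in> J \<Longrightarrow> k \<in> J \<Longrightarrow> x j - x k \<le> c"
  shows "(\<Sum>j\<in>J. exp (l * x j)) \<le> card J * exp (l * (sum x J / card J) + l\<^sup>2 * c\<^sup>2 / 8)"
proof -
  define a where "a = Min (x ` J)"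
  define b where "b = Max (x ` J)"
  define \<mu> where "\<mu> = sum x J / card J"
  have mem: "a \<in> x ` J" "b \<in> x ` J" unfolding a_def b_def using J by (auto intro: Min_in Max_in)
  then have ba: "b - a \<le> c" using c by auto
  have ab: "a \<le> b" unfolding a_def b_def using J mem by (metis Max.coboundedI a_def finite_imageI)
  interpret interval_bounded_random_variable "measure_pmf (pmf_of_set J)" x a b
  proof unfold_locales
    show "AE y in measure_pmf (pmf_of_set J). x y \<in> {a..b}"
      using J by (auto simp: AE_measure_pmf_iff a_def b_def)
  qed auto
  have E: "measure_pmf.expectation (pmf_of_set J) x = \<mu>"
    unfolding \<mu>_def using J by (simp add: integral_pmf_of_set)
  have "ennreal ((\<Sum>j\<in>J. exp (l * (x j - \<mu>))) / card J)
      = (\<Sum>j\<in>J. ennreal (exp (l * (x j - \<mu>)))) / card J"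
    using J by (subst sum_ennreal) (auto simp: divide_ennreal ennreal_of_nat_eq_real_of_nat card_gt_0_iff sum_nonneg)
  also have "\<dots> = nn_integral (measure_pmf (pmf_of_set J)) (\<lambda>j. exp (l * (x j - \<mu>)))"
    using J by (simp add: nn_integral_pmf_of_set)
  also have "\<dots> \<le> ennreal (exp (l\<^sup>2 * (b - a)\<^sup>2 / 8))"
    using Hoeffdings_lemma_nn_integral[OF l] unfolding E .
  finally have "(\<Sum>j\<in>J. exp (l * (x j - \<mu>))) / card J \<le> exp (l\<^sup>2 * (b - a)\<^sup>2 / 8)"
    by (subst (asm) ennreal_le_iff) auto
  also have "\<dots> \<le> exp (l\<^sup>2 * c\<^sup>2 / 8)"
    using ab ba by (simp add: mult_left_mono power_mono)
  finally have "(\<Sum>j\<in>J. exp (l * (x j - \<mu>))) \<le> card J * exp (l\<^sup>2 * c\<^sup>2 / 8)"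
    using J by (simp add: field_simps card_gt_0_iff)
  then have "exp (l * \<mu>) * (\<Sum>j\<in>J. exp (l * (x j - \<mu>))) \<le> exp (l * \<mu>) * (card J * exp (l\<^sup>2 * c\<^sup>2 / 8))"
    by (rule mult_left_mono) simp
  also have "exp (l * \<mu>) * (\<Sum>j\<in>J. exp (l * (x j - \<mu>))) = (\<Sum>j\<in>J. exp (l * x j))"
    by (simp add: sum_distrib_left algebra_simps flip: exp_add)
  finally show ?thesis unfolding \<mu>_def[symmetric] by (simp add: exp_add mult_ac)
qed

section \<open>Column swaps and Azuma's inequality\<close>

definition swap_columns :: "nat \<Rightarrow> nat \<Rightarrow> (nat \<times> nat) set \<Rightarrow> (nat \<times> nat) set" where
  "swap_columns j j' F = (\<lambda>x. (fst x, Transposition.transpose j j' (snd x))) ` F"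

lemma swap_columns_involutory [simp]: "swap_columns j j' (swap_columns j j' F) = F"
  unfolding swap_columns_def image_image by simp

lemma swap_columns_commute: "swap_columns j j' = swap_columns j' j"
  unfolding swap_columns_def by (simp add: transpose_commute)

lemma swap_columns_perm_sets:
  assumes "F \<in> perm_sets n" "j \<in> {1..n}" "j' \<in> {1..n}"
  shows "swap_columns j j' F \<in> perm_sets n"
proof -
  obtain \<sigma> where s: "\<sigma> permutes {1..n}" "F = (\<lambda>i. (i, \<sigma> i)) ` {1..n}"
    using assms(1) unfolding perm_sets_def by auto
  have "Transposition.transpose j j' \<circ> \<sigma> permutes {1..n}"
    using s(1) permutes_swap_id[OF assms(2,3)] by (rule permutes_compose)
  moreover have "swap_columns j j' F = (\<lambda>i. (i, (Transposition.transpose j j' \<circ> \<sigma>) i)) ` {1..n}"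
    unfolding swap_columns_def s(2) image_image by simp
  ultimately show ?thesis unfolding perm_sets_def by blast
qed

lemma swap_columns_extensions:
  assumes "F \<in> extensions n (insert (i, j) S)" "j \<in> {1..n} - snd ` S" "j' \<in> {1..n} - snd ` S"
  shows "swap_columns j j' F \<in> extensions n (insert (i, j') S)"
proof -
  have F: "F \<in> perm_sets n" "(i, j) \<in> F" "S \<subseteq> F" using assms(1) unfolding extensions_def by auto
  have "(i, j') \<in> swap_columns j j' F"
    using F(2) unfolding swap_columns_def by force
  moreover have "S \<subseteq> swap_columns j j' F"
  proof
    fix x assume x: "x \<in> S"
    then have "snd x \<noteq> j" "snd x \<noteq> j'" using assms(2,3) by auto
    then have "x = (fst x, Transposition.transpose j j' (snd x))" by (simp add: Transposition.transpose_def)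
    then show "x \<in> swap_columns j j' F" using x F(3) unfolding swap_columns_def by blast
  qed
  ultimately show ?thesis
    using swap_columns_perm_sets[OF F(1), of j j'] assms(2,3) unfolding extensions_def by auto
qed

lemma sum_extensions_swap:
  assumes "j \<in> {1..n} - snd ` S" "j' \<in> {1..n} - snd ` S"
  shows "sum h (extensions n (insert (i, j') S)) =
    (\<Sum>F\<in>extensions n (insert (i, j) S). h (swap_columns j j' F))"
proof (rule sum.reindex_bij_betw[symmetric])
  show "bij_betw (swap_columns j j') (extensions n (insert (i, j) S)) (extensions n (insert (i, j') S))"
    by (rule bij_betw_byWitness[where f' = "swap_columns j j'"])
       (use swap_columns_extensions[of _ n i j S j'] swap_columns_extensions[of _ n i j' S j] assms
          swap_columns_commute[of j j'] in auto)
qed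

text \<open>Exposing the permutation row by row gives a martingale whose increments are bounded by c,
  because a transposition of columns matches the extensions of two possible values in a row.\<close>

lemma sum_exp_extensions_le:
  fixes h :: "(nat \<times> nat) set \<Rightarrow> real"
  assumes l: "l > 0" and S: "matching n S"
    and lip: "\<And>F j j'. F \<in> perm_sets n \<Longrightarrow> j \<in> {1..n} \<Longrightarrow> j' \<in> {1..n} \<Longrightarrow>
      h (swap_columns j j' F) - h F \<le> c"
  shows "(\<Sum>F\<in>extensions n S. exp (l * h F)) \<le> fact (n - card S) *
    exp (l * (sum h (extensions n S) / fact (n - card S)) + l\<^sup>2 * c\<^sup>2 / 8 * real (n - card S))"
  using S
proof (induction "n - card S" arbitrary: S)
  case 0
  then have "card S = n" using matching_card_le[of n S] by simp
  then show ?case using extensions_full 0 by simp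
next
  case (Suc m)
  obtain i where i: "i \<in> {1..n} - fst ` S"
    by (rule matching_free_row[OF Suc(3)]) (use Suc(2) in simp_all)
  define J where "J = {1..n} - snd ` S"
  define X where "X j = sum h (extensions n (insert (i, j) S)) / fact m" for j
  define K where "K = l\<^sup>2 * c\<^sup>2 / 8"
  have J: "finite J" "card J = Suc m" using Suc matching_card_free(1)[OF Suc(3)] unfolding J_def by auto
  have ext: "matching n (insert (i, j) S)" "m = n - card (insert (i, j) S)" if "j \<in> J" for j
  proof -
    have ij: "(i, j) \<notin> S" using i by force
    show "matching n (insert (i, j) S)"
      using matching_insert_iff[OF Suc(3) ij] i that unfolding J_def by simp
    show "m = n - card (insert (i, j) S)"
      using ij matching_finite[OF Suc(3)] Suc(2) by simp
  qed
  have XX: "X j' - X j \<le> c" if "j' \<in> J" "j \<in> J" for j j'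
  proof -
    have "X j' - X j = (\<Sum>F\<in>extensions n (insert (i, j) S). h (swap_columns j j' F) - h F) / fact m"
      unfolding X_def using sum_extensions_swap[of j n S j' h i] that
      by (simp add: J_def sum_subtractf diff_divide_distrib)
    also have "\<dots> \<le> (\<Sum>F\<in>extensions n (insert (i, j) S). c) / fact m"
      using that by (intro divide_right_mono sum_mono lip) (auto simp: extensions_def J_def)
    also have "\<dots> = c" using card_extensions[OF ext(1)[OF that(2)]] ext(2)[OF that(2)] by simp
    finally show ?thesis .
  qed
  have sumX: "sum X J = sum h (extensions n S) / fact m"
    unfolding sum_extensions_split_row[OF Suc(3) i, of h] X_def J_def by (simp add: sum_divide_distrib)
  have "(\<Sum>F\<in>extensions n S. exp (l * h F))
      = (\<Sum>j\<in>J. \<Sum>F\<in>extensions n (insert (i, j) S). exp (l * h F))"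
    unfolding J_def by (rule sum_extensions_split_row[OF Suc(3) i])
  \<comment> \<open>The induction hypothesis bounds the sum for each value \<open>j\<close> of row
    \<open>i\<close> through the conditional mean \<open>X j\<close>; Hoeffding's lemma then
    averages over \<open>j\<close>.\<close>
  also have "\<dots> \<le> (\<Sum>j\<in>J. fact m * exp (l * X j + K * real m))"
    using Suc(1)[OF ext(2,1)] ext(2) unfolding X_def K_def by (intro sum_mono) (metis (no_types, lifting))
  also have "\<dots> = fact m * exp (K * real m) * (\<Sum>j\<in>J. exp (l * X j))"
    by (simp add: sum_distrib_left exp_add mult_ac)
  also have "\<dots> \<le> fact m * exp (K * real m) * (card J * exp (l * (sum X J / card J) + K))"
    unfolding K_def
    by (intro mult_left_mono sum_exp_le_hoeffding) (use J l XX in auto)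
  also have "\<dots> = fact (Suc m) * exp (l * (sum h (extensions n S) / fact (Suc m)) + K * real (Suc m))"
    unfolding J sumX by (simp add: exp_add algebra_simps)
  finally show ?case using Suc(2) unfolding K_def by simp
qed

lemma card_perm_sets_nonpos_le:
  fixes h :: "(nat \<times> nat) set \<Rightarrow> real"
  assumes n: "n > 0" and c: "c > 0" and \<mu>: "\<mu> > 0"
    and lip: "\<And>F j j'. F \<in> perm_sets n \<Longrightarrow> j \<in> {1..n} \<Longrightarrow> j' \<in> {1..n} \<Longrightarrow>
      h F - h (swap_columns j j' F) \<le> c"
    and mean: "\<mu> * fact n \<le> sum h (perm_sets n)"
  shows "real (card {F \<in> perm_sets n. h F \<le> 0}) \<le> fact n * exp (- 2 * \<mu>\<^sup>2 / (n * c\<^sup>2))"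
proof -
  \<comment> \<open>Minimizes the exponent \<open>- l * \<mu> + l^2 * c^2 * n / 8\<close>.\<close>
  define l where "l = 4 * \<mu> / (n * c\<^sup>2)"
  have l: "l > 0" unfolding l_def using assms by simp
  have "real (card {F \<in> perm_sets n. h F \<le> 0}) = (\<Sum>F\<in>{F \<in> perm_sets n. h F \<le> 0}. 1)" by simp
  also have "\<dots> \<le> (\<Sum>F\<in>{F \<in> perm_sets n. h F \<le> 0}. exp (l * - h F))"
    using l by (intro sum_mono) (auto intro: mult_nonneg_nonpos)
  also have "\<dots> \<le> (\<Sum>F\<in>perm_sets n. exp (l * - h F))"
    by (rule sum_mono2) auto
  also have "\<dots> \<le> fact n * exp (l * ((\<Sum>F\<in>perm_sets n. - h F) / fact n) + l\<^sup>2 * c\<^sup>2 / 8 * real n)"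
    using sum_exp_extensions_le[OF l matching_empty, of n "\<lambda>F. - h F" c] lip by simp
  also have "\<dots> \<le> fact n * exp (l * (- \<mu>) + l\<^sup>2 * c\<^sup>2 / 8 * real n)"
  proof -
    have "(\<Sum>F\<in>perm_sets n. - h F) / fact n \<le> - \<mu>"
      using mean by (simp add: sum_negf field_simps)
    from mult_left_mono[OF this, of l] show ?thesis using l by simp
  qed
  also have "l * (- \<mu>) + l\<^sup>2 * c\<^sup>2 / 8 * real n = - 2 * \<mu>\<^sup>2 / (n * c\<^sup>2)"
    unfolding l_def using n c by (simp add: field_simps power2_eq_square)
  finally show ?thesis .
qed

text \<open>The function to which concentration is applied is the proportion of members of \<open>\<A>\<close> that
  meet F only inside S.\<close>

lemma card_blocked_le:
  fixes \<delta> :: real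
  assumes A: "\<A> \<subseteq> extensions n S" "\<A> \<noteq> {}" and n: "n \<ge> 5" and \<delta>: "\<delta> > 0"
    and spread: "\<And>x. x \<notin> S \<Longrightarrow> real (card {A \<in> \<A>. x \<in> A}) \<le> \<delta> * card \<A>"
  shows "real (card {F \<in> perm_sets n. \<forall>A\<in>\<A>. \<not> A \<inter> F \<subseteq> S})
    \<le> fact n * exp (- 2 * (11 / 30)\<^sup>2 / (n * (2 * \<delta>)\<^sup>2))"
proof -
  have fA: "finite \<A>" using A(1) finite_extensions finite_subset by blast
  have cA: "real (card \<A>) > 0" using fA A(2) by (simp add: card_gt_0_iff)
  define h where "h F = real (card {A \<in> \<A>. A \<inter> F \<subseteq> S}) / card \<A>" for F
  have "{F \<in> perm_sets n. \<forall>A\<in>\<A>. \<not> A \<inter> F \<subseteq> S} = {F \<in> perm_sets n. h F \<le> 0}"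
  proof -
    have "h F \<le> 0 \<longleftrightarrow> {A \<in> \<A>. A \<inter> F \<subseteq> S} = {}" for F
    proof -
      have "h F \<le> 0 \<longleftrightarrow> card {A \<in> \<A>. A \<inter> F \<subseteq> S} = 0"
        unfolding h_def using cA by (auto simp: divide_le_0_iff)
      then show ?thesis using fA by simp
    qed
    then show ?thesis by auto
  qed
  moreover have "real (card {F \<in> perm_sets n. h F \<le> 0})
    \<le> fact n * exp (- 2 * (11 / 30)\<^sup>2 / (n * (2 * \<delta>)\<^sup>2))"
  proof (rule card_perm_sets_nonpos_le)
    fix F j j' assume F: "F \<in> perm_sets n" and jj: "j \<in> {1..n}" "j' \<in> {1..n}"
    \<comment> \<open>A swap moves only the cells of \<open>F\<close> in the columns
      \<open>j\<close> and \<open>j'\<close>, at most two. A member counted for \<open>F\<close> but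
      not for the swapped permutation contains one of the new cells outside \<open>S\<close>, so
      \<open>h\<close> drops by at most \<open>2 * \<delta>\<close>.\<close>
    define Y where "Y = {x \<in> F. snd x \<in> {j, j'}}"
    define X where "X = (\<lambda>x. (fst x, Transposition.transpose j j' (snd x))) ` Y - S"
    have fF: "finite F" "inj_on snd F"
      using perm_sets_finite_mem[OF F] F by (simp_all add: perm_sets_iff matching_def)
    have "card Y = card (snd ` Y)"
      using fF(2) by (intro card_image[symmetric]) (auto simp: Y_def intro: inj_on_subset)
    also have "\<dots> \<le> card {j, j'}" unfolding Y_def by (intro card_mono) auto
    also have "\<dots> \<le> 2" by (simp add: card_insert_if)
    finally have cY: "card Y \<le> 2" .
    have fY: "finite Y" unfolding Y_def using fF(1) by auto
    have cX: "card X \<le> 2"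
      unfolding X_def using cY card_image_le[OF fY] card_Diff_subset_Int
      by (meson Diff_subset card_mono fY finite_imageI le_trans)
    have fX: "finite X" unfolding X_def using fY by auto
    have "{A \<in> \<A>. A \<inter> F \<subseteq> S} \<subseteq> {A \<in> \<A>. A \<inter> swap_columns j j' F \<subseteq> S} \<union> (\<Union>x\<in>X. {A \<in> \<A>. x \<in> A})"
    proof
      fix A assume "A \<in> {A \<in> \<A>. A \<inter> F \<subseteq> S}"
      then have a: "A \<in> \<A>" "A \<inter> F \<subseteq> S" by auto
      show "A \<in> {A \<in> \<A>. A \<inter> swap_columns j j' F \<subseteq> S} \<union> (\<Union>x\<in>X. {A \<in> \<A>. x \<in> A})"
      proof (cases "A \<inter> swap_columns j j' F \<subseteq> S")
        case False
        then obtain x where x: "x \<in> A" "x \<in> swap_columns j j' F" "x \<notin> S" by auto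
        then obtain y where y: "y \<in> F" "x = (fst y, Transposition.transpose j j' (snd y))"
          unfolding swap_columns_def by auto
        have "snd y \<in> {j, j'}"
        proof (rule ccontr)
          assume "snd y \<notin> {j, j'}"
          then have "x = y" using y(2) by (simp add: Transposition.transpose_def)
          then show False using x a y by auto
        qed
        then have "x \<in> X" unfolding X_def Y_def using y x(3) by blast
        then show ?thesis using a x by auto
      qed (use a in auto)
    qed
    then have "card {A \<in> \<A>. A \<inter> F \<subseteq> S} \<le> card ({A \<in> \<A>. A \<inter> swap_columns j j' F \<subseteq> S} \<union> (\<Union>x\<in>X. {A \<in> \<A>. x \<in> A}))"
      using fA fX by (intro card_mono) auto
    also have "\<dots> \<le> card {A \<in> \<A>. A \<inter> swap_columns j j' F \<subseteq> S} + card (\<Union>x\<in>X. {A \<in> \<A>. x \<in> A})"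
      by (rule card_Un_le)
    also have "\<dots> \<le> card {A \<in> \<A>. A \<inter> swap_columns j j' F \<subseteq> S} + (\<Sum>x\<in>X. card {A \<in> \<A>. x \<in> A})"
      using card_UN_le[OF fX] by auto
    finally have "real (card {A \<in> \<A>. A \<inter> F \<subseteq> S})
      \<le> real (card {A \<in> \<A>. A \<inter> swap_columns j j' F \<subseteq> S} + (\<Sum>x\<in>X. card {A \<in> \<A>. x \<in> A}))"
      by (rule of_nat_mono)
    also have "\<dots> = real (card {A \<in> \<A>. A \<inter> swap_columns j j' F \<subseteq> S})
      + (\<Sum>x\<in>X. real (card {A \<in> \<A>. x \<in> A}))" by simp
    also have "(\<Sum>x\<in>X. real (card {A \<in> \<A>. x \<in> A})) \<le> (\<Sum>x\<in>X. \<delta> * card \<A>)"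
      by (intro sum_mono spread) (auto simp: X_def)
    also have "\<dots> \<le> 2 * (\<delta> * card \<A>)"
      using cX \<delta> by (simp add: mult_right_mono)
    finally show "h F - h (swap_columns j j' F) \<le> 2 * \<delta>"
      unfolding h_def using cA by (simp add: field_simps)
  next
    \<comment> \<open>The mean is bounded by exchanging sums: each fixed \<open>A\<close> meets a
      random permutation only inside \<open>S\<close> with probability at least 11/30.\<close>
    have "11 / 30 * fact n * real (card \<A>) = (\<Sum>A\<in>\<A>. 11 / 30 * fact n)" by simp
    also have "\<dots> \<le> (\<Sum>A\<in>\<A>. real (card {F \<in> perm_sets n. A \<inter> F \<subseteq> S}))"
    proof (rule sum_mono)
      fix A assume "A \<in> \<A>"
      then have "A \<in> extensions n S" using A(1) by blast
      then have "matching n A" by (simp add: extensions_def perm_sets_iff)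
      then have "matching n (A - S)" by (rule matching_subset) blast
      from card_avoiding_ge[OF matching_empty this] n
      have "11 / 30 * fact n \<le> real (card {F \<in> perm_sets n. F \<inter> (A - S) \<subseteq> {}})" by simp
      also have "{F \<in> perm_sets n. F \<inter> (A - S) \<subseteq> {}} = {F \<in> perm_sets n. A \<inter> F \<subseteq> S}" by auto
      finally show "11 / 30 * fact n \<le> real (card {F \<in> perm_sets n. A \<inter> F \<subseteq> S})" .
    qed
    also have "\<dots> = (\<Sum>A\<in>\<A>. \<Sum>F\<in>perm_sets n. if A \<inter> F \<subseteq> S then 1 else 0)"
      by (simp add: sum.If_cases Int_def)
    also have "\<dots> = (\<Sum>F\<in>perm_sets n. \<Sum>A\<in>\<A>. if A \<inter> F \<subseteq> S then 1 else 0)"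
      by (rule sum.swap)
    also have "\<dots> = (\<Sum>F\<in>perm_sets n. real (card {A \<in> \<A>. A \<inter> F \<subseteq> S}))"
      using fA by (simp add: sum.If_cases Int_def)
    finally show "11 / 30 * fact n \<le> sum h (perm_sets n)"
      unfolding h_def sum_divide_distrib[symmetric] using cA by (simp add: field_simps)
  qed (use n \<delta> in auto)
  ultimately show ?thesis by simp
qed

section \<open>Numerical estimates\<close>

lemma choose_step:
  assumes "k \<le> m"
  shows "(m + 2 choose (k + 1)) * ((k + 1) * (m + 1 - k)) = (m choose k) * ((m + 2) * (m + 1))"
proof -
  have "(k + 1) * (m + 2 choose (k + 1)) = (m + 2) * (m + 1 choose k)"
    using Suc_times_binomial[of k "m + 1"] by simp
  moreover have "(m + 1 - k) * (m + 1 choose k) = (m + 1) * (m choose k)"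
    using binomial_absorb_comp[of "m + 1" k] by simp
  ultimately show ?thesis by (metis mult.assoc mult.commute mult.left_commute)
qed

text \<open>With t = s + 1 the left side is (2t + a choose t), and \<open>x\<close> bounds the ratio
  of consecutive values. In both uses below \<open>x\<close> is the ratio at \<open>s = 0\<close>,
  where it is largest.\<close>

lemma choose_geometric:
  fixes a :: nat and x :: real
  assumes base: "real (2 + a choose 1) \<le> c"
    and step: "\<And>s :: nat. real ((2 * s + a + 4) * (2 * s + a + 3)) \<le> x * real ((s + 2) * (s + a + 2))"
    and x: "x \<ge> 0"
  shows "real (2 * s + a + 2 choose (s + 1)) \<le> c * x ^ s"
proof (induction s)
  case (Suc s)
  define A where "A = real ((s + 2) * (s + a + 2))"
  have A: "A > 0" unfolding A_def of_nat_0_less_iff by simp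
  have "(2 * Suc s + a + 2 choose (Suc s + 1)) * ((s + 2) * (s + a + 2))
      = (2 * s + a + 2 choose (s + 1)) * ((2 * s + a + 4) * (2 * s + a + 3))"
  proof -
    have e: "2 * Suc s + a + 2 = (2 * s + a + 2) + 2" "Suc s + 1 = (s + 1) + 1" "s + 2 = (s + 1) + 1"
      "s + a + 2 = (2 * s + a + 2) + 1 - (s + 1)" "2 * s + a + 4 = (2 * s + a + 2) + 2"
      "2 * s + a + 3 = (2 * s + a + 2) + 1" by simp_all
    show ?thesis
      by (subst e(1), subst e(2), subst e(3), subst e(4), subst e(5), subst e(6), rule choose_step) simp
  qed
  then have "real (2 * Suc s + a + 2 choose (Suc s + 1)) * A
      = real (2 * s + a + 2 choose (s + 1)) * real ((2 * s + a + 4) * (2 * s + a + 3))"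
    unfolding A_def of_nat_mult[symmetric] by (rule arg_cong)
  also have "\<dots> \<le> (c * x ^ s) * (x * A)"
    unfolding A_def by (intro mult_mono Suc step) (use base x in auto)
  finally show ?case using A by (simp add: mult_ac)
qed (use base in simp)

lemma e_gt_2718: "exp 1 > (2718 / 1000 :: real)"
proof -
  have "(\<Sum>k<7. (1 :: real) ^ k /\<^sub>R fact k) \<le> exp 1"
    unfolding exp_def by (rule sum_le_suminf) (use summable_exp_generic[of "1 :: real"] in auto)
  then show ?thesis by (simp add: numeral_eq_Suc)
qed

text \<open>From \<open>exp (u - 1) \<ge> u\<close> at \<open>u = y / k\<close>, with 2.718 in place
  of e.\<close>

lemma exp_ge_power:
  assumes "y \<ge> 0" "k > 0"
  shows "exp y \<ge> (2718 / 1000 * y / real k) ^ k"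
proof -
  have "2718 / 1000 * (y / real k) \<le> exp 1 * exp (y / real k - 1)"
    using e_gt_2718 exp_ge_add_one_self[of "y / real k - 1"] assms by (intro mult_mono) auto
  also have "\<dots> = exp (y / real k)" by (simp flip: exp_add)
  finally have "(2718 / 1000 * (y / real k)) ^ k \<le> exp (y / real k) ^ k"
    using assms by (intro power_mono) auto
  also have "\<dots> = exp y" using assms by (simp flip: exp_of_nat_mult)
  finally show ?thesis by simp
qed

text \<open>Equality holds at \<open>s = 0\<close>. From \<open>s\<close> to \<open>s + 1\<close>
  the left side grows at least by the factor 16(s + 3), which is at least 48, because
  \<open>(s + 2) ^ (s + 1)\<close> is at least twice \<open>(s + 1) ^ (s + 1)\<close>. The geometric
  form is what the later estimates are compared with.\<close>

lemma threshold_ge: "130 * (s + 2) * (8 * (s + 1)) ^ (s + 1) \<ge> (2080 * 48 ^ s :: nat)"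
proof (induction s)
  case (Suc s)
  have "(s + 1) ^ (s + 1) + (s + 1) * (s + 1) ^ s \<le> (s + 2) ^ (s + 1)"
  proof -
    have "(s + 2) ^ (s + 1) = (\<Sum>k\<le>s + 1. (s + 1 choose k) * (s + 1) ^ k)"
      using binomial[of "s + 1" 1 "s + 1"] by (simp add: add.commute)
    also have "\<dots> \<ge> (\<Sum>k\<in>{s, s + 1}. (s + 1 choose k) * (s + 1) ^ k)"
      by (rule sum_mono2) auto
    finally show ?thesis by simp
  qed
  then have "2 * (s + 1) ^ (s + 1) \<le> (s + 2) ^ (s + 1)" by simp
  then have "8 ^ (s + 1) * (2 * (s + 1) ^ (s + 1)) \<le> 8 ^ (s + 1) * (s + 2) ^ (s + 1)" by (rule mult_left_mono) simp
  then have *: "2 * (8 * (s + 1)) ^ (s + 1) \<le> (8 * (s + 2)) ^ (s + 1)"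
    by (simp only: power_mult_distrib mult_ac)
  define P where "P = (8 * (s + 1)) ^ (s + 1)"
  have "(2080 * 48 ^ Suc s :: nat) = 48 * (2080 * 48 ^ s)" by simp
  also have "\<dots> \<le> 48 * (130 * (s + 2) * P)" using Suc unfolding P_def by (rule mult_left_mono) simp
  also have "\<dots> \<le> 16 * (s + 3) * (130 * (s + 2) * P)" by (rule mult_right_mono) auto
  also have "\<dots> = 130 * (s + 3) * (8 * (s + 2)) * (2 * P)" by (simp add: algebra_simps)
  also have "\<dots> \<le> 130 * (s + 3) * (8 * (s + 2)) * (8 * (s + 2)) ^ (s + 1)"
    using * unfolding P_def by (rule mult_left_mono) simp
  also have "\<dots> = 130 * (Suc s + 2) * (8 * (Suc s + 1)) ^ (Suc s + 1)"
    by (simp add: numeral_3_eq_3 mult_ac)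
  finally show ?case .
qed simp

text \<open>A family is called spread when no cell outside its kernel occurs in more than a fraction
  w/n of its members; this is the value of w used throughout.\<close>

definition spread_const :: "nat \<Rightarrow> real" where
  "spread_const t = 5 / 2 * 3 ^ (t - 1)"

text \<open>The error term of \<open>card_blocked_le\<close> for a spread of
  \<open>w / (n - card S)\<close> with \<open>100 * card S \<le> n\<close>. Here w^2 is 25/4 times
  9^(t-1), and 95 absorbs the numerical constants.\<close>

definition exception_rate :: "nat \<Rightarrow> nat \<Rightarrow> real" where
  "exception_rate n t = exp (- (real n / (95 * 9 ^ (t - 1))))"

text \<open>The number of choices of a t-subset in a set of size 2t + 3, followed by a t-subset in a
  second such set: the number of 2t-sets in a two-round cover.\<close>

definition cover_bound :: "nat \<Rightarrow> real" where
  "cover_bound t = real (2 * t + 3 choose t) ^ 2"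

locale large_n =
  fixes n t :: nat
  assumes t_pos: "t \<ge> 1" and n_ge: "n \<ge> 130 * (t + 1) * (8 * t) ^ t"
begin

abbreviation "w \<equiv> spread_const t"
abbreviation "N \<equiv> cover_bound t"
text \<open>Bounds the number of exceptional members for one robust set in units of
  \<open>fact (n - 2 * t)\<close>; the power of \<open>n\<close> comes from
  \<open>fact n\<close>.\<close>

abbreviation "\<epsilon> \<equiv> real n ^ (2 * t) * exception_rate n t"

lemma n_ge_48: "n \<ge> 2080 * 48 ^ (t - 1)"
  using threshold_ge[of "t - 1"] n_ge t_pos by (simp add: algebra_simps)

lemma n_ge_48_real: "real n \<ge> 2080 * 48 ^ (t - 1)"
  using of_nat_mono[OF n_ge_48, where 'a = real] by simp

lemma w_ge: "w \<ge> 5 / 2"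
  unfolding spread_const_def by simp

lemma w_ge': "t \<ge> 2 \<Longrightarrow> w \<ge> 15 / 2"
  using power_increasing[of 1 "t - 1" "3 :: real"] unfolding spread_const_def by simp

lemma N_le: "N \<le> 25 * (441 / 25) ^ (t - 1)"
proof -
  have "real (2 * s + 5 choose (s + 1)) \<le> 5 * (21 / 5) ^ s" for s
  proof -
    have "real (2 * s + 3 + 2 choose (s + 1)) \<le> 5 * (21 / 5) ^ s"
    proof (rule choose_geometric)
      fix s :: nat
      have "real ((2 * s + 3 + 4) * (2 * s + 3 + 3)) = 4 * (real s)\<^sup>2 + 26 * real s + 42"
        by (simp add: power2_eq_square algebra_simps)
      moreover have "21 / 5 * real ((s + 2) * (s + 3 + 2)) = 21 / 5 * (real s)\<^sup>2 + 147 / 5 * real s + 42"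
        by (simp add: power2_eq_square algebra_simps)
      ultimately show "real ((2 * s + 3 + 4) * (2 * s + 3 + 3)) \<le> 21 / 5 * real ((s + 2) * (s + 3 + 2))"
        using zero_le_power2[of "real s"] by linarith
    qed simp_all
    then show ?thesis by (simp add: ac_simps)
  qed
  from this[of "t - 1"] have "real (2 * t + 3 choose t) \<le> 5 * (21 / 5) ^ (t - 1)"
    using t_pos by (simp add: algebra_simps)
  then have "N \<le> (5 * (21 / 5) ^ (t - 1)) ^ 2" unfolding cover_bound_def by (rule power_mono) simp
  then show ?thesis by (simp add: power_mult_distrib power2_eq_square flip: power_mult_distrib)
qed

lemma N_ge: "N \<ge> 25"
proof -
  have "2 * t + 3 \<le> (2 * t + 3 choose t)"
  proof -
    have "(2 * t + 3 choose 1) \<le> (2 * t + 3 choose t)" by (rule binomial_mono) (use t_pos in auto)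
    then show ?thesis by simp
  qed
  then have "5 \<le> (2 * t + 3 choose t)" using t_pos by linarith
  then have "(5 :: real) ^ 2 \<le> N" unfolding cover_bound_def by (intro power_mono) auto
  then show ?thesis by simp
qed

text \<open>\<open>N\<close> is the square of a number that is at least 5 and at least the left
  side.\<close>

lemma central_le: "real (2 * t choose t) \<le> N / 5"
proof -
  have "(2 * t choose t) \<le> (2 * t + 3 choose t)" by (rule binomial_right_mono) simp
  then have *: "real (2 * t choose t) \<le> real (2 * t + 3 choose t)" by simp
  have "real (2 * t + 3 choose t) ^ 2 \<ge> 5 ^ 2" using N_ge unfolding cover_bound_def by simp
  then have "real (2 * t + 3 choose t) \<ge> 5" by (rule power2_le_imp_le) simp
  then have "5 * real (2 * t + 3 choose t) \<le> real (2 * t + 3 choose t) * real (2 * t + 3 choose t)"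
    by (rule mult_right_mono) simp
  then show ?thesis using * unfolding cover_bound_def power2_eq_square by linarith
qed

text \<open>Deleting the members through one of 5(2t + 1) further cells, the total size of 2t + 1
  petals, costs a heavy set at most 5(2t + 1) times \<open>fact (n - 2 * t - 1)\<close>. By this
  estimate that is at most half of its members.\<close>

lemma deletions_small: "20 * real (2 * t + 1) * N \<le> real n - 2 * real t"
proof -
  have *: "500 * real (2 * s + 3) * (441 / 25) ^ s + 2 * real (s + 1) \<le> 2080 * 48 ^ s" for s :: nat
  proof (induction s)
    case (Suc s)
    have "500 * real (2 * Suc s + 3) * (441 / 25) ^ Suc s + 2 * real (Suc s + 1)
      \<le> 48 * (500 * real (2 * s + 3) * (441 / 25) ^ s + 2 * real (s + 1))"
    proof -
      have "500 * real (2 * Suc s + 3) * (441 / 25) ^ Suc s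
        = (441 / 25) * real (2 * s + 5) * (500 * (441 / 25) ^ s)" by simp
      also have "\<dots> \<le> 48 * real (2 * s + 3) * (500 * (441 / 25) ^ s)"
        by (rule mult_right_mono) auto
      also have "\<dots> = 48 * (500 * real (2 * s + 3) * (441 / 25) ^ s)" by simp
      finally show ?thesis unfolding distrib_left by (intro add_mono) auto
    qed
    also have "\<dots> \<le> 48 * (2080 * 48 ^ s)" using Suc by simp
    finally show ?case by simp
  qed simp
  have "20 * real (2 * t + 1) * N \<le> 20 * real (2 * t + 1) * (25 * (441 / 25) ^ (t - 1))"
    using N_le by (intro mult_left_mono) auto
  also have "\<dots> \<le> real n - 2 * real t"
    using *[of "t - 1"] n_ge_48_real t_pos by (simp add: algebra_simps of_nat_diff)
  finally show ?thesis .
qed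

lemma n_large: "real n - 2 * real t \<ge> 1500 * real t"
proof -
  show ?thesis
  proof (cases "t = 1")
    case True
    then show ?thesis using n_ge_48_real by simp
  next
    case False
    have "real (2 * t + 1) * N \<ge> real (2 * t + 1) * 441" 
    proof (intro mult_left_mono)
      have "(2 * t + 3 choose 2) \<le> (2 * t + 3 choose t)"
        by (rule binomial_mono) (use t_pos False in auto)
      moreover have "(7 choose 2) \<le> (2 * t + 3 choose 2)"
        by (rule binomial_right_mono) (use t_pos False in auto)
      ultimately have "21 \<le> (2 * t + 3 choose t)" by (simp add: choose_two)
      then have "(21 :: real) ^ 2 \<le> N" unfolding cover_bound_def by (intro power_mono) auto
      then show "441 \<le> N" by simp
    qed simp
    then have "20 * (real (2 * t + 1) * 441) \<le> 20 * (real (2 * t + 1) * N)"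
      by (rule mult_left_mono) simp
    also have "\<dots> = 20 * real (2 * t + 1) * N" by (simp only: mult.assoc)
    also note deletions_small
    finally show ?thesis by simp
  qed
qed

text \<open>For larger \<open>q\<close> the discount \<open>w ^ (q - 2 * t)\<close> outweighs the
  number of pairs of t-subsets in the cover. At t = 1 and q = 6 it reads 36 against 0.93 times
  (5/2)^4, which is where the factor 5/2 in \<open>w\<close> comes from; 93/100 leaves room for the
  exceptional members.\<close>

lemma choose_square_le:
  assumes "q \<ge> 2 * t + 4"
  shows "real (q choose t) ^ 2 \<le> 93 / 100 * w ^ (q - 2 * t)"
  using assms
proof (induction q rule: dec_induct)
  case base
  have "real (2 * s + 6 choose (s + 1)) \<le> 6 * (14 / 3) ^ s" for s
  proof -
    have "real (2 * s + 4 + 2 choose (s + 1)) \<le> 6 * (14 / 3) ^ s"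
    proof (rule choose_geometric)
      fix s :: nat
      have "real ((2 * s + 4 + 4) * (2 * s + 4 + 3)) = 4 * (real s)\<^sup>2 + 30 * real s + 56"
        by (simp add: power2_eq_square algebra_simps)
      moreover have "14 / 3 * real ((s + 2) * (s + 4 + 2)) = 14 / 3 * (real s)\<^sup>2 + 112 / 3 * real s + 56"
        by (simp add: power2_eq_square algebra_simps)
      ultimately show "real ((2 * s + 4 + 4) * (2 * s + 4 + 3)) \<le> 14 / 3 * real ((s + 2) * (s + 4 + 2))"
        using zero_le_power2[of "real s"] by linarith
    qed simp_all
    then show ?thesis by (simp add: ac_simps)
  qed
  from this[of "t - 1"] have "real (2 * t + 4 choose t) \<le> 6 * (14 / 3) ^ (t - 1)"
    using t_pos by (simp add: algebra_simps)
  then have "real (2 * t + 4 choose t) ^ 2 \<le> (6 * (14 / 3) ^ (t - 1)) ^ 2" by (rule power_mono) simp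
  also have "\<dots> = 36 * (196 / 9) ^ (t - 1)"
    by (simp add: power_mult_distrib power2_eq_square flip: power_mult_distrib)
  also have "\<dots> \<le> 93 / 100 * (625 / 16) * 81 ^ (t - 1)"
    by (intro mult_mono power_mono) auto
  also have "\<dots> = 93 / 100 * w ^ 4"
    unfolding spread_const_def by (simp add: power_mult_distrib power4_eq_xxxx flip: power_mult_distrib)
  finally show ?case by simp
next
  case (step q)
  have q: "q \<ge> 2 * t + 4" using step by simp
  have eq: "real (q + 1 - t) * real (Suc q choose t) = real (q + 1) * real (q choose t)"
    using arg_cong[OF binomial_absorb_comp[of "Suc q" t], of real] unfolding of_nat_mult by simp
  have ratio: "real (q + 1) ^ 2 \<le> w * real (q + 1 - t) ^ 2"
  proof (cases "t = 1")
    case True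
    have "real (q + 1) \<le> 7 / 6 * real q" using q True by simp
    then have "real (q + 1) ^ 2 \<le> (7 / 6 * real q) ^ 2" by (rule power_mono) simp
    also have "\<dots> \<le> 5 / 2 * real q ^ 2" by (simp add: power2_eq_square)
    finally show ?thesis using True by (simp add: spread_const_def)
  next
    case False
    have "real (q + 1) \<le> 2 * real (q + 1 - t)" using q by simp
    then have "real (q + 1) ^ 2 \<le> (2 * real (q + 1 - t)) ^ 2" by (rule power_mono) simp
    also have "\<dots> = 4 * real (q + 1 - t) ^ 2" by (simp add: power2_eq_square)
    also have "\<dots> \<le> w * real (q + 1 - t) ^ 2"
      using w_ge' False t_pos by (intro mult_right_mono) auto
    finally show ?thesis .
  qed
  have pos: "real (q + 1 - t) ^ 2 > 0" using q by simp
  have "real (q + 1 - t) ^ 2 * real (Suc q choose t) ^ 2 = real (q + 1) ^ 2 * real (q choose t) ^ 2"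
    using arg_cong[OF eq, of "\<lambda>x. x ^ 2"] by (simp only: power_mult_distrib)
  also have "\<dots> \<le> (w * real (q + 1 - t) ^ 2) * (93 / 100 * w ^ (q - 2 * t))"
    using ratio step w_ge by (intro mult_mono) auto
  also have "\<dots> = real (q + 1 - t) ^ 2 * (93 / 100 * w ^ (Suc q - 2 * t))"
    using q by (simp add: Suc_diff_le mult_ac)
  finally show ?case using pos by (simp only: mult_le_cancel_left_pos)
qed

text \<open>Limits a petal to 5 cells: each cell of it costs a factor \<open>w\<close> in the
  potential, and at least a proportion 1/(4N) of the permutations through the kernel is
  available.\<close>

lemma petal_power: "4 * N < w ^ 6"
proof -
  have "4 * N \<le> 100 * (441 / 25) ^ (t - 1)" using N_le by simp
  also have "\<dots> \<le> 100 * 729 ^ (t - 1)" by (intro mult_left_mono power_mono) auto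
  also have "\<dots> < 15625 / 64 * 729 ^ (t - 1)" by simp
  also have "\<dots> = w ^ 6"
    unfolding spread_const_def
    by (simp add: power_mult_distrib numeral_eq_Suc mult_ac flip: power_mult_distrib)
  finally show ?thesis .
qed

text \<open>Controls the permutations meeting 2t + 2 petals of at most 5 cells. The bound used for
  the left side grows by 441 per unit of t, the right side at least by 48^2 = 2304. With one petal
  less, only a single factor of order n would stand against 441.\<close>

lemma transversals_small: "5 ^ (2 * t + 2) * N \<le> 1 / 10 * ((real n - 2 * real t) * (real n - 2 * real t - 1))"
proof -
  have half: "real n / 2 \<le> real n - 2 * real t - 1" using n_large t_pos by simp
  have "(5 :: real) ^ (2 * t + 2) = 625 * 25 ^ (t - 1)"
  proof -
    have "2 * t + 2 = 4 + 2 * (t - 1)" using t_pos by simp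
    then show ?thesis by (simp add: power_add power_mult)
  qed
  then have "5 ^ (2 * t + 2) * N \<le> 625 * 25 ^ (t - 1) * (25 * (441 / 25) ^ (t - 1))"
    using N_le by (simp add: mult_left_mono)
  also have "\<dots> = 15625 * 441 ^ (t - 1)" by (simp flip: power_mult_distrib)
  also have "\<dots> \<le> 1 / 40 * 2080 ^ 2 * 2304 ^ (t - 1)" by (intro mult_mono power_mono) auto
  also have "\<dots> = 1 / 10 * ((2080 * 48 ^ (t - 1)) / 2 * ((2080 * 48 ^ (t - 1)) / 2))"
    by (simp add: power2_eq_square flip: power_mult_distrib)
  also have "\<dots> \<le> 1 / 10 * (real n / 2 * (real n / 2))"
    using n_ge_48_real by (intro mult_left_mono mult_mono divide_right_mono) auto
  also have "\<dots> \<le> 1 / 10 * ((real n - 2 * real t) * (real n - 2 * real t - 1))"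
    using half by (intro mult_left_mono mult_mono) auto
  finally show ?thesis .
qed

text \<open>Maximizers of the potential satisfy the hypothesis. They are then small enough to occupy
  at most one percent of the rows, as the concentration estimate requires.\<close>

lemma size_small:
  assumes "w ^ q \<le> 11 / 10 * real n ^ (2 * t)"
  shows "100 * q \<le> n"
proof (rule ccontr)
  assume "\<not> 100 * q \<le> n"
  then have q: "n < 100 * q" by simp
  \<comment> \<open>Amounts to a comparison of 2t-th roots: \<open>w ^ q\<close> is at least the
    2t-th power of \<open>(5 / 2) ^ m\<close>, while \<open>n < 100 * q\<close> is at most quadratic
    in \<open>m\<close> because \<open>m \<ge> 10 * t\<close>.\<close>
  define m where "m = q div (2 * t)"
  have "20 * 48 ^ (t - 1) \<le> q" using n_ge_48 q by simp
  have tt: "20 * t ^ 2 \<le> q"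
  proof -
    have "(s + 1) ^ 2 \<le> 48 ^ s" for s :: nat
    proof (induction s)
      case (Suc s)
      have "(Suc s + 1) ^ 2 \<le> 48 * (s + 1) ^ 2" by (simp add: power2_eq_square)
      also have "\<dots> \<le> 48 * 48 ^ s" using Suc by simp
      finally show ?case by simp
    qed simp
    from this[of "t - 1"] have "t ^ 2 \<le> 48 ^ (t - 1)" using t_pos by simp
    then show ?thesis using \<open>20 * 48 ^ (t - 1) \<le> q\<close> by simp
  qed
  have m10: "10 * t \<le> m"
    unfolding m_def using tt t_pos by (simp add: less_eq_div_iff_mult_less_eq power2_eq_square)
  have qm: "2 * t * m \<le> q" unfolding m_def by simp
  have qm2: "q < 2 * t * (m + 1)"
    unfolding m_def using t_pos by (metis Suc_eq_plus1 dividend_less_times_div mult_Suc_right nat_0_less_mult_iff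
        not_gr0 not_one_le_zero zero_less_numeral add.commute)
  have growth: "22 * real k * (real k + 1) \<le> (5 / 2) ^ k" if "k \<ge> 10" for k :: nat
    using that
  proof (induction k rule: dec_induct)
    case (step k)
    have "22 * real (Suc k) * (real (Suc k) + 1) = 22 * (real k + 1) * (real k + 2)" by (simp add: algebra_simps)
    also have "\<dots> \<le> 22 * (real k + 1) * (5 / 2 * real k)"
      using step by (intro mult_left_mono) auto
    also have "\<dots> = 5 / 2 * (22 * real k * (real k + 1))" by simp
    also have "\<dots> \<le> 5 / 2 * (5 / 2) ^ k" using step by simp
    finally show ?case by simp
  qed (simp add: power_divide)
  have "11 / 10 * real n ^ (2 * t) \<le> (11 / 10 * real n) ^ (2 * t)"
  proof -
    have "(11 / 10 :: real) ^ 1 \<le> (11 / 10) ^ (2 * t)" by (rule power_increasing) (use t_pos in auto)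
    then have "(11 / 10) ^ 1 * real n ^ (2 * t) \<le> (11 / 10) ^ (2 * t) * real n ^ (2 * t)"
      by (rule mult_right_mono) simp
    then show ?thesis unfolding power_mult_distrib by simp
  qed
  also have "\<dots> < (22 * real m * (real m + 1)) ^ (2 * t)"
  proof (rule power_strict_mono)
    have "real n < 100 * real q" using q by (metis of_nat_less_iff of_nat_mult of_nat_numeral)
    also have "real q \<le> 2 * real t * (real m + 1)"
      using of_nat_mono[OF less_imp_le[OF qm2], where 'a = real] by (simp add: algebra_simps)
    also have "\<dots> \<le> (real m / 5) * (real m + 1)"
      using of_nat_mono[OF m10, where 'a = real] by (intro mult_right_mono) auto
    finally show "11 / 10 * real n < 22 * real m * (real m + 1)" by simp
  qed (use t_pos in auto)
  also have "\<dots> \<le> ((5 / 2) ^ m) ^ (2 * t)"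
    using m10 t_pos by (intro power_mono growth) auto
  also have "\<dots> = (5 / 2) ^ (2 * t * m)" by (simp add: mult.commute flip: power_mult)
  also have "\<dots> \<le> (5 / 2) ^ q" using qm by (intro power_increasing) auto
  also have "\<dots> \<le> w ^ q" using w_ge by (intro power_mono) auto
  finally show False using assms by simp
qed

lemma exception_rate_t1:
  assumes "t = 1"
  shows "3 * 10 ^ 9 * (real n / 2080) ^ 3 * exception_rate n t \<le> 1"
proof -
  define y where "y = real n / 2080"
  have y: "y \<ge> 1" unfolding y_def using n_ge_48_real assms by simp
  \<comment> \<open>\<open>exp_ge_power\<close> is sharpest when the exponent equals the argument;
    22 is the integer nearest to 2080/95, the value of \<open>n / 95\<close> at
    \<open>y = 1\<close>.\<close>
  have "(2704 / 1000) ^ 22 * y ^ 22 = (2704 / 1000 * y) ^ 22" by (rule power_mult_distrib[symmetric])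
  also have "\<dots> \<le> (2718 / 1000 * (real n / 95) / real 22) ^ 22"
  proof (rule power_mono)
    show "2704 / 1000 * y \<le> 2718 / 1000 * (real n / 95) / real 22" unfolding y_def by simp
  qed (use y in simp)
  also have "\<dots> \<le> exp (real n / 95)" by (rule exp_ge_power) auto
  finally have *: "(2704 / 1000) ^ 22 * y ^ 22 \<le> exp (real n / 95)" .
  have "3 * 10 ^ 9 * y ^ 3 \<le> (2704 / 1000) ^ 22 * y ^ 22"
    using y by (intro mult_mono power_increasing) (auto simp: power_divide)
  then have "3 * 10 ^ 9 * y ^ 3 \<le> exp (real n / 95)" using * by linarith
  then have "3 * 10 ^ 9 * y ^ 3 * exp (- (real n / 95)) \<le> exp (real n / 95) * exp (- (real n / 95))"
    by (rule mult_right_mono) simp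
  then show ?thesis unfolding exception_rate_def y_def using assms by (simp flip: exp_add)
qed

lemma exception_rate_t2:
  assumes "t \<ge> 2"
  shows "(4 * real n) ^ (3 * t) * exception_rate n t \<le> 1"
proof -
  obtain r where r: "t = r + 2" using assms by (metis add.commute le_Suc_ex)
  have tr: "real t \<le> 2 * (3 / 2) ^ r"
    unfolding r
  proof (induction r)
    case (Suc r)
    have "real (Suc r + 2) \<le> 3 / 2 * real (r + 2)" by simp
    also have "\<dots> \<le> 3 / 2 * (2 * (3 / 2) ^ r)" using Suc by simp
    finally show ?case by simp
  qed simp
  define y where "y = real n / (95 * 9 ^ (t - 1))"
  \<comment> \<open>A lower bound for the base in \<open>exp_ge_power\<close> with exponent 24t. Its
    eighth power is at least \<open>4 * n\<close>, so the 24t factors yield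
    \<open>(4 * n) ^ (3 * t)\<close>.\<close>
  define z where "z = 2718 / 1000 / (95 * 24 * 18 * (27 / 2) ^ r) * real n"
  have nr: "real n \<ge> 99840 * 48 ^ r" using n_ge_48_real unfolding r by simp
  have "9 ^ (t - 1) * real t \<le> 9 ^ (t - 1) * (2 * (3 / 2) ^ r)" using tr by simp
  also have "\<dots> = 18 * (27 / 2) ^ r" unfolding r by (simp flip: power_mult_distrib)
  finally have "9 ^ (t - 1) * real t \<le> 18 * (27 / 2) ^ r" .
  then have zy: "z \<le> 2718 / 1000 * y / real (24 * t)"
  proof -
    have "z = (2718 / 1000 * real n / (95 * 24)) / (18 * (27 / 2) ^ r)" unfolding z_def by simp
    also have "\<dots> \<le> (2718 / 1000 * real n / (95 * 24)) / (9 ^ (t - 1) * real t)"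
      by (rule divide_left_mono) (use assms \<open>9 ^ (t - 1) * real t \<le> 18 * (27 / 2) ^ r\<close> in auto)
    also have "\<dots> = 2718 / 1000 * y / real (24 * t)" unfolding y_def by simp
    finally show ?thesis .
  qed
  have z0: "z \<ge> 0" unfolding z_def by simp
  have "4 * real n \<le> z ^ 8"
  proof -
    define a :: real where "a = 2718 / 1000 / (95 * 24 * 18)"
    have za: "z = a * real n / (27 / 2) ^ r" unfolding z_def a_def by simp
    have b: "4 * ((27 / 2) ^ r) ^ 8 \<le> a ^ 8 * (99840 * 48 ^ r) ^ 7"
    proof -
      have "4 * ((27 / 2) ^ r) ^ 8 = 4 * (((27 / 2 :: real) ^ 8) ^ r)"
        by (simp add: mult.commute flip: power_mult)
      also have "\<dots> \<le> a ^ 8 * 99840 ^ 7 * ((48 ^ 7) ^ r)"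
        unfolding a_def by (intro mult_mono power_mono) (auto simp: power_divide)
      also have "\<dots> = a ^ 8 * (99840 * 48 ^ r) ^ 7"
        by (simp only: power_mult_distrib power_mult[symmetric] mult.commute[of r 7] mult.assoc)
      finally show ?thesis .
    qed
    also have "\<dots> \<le> a ^ 8 * real n ^ 7"
      using nr unfolding a_def by (intro mult_left_mono power_mono) auto
    finally have "4 * ((27 / 2) ^ r) ^ 8 * real n \<le> a ^ 8 * real n ^ 7 * real n"
      by (rule mult_right_mono) simp
    then show ?thesis unfolding za
      by (simp add: power_mult_distrib power_divide field_simps numeral_eq_Suc)
  qed
  then have "(4 * real n) ^ (3 * t) \<le> (z ^ 8) ^ (3 * t)" by (intro power_mono) auto
  also have "\<dots> = z ^ (24 * t)" by (simp flip: power_mult)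
  also have "\<dots> \<le> (2718 / 1000 * y / real (24 * t)) ^ (24 * t)" using zy z0 by (rule power_mono)
  also have "\<dots> \<le> exp y" by (rule exp_ge_power) (use assms in \<open>auto simp: y_def\<close>)
  finally have "(4 * real n) ^ (3 * t) * exp (- y) \<le> exp y * exp (- y)" by (rule mult_right_mono) simp
  then show ?thesis unfolding exception_rate_def y_def by (simp flip: exp_add)
qed

text \<open>For \<open>t \<ge> 2\<close> the spread constant exceeds 4, so
  \<open>q choose t \<le> 2 ^ q \<le> sqrt (w ^ q)\<close> is of order n^t. For \<open>t = 1\<close>
  it is only 5/2, and the linear bound \<open>q \<le> n / 100\<close> takes its place.\<close>

lemma exception_cover:
  assumes "w ^ q \<le> 11 / 10 * real n ^ (2 * t)"
  shows "(1 + real (q choose t)) * \<epsilon> \<le> 1 / 20"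
proof (cases "t = 1")
  case True
  have p0: "exception_rate n t \<ge> 0" unfolding exception_rate_def by simp
  define y where "y = real n / 2080"
  have y: "y \<ge> 1" "real n = 2080 * y" unfolding y_def using n_ge_48_real True by simp_all
  have "real q \<le> real n / 100" using size_small[OF assms] by simp
  then have "1 + real (q choose t) \<le> 218 / 10 * y" using y True by simp
  then have "(1 + real (q choose t)) * \<epsilon> \<le> (218 / 10 * y) * \<epsilon>"
    using p0 by (intro mult_right_mono) auto
  also have "(218 / 10 * y) * \<epsilon> = (218 / 10 * y) * ((2080 * y) ^ 2 * exception_rate n t)"
    unfolding y(2)[symmetric] using True by simp
  also have "\<dots> = (218 / 10 * 2080 ^ 2 / (3 * 10 ^ 9)) * (3 * 10 ^ 9 * y ^ 3 * exception_rate n t)"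
    by (simp add: power2_eq_square power3_eq_cube)
  also have "\<dots> \<le> (218 / 10 * 2080 ^ 2 / (3 * 10 ^ 9)) * 1"
    unfolding y_def by (rule mult_left_mono[OF exception_rate_t1[OF True]]) simp
  finally show ?thesis by simp
next
  case False
  then have t2: "t \<ge> 2" using t_pos by simp
  have p0: "exception_rate n t \<ge> 0" unfolding exception_rate_def by simp
  have n1: "real n \<ge> 1" using n_large t_pos by simp
  have "(2 ^ q :: real) ^ 2 = 4 ^ q" unfolding power2_eq_square by (simp flip: power_mult_distrib)
  also have "\<dots> \<le> w ^ q" using w_ge'[OF t2] by (intro power_mono) auto
  also have "\<dots> \<le> 11 / 10 * (real n ^ t) ^ 2" using assms by (simp add: power_mult[symmetric] mult.commute)
  also have "\<dots> \<le> (11 / 10 * real n ^ t) ^ 2" by (simp add: power_mult_distrib power2_eq_square)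
  finally have "2 ^ q \<le> 11 / 10 * real n ^ t" by (rule power2_le_imp_le) simp
  moreover have "real (q choose t) \<le> 2 ^ q" using binomial_le_pow2[of q t] by (metis of_nat_le_iff of_nat_numeral of_nat_power)
  moreover have "1 \<le> real n ^ t" using n1 by (rule one_le_power)
  ultimately have "1 + real (q choose t) \<le> 3 * real n ^ t" by linarith
  then have "(1 + real (q choose t)) * \<epsilon> \<le> (3 * real n ^ t) * \<epsilon>"
    using p0 by (intro mult_right_mono) auto
  also have "\<dots> = 3 / 4 ^ (3 * t) * ((4 * real n) ^ (3 * t) * exception_rate n t)"
    by (simp add: power_mult_distrib power_add[symmetric])
  also have "\<dots> \<le> 3 / 4 ^ (3 * t) * 1"
    by (rule mult_left_mono[OF exception_rate_t2[OF t2]]) simp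
  also have "\<dots> \<le> 3 / 4 ^ 6"
    unfolding mult_1_right by (rule divide_left_mono) (use t2 power_increasing[of 6 "3 * t" "4 :: real"] in auto)
  finally show ?thesis by simp
qed

lemma exception_petals: "real (2 * t + 2) * \<epsilon> * N \<le> 1 / 5"
proof (cases "t = 1")
  case True
  define y where "y = real n / 2080"
  have p0: "exception_rate n t \<ge> 0" unfolding exception_rate_def by simp
  have y: "y \<ge> 1" "real n = 2080 * y" unfolding y_def using n_ge_48_real True by simp_all
  have "N = 25" unfolding cover_bound_def True by (simp add: numeral_eq_Suc)
  then have "real (2 * t + 2) * \<epsilon> * N = 100 * ((2080 * y) ^ 2 * exception_rate n t)"
    unfolding y(2)[symmetric] using True by simp
  also have "\<dots> \<le> 100 * (2080 ^ 2 * y ^ 3 * exception_rate n t)"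
    using y(1) p0 power_increasing[of 2 3 y]
    by (intro mult_left_mono mult_right_mono) (auto simp: power_mult_distrib)
  also have "\<dots> = (100 * 2080 ^ 2 / (3 * 10 ^ 9)) * (3 * 10 ^ 9 * (real n / 2080) ^ 3 * exception_rate n t)"
    unfolding y_def by (simp add: power2_eq_square power3_eq_cube)
  also have "\<dots> \<le> (100 * 2080 ^ 2 / (3 * 10 ^ 9)) * 1"
    by (rule mult_left_mono[OF exception_rate_t1[OF True]]) simp
  finally show ?thesis by simp
next
  case False
  then have t2: "t \<ge> 2" using t_pos by simp
  have p0: "exception_rate n t \<ge> 0" unfolding exception_rate_def by simp
  have n1: "real n \<ge> 1" using n_large t_pos by simp
  have "real (2 * t + 2) * N \<le> real n"
  proof -
    have "real (2 * t + 2) * N \<le> 20 * real (2 * t + 1) * N" using N_ge by (intro mult_right_mono) auto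
    then show ?thesis using deletions_small by linarith
  qed
  also have "\<dots> \<le> real n ^ t" using power_increasing[of 1 t "real n"] t_pos n1 by simp
  finally have "(real (2 * t + 2) * N) * \<epsilon> \<le> real n ^ t * \<epsilon>"
    using p0 by (intro mult_right_mono) auto
  also have "\<dots> = 1 / 4 ^ (3 * t) * ((4 * real n) ^ (3 * t) * exception_rate n t)"
    by (simp add: power_mult_distrib power_add[symmetric])
  also have "\<dots> \<le> 1 / 4 ^ (3 * t) * 1"
    by (rule mult_left_mono[OF exception_rate_t2[OF t2]]) simp
  also have "\<dots> \<le> 1 / 4 ^ 6"
    unfolding mult_1_right by (rule divide_left_mono) (use t2 power_increasing[of 6 "3 * t" "4 :: real"] in auto)
  also have "\<dots> \<le> 1 / 5" by simp
  finally show ?thesis by (simp only: mult_ac)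
qed

end

section \<open>Intersecting families with the exchange property\<close>

locale exchange_family =
  fixes t :: nat and \<H> :: "'a set set"
  assumes size: "H \<in> \<H> \<Longrightarrow> finite H \<and> card H = 2 * t"
    and inter: "H \<in> \<H> \<Longrightarrow> K \<in> \<H> \<Longrightarrow> t \<le> card (H \<inter> K)"
    and avoid: "H \<in> \<H> \<Longrightarrow> T \<subseteq> H \<Longrightarrow> card T = t \<Longrightarrow> \<exists>K\<in>\<H>. K \<inter> T = {}"
begin

lemma fin: "H \<in> \<H> \<Longrightarrow> finite H"
  using size by blast

lemma card_minus:
  assumes "K \<in> \<H>" "card (K \<inter> H) = t"
  shows "card (K - H) = t"
  using card_Diff_subset_Int[of K H] size[OF assms(1)] assms(2) by simp

lemma card_rest:
  assumes "H \<in> \<H>" "Y \<subseteq> H" "card Y = t"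
  shows "card (H - Y) = t"
  using size[OF assms(1)] assms(2,3) by (simp add: card_Diff_subset finite_subset)

lemma avoid_inter:
  assumes H: "H \<in> \<H>" "Y \<subseteq> H" "card Y = t" and K: "K \<in> \<H>" "K \<inter> (H - Y) = {}"
  shows "K \<inter> H = Y"
proof -
  have "K \<inter> H \<subseteq> Y" using K(2) by blast
  moreover have "finite Y" using fin[OF H(1)] H(2) by (rule rev_finite_subset)
  moreover have "card Y \<le> card (K \<inter> H)" using inter[OF K(1) H(1)] H(3) by simp
  ultimately show ?thesis by (metis card_seteq)
qed

text \<open>\<open>K\<close> and \<open>K'\<close> meet \<open>H\<close> in the complementary halves
  \<open>Y\<close> and \<open>H - Y\<close>. Their common points, at least t of them, thus lie
  outside \<open>H\<close>, where each has exactly t points.\<close>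

lemma avoid_unique:
  assumes H: "H \<in> \<H>" "Y \<subseteq> H" "card Y = t"
    and K: "K \<in> \<H>" "K \<inter> (H - Y) = {}" and K': "K' \<in> \<H>" "K' \<inter> Y = {}"
  shows "K - H = K' - H"
proof -
  have k: "K \<inter> H = Y" using avoid_inter[OF H K] .
  have k': "K' \<inter> H = H - Y"
    by (rule avoid_inter[OF H(1) _ card_rest[OF H] K'(1)]) (use K'(2) H(2) in auto)
  have c: "card (K - H) = t" "card (K' - H) = t"
    using card_minus[OF K(1), of H] card_minus[OF K'(1), of H] k k' H(3) card_rest[OF H] by simp_all
  have "K \<inter> K' = (K - H) \<inter> (K' - H)" using k k' by blast
  then have i: "t \<le> card ((K - H) \<inter> (K' - H))" using inter[OF K(1) K'(1)] by simp
  have "(K - H) \<inter> (K' - H) = K - H" "(K - H) \<inter> (K' - H) = K' - H"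
    by (rule card_seteq; use i c fin[OF K(1)] fin[OF K'(1)] in simp)+
  then show ?thesis by blast
qed

text \<open>By \<open>avoid_unique\<close> the choice is immaterial, and complementary halves of
  \<open>H\<close> have the same partner: it completes either of them to a member.\<close>

definition partner :: "'a set \<Rightarrow> 'a set \<Rightarrow> 'a set" where
  "partner H Y = (SOME K. K \<in> \<H> \<and> K \<inter> (H - Y) = {}) - H"

lemma partner_eq:
  assumes H: "H \<in> \<H>" "Y \<subseteq> H" "card Y = t" and K: "K \<in> \<H>" "K \<inter> (H - Y) = {}"
  shows "partner H Y = K - H"
proof -
  obtain K' where K': "K' \<in> \<H>" "K' \<inter> Y = {}" using avoid[OF H] by auto
  have "\<exists>K. K \<in> \<H> \<and> K \<inter> (H - Y) = {}" using K by blast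
  from someI_ex[OF this] show ?thesis
    unfolding partner_def using avoid_unique[OF H _ _ K'] avoid_unique[OF H K K'] by simp
qed

lemma partner_mem:
  assumes H: "H \<in> \<H>" "Y \<subseteq> H" "card Y = t"
  shows "Y \<union> partner H Y \<in> \<H>" "(H - Y) \<union> partner H Y \<in> \<H>"
    "partner H Y \<inter> H = {}" "card (partner H Y) = t" "finite (partner H Y)"
proof -
  obtain K where K: "K \<in> \<H>" "K \<inter> (H - Y) = {}" using avoid[OF H(1) _ card_rest[OF H]] by auto
  obtain K' where K': "K' \<in> \<H>" "K' \<inter> Y = {}" using avoid[OF H] by auto
  have p: "partner H Y = K - H" "partner H Y = K' - H"
    using partner_eq[OF H K] avoid_unique[OF H K K'] by auto
  have k: "K \<inter> H = Y" using avoid_inter[OF H K] .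
  have k': "K' \<inter> H = H - Y"
    by (rule avoid_inter[OF H(1) _ card_rest[OF H] K'(1)]) (use K'(2) H(2) in auto)
  have "Y \<union> partner H Y = K" "(H - Y) \<union> partner H Y = K'" using p k k' by blast+
  then show "Y \<union> partner H Y \<in> \<H>" "(H - Y) \<union> partner H Y \<in> \<H>" using K K' by auto
  show "partner H Y \<inter> H = {}" using p by blast
  show "card (partner H Y) = t"
    unfolding p(1) using card_minus[OF K(1), of H] k H(3) by simp
  show "finite (partner H Y)" unfolding p(1) using fin[OF K(1)] by simp
qed

text \<open>\<open>H \<inter> K\<close> and \<open>H - K\<close> are complementary halves of
  \<open>H\<close> with common partner \<open>K - H\<close>.\<close>

lemma symdiff_mem:
  assumes H: "H \<in> \<H>" and K: "K \<in> \<H>" and c: "card (H \<inter> K) = t"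
  shows "(H - K) \<union> (K - H) \<in> \<H>"
proof -
  have "partner H (H \<inter> K) = K - H"
    by (rule partner_eq) (use assms in auto)
  moreover have "(H - H \<inter> K) \<union> partner H (H \<inter> K) \<in> \<H>"
    by (rule partner_mem) (use assms in auto)
  ultimately show ?thesis by (simp add: Diff_Int)
qed

text \<open>Inside \<open>Y\<close> the set \<open>K\<close> misses exactly
  \<open>card (H - K) = card (K - H)\<close> points. As \<open>K\<close> has at least t points in
  \<open>Y \<union> partner H Y\<close>, at least that many lie in the partner. In this way members
  meeting \<open>H\<close> in more than t points also constrain partners.\<close>

lemma partner_superset:
  assumes H: "H \<in> \<H>" "Y \<subseteq> H" "card Y = t" and K: "K \<in> \<H>" "H - K \<subseteq> Y"
  shows "K - H \<subseteq> partner H Y"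
proof -
  define A where "A = partner H Y"
  note A = partner_mem[OF H, folded A_def]
  have fH: "finite H" "finite K" "finite Y" using fin H K by (auto intro: finite_subset)
  have e: "card (H - K) = card (K - H)"
    using size[OF H(1)] size[OF K(1)] fH by (simp add: card_Diff_subset_Int Int_commute)
  have "card Y = card (H - K) + card (K \<inter> Y)"
  proof -
    have "Y = (H - K) \<union> (K \<inter> Y)" using H(2) K(2) by blast
    moreover have "(H - K) \<inter> (K \<inter> Y) = {}" by blast
    ultimately show ?thesis using fH by (metis card_Un_disjoint finite_Diff finite_Int)
  qed
  moreover have "card (K \<inter> (Y \<union> A)) = card (K \<inter> Y) + card (K \<inter> A)"
  proof -
    have "K \<inter> (Y \<union> A) = (K \<inter> Y) \<union> (K \<inter> A)" by blast
    moreover have "(K \<inter> Y) \<inter> (K \<inter> A) = {}" using A(3) H(2) by blast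
    ultimately show ?thesis using fH by (metis card_Un_disjoint finite_Int)
  qed
  moreover have "t \<le> card (K \<inter> (Y \<union> A))" using inter[OF K(1) A(1)] .
  ultimately have "card (K - H) \<le> card (K \<inter> A)" using H(3) e by linarith
  moreover have "K \<inter> A \<subseteq> K - H" using A(3) by blast
  ultimately have "K \<inter> A = K - H" using fH by (metis card_seteq finite_Diff)
  then show ?thesis unfolding A_def by blast
qed

lemma constant_partner:
  assumes ne: "\<H> \<noteq> {}"
    and const: "\<And>H Y Y'. H \<in> \<H> \<Longrightarrow> Y \<subseteq> H \<Longrightarrow> card Y = t \<Longrightarrow> Y' \<subseteq> H \<Longrightarrow> card Y' = t \<Longrightarrow>
      partner H Y = partner H Y'"
  shows "\<exists>X. finite X \<and> card X = 3 * t \<and> (\<forall>G. G \<subseteq> X \<longrightarrow> card G = 2 * t \<longrightarrow> G \<in> \<H>)"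
proof -
  obtain H where H: "H \<in> \<H>" using ne by blast
  obtain Y where Y: "Y \<subseteq> H" "card Y = t"
    using size[OF H] obtain_subset_with_card_n[of t H] by auto
  define X where "X = H \<union> partner H Y"
  note A = partner_mem[OF H Y]
  have X: "finite X" "card X = 3 * t"
    unfolding X_def using A size[OF H] by (auto simp: card_Un_disjoint Int_commute)
  \<comment> \<open>Every half of a good \<open>G\<close> has partner \<open>X - G\<close>, so
    exchanging a half never leaves \<open>X\<close>; this property is passed on by the
    exchange.\<close>
  define good where "good G \<longleftrightarrow> G \<in> \<H> \<and> G \<subseteq> X \<and>
    (\<forall>Z. Z \<subseteq> G \<longrightarrow> card Z = t \<longrightarrow> partner G Z = X - G)" for G
  have "good H"
    unfolding good_def using const[OF H _ _ Y] H A(3) by (auto simp: X_def)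
  have step: "good (X - C)" if G: "good G" and C: "C \<subseteq> G" "card C = t" for G C
  proof -
    have G': "G \<in> \<H>" "G \<subseteq> X" using G unfolding good_def by auto
    have cZ: "card (G - C) = t" using card_rest[OF G'(1) C] .
    have "partner G (G - C) = X - G" using G cZ unfolding good_def by auto
    moreover have "(G - C) \<union> partner G (G - C) \<in> \<H>" by (rule partner_mem) (use G' cZ in auto)
    moreover have eq: "(G - C) \<union> (X - G) = X - C" using C(1) G'(2) by blast
    ultimately have m: "X - C \<in> \<H>" by simp
    have sub: "G - C \<subseteq> X - C" using G'(2) by blast
    have "partner (X - C) (G - C) = G - (X - C)"
      by (rule partner_eq[OF m sub cZ G'(1)]) blast
    also have "\<dots> = X - (X - C)" using C(1) G'(2) by blast
    finally have "partner (X - C) Z = X - (X - C)" if "Z \<subseteq> X - C" "card Z = t" for Z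
      using const[OF m that sub cZ] by simp
    then show ?thesis unfolding good_def using m by auto
  qed
  \<comment> \<open>Two exchanges lead from \<open>H\<close> to any 2t-subset \<open>G\<close> of
    \<open>X\<close>: remove some \<open>C \<subseteq> G \<inter> H\<close>, then
    \<open>X - G\<close>. Such a \<open>C\<close> exists because two 2t-subsets of a 3t-set share at
    least t points.\<close>
  have "G \<in> \<H>" if G: "G \<subseteq> X" "card G = 2 * t" for G
  proof -
    have HX: "H \<subseteq> X" unfolding X_def by simp
    have fs: "finite G" "finite H" using X(1) G(1) HX by (auto intro: finite_subset)
    have "card (G \<union> H) + card (G \<inter> H) = 4 * t"
      using card_Un_Int[OF fs] G(2) size[OF H] by simp
    moreover have "card (G \<union> H) \<le> 3 * t" using X G(1) HX by (metis Un_least card_mono)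
    ultimately have "t \<le> card (G \<inter> H)" by linarith
    then obtain C where C: "C \<subseteq> G \<inter> H" "card C = t" using obtain_subset_with_card_n by metis
    have "good (X - C)" using step[OF \<open>good H\<close>] C by blast
    moreover have "card (X - G) = t" using X G fs by (simp add: card_Diff_subset)
    ultimately have "good (X - (X - G))" using step[of "X - C" "X - G"] C by blast
    then show ?thesis using G(1) unfolding good_def by (simp add: double_diff)
  qed
  then show ?thesis using X by blast
qed

text \<open>Any two halves of \<open>H\<close> are joined by a path of single-point exchanges, and
  along it the partner must change at some exchange.\<close>

lemma nonconstant_adjacent:
  assumes H: "H \<in> \<H>" and Y: "Y \<subseteq> H" "card Y = t" and Y': "Y' \<subseteq> H" "card Y' = t"
    and ne: "partner H Y \<noteq> partner H Y'"
  obtains Z a b where "a \<in> H" "b \<in> H" "a \<noteq> b" "Z \<subseteq> H" "a \<notin> Z" "b \<notin> Z" "card Z + 1 = t"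
    "partner H (insert a Z) \<noteq> partner H (insert b Z)"
proof -
  have "\<exists>Z a b. a \<in> H \<and> b \<in> H \<and> a \<noteq> b \<and> Z \<subseteq> H \<and> a \<notin> Z \<and> b \<notin> Z \<and> card Z + 1 = t \<and>
    partner H (insert a Z) \<noteq> partner H (insert b Z)"
    using Y ne
  proof (induction "card (Y - Y')" arbitrary: Y)
    case 0
    then have fY: "finite Y" using fin[OF H] by (auto intro: finite_subset)
    then have "Y \<subseteq> Y'" using 0 by simp
    moreover have "finite Y'" using fin[OF H] Y' by (auto intro: finite_subset)
    ultimately have "Y = Y'" using 0 Y' by (metis card_subset_eq)
    then show ?case using 0 by simp
  next
    case (Suc k)
    have fs: "finite Y" "finite Y'" using fin[OF H] Suc(3) Y' by (auto intro: finite_subset)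
    have "Y - Y' \<noteq> {}" using Suc(2) by (metis card.empty nat.distinct(1))
    then obtain a where a: "a \<in> Y" "a \<notin> Y'" by blast
    have "\<not> Y' \<subseteq> Y"
    proof
      assume "Y' \<subseteq> Y"
      then have "Y' = Y" using card_subset_eq[OF fs(1)] Suc(4) Y'(2) by simp
      then show False using a by simp
    qed
    then obtain b where b: "b \<in> Y'" "b \<notin> Y" by blast
    define Z where "Z = Y - {a}"
    have Z: "Y = insert a Z" "a \<notin> Z" "b \<notin> Z" "Z \<subseteq> H" "a \<noteq> b"
      unfolding Z_def using a b Suc(3) by auto
    have cZ: "card Z + 1 = t" using Suc(4) card_Suc_Diff1[OF fs(1) a(1)] unfolding Z_def by simp
    show ?case
    proof (cases "partner H Y = partner H (insert b Z)")
      case False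
      moreover have "a \<in> H" "b \<in> H" using a b Suc(3) Y'(1) by auto
      ultimately show ?thesis using Z cZ by metis
    next
      case True
      have "insert b Z - Y' = (Y - Y') - {a}" unfolding Z_def using a b by auto
      then have "k = card (insert b Z - Y')" using Suc(2) a fs by simp
      moreover have "card (insert b Z) = t" using cZ Z(3) fs(1) by (simp add: Z_def)
      moreover have "insert b Z \<subseteq> H" using Z(4) b(1) Y'(1) by blast
      moreover have "partner H (insert b Z) \<noteq> partner H Y'" using True Suc(5) by simp
      ultimately show ?thesis using Suc(1)[of "insert b Z"] by blast
    qed
  qed
  then show thesis using that by blast
qed

text \<open>The configuration forced by two adjacent halves with different partners. With Z, W, C
  singletons these five sets and H generate the seven complements of the lines of a Fano plane.\<close>

definition configuration :: "'a set \<Rightarrow> 'a set \<Rightarrow> 'a set \<Rightarrow> 'a \<Rightarrow> 'a \<Rightarrow> 'a \<Rightarrow> 'a \<Rightarrow> bool" where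
  "configuration Z W C a b p q \<longleftrightarrow>
    distinct [a, b, p, q] \<and> Z \<inter> W = {} \<and> Z \<inter> C = {} \<and> W \<inter> C = {} \<and>
    (Z \<union> W \<union> C) \<inter> {a, b, p, q} = {} \<and> finite (Z \<union> W \<union> C) \<and>
    card Z + 1 = t \<and> card W + 1 = t \<and> card C + 1 = t \<and>
    Z \<union> W \<union> {a, b} \<in> \<H> \<and> Z \<union> W \<union> {p, q} \<in> \<H> \<and>
    Z \<union> C \<union> {a, p} \<in> \<H> \<and> Z \<union> C \<union> {b, q} \<in> \<H> \<and>
    W \<union> C \<union> {b, p} \<in> \<H> \<and> W \<union> C \<union> {a, q} \<in> \<H>"

lemma configuration_swap: "configuration Z W C a b p q \<Longrightarrow> configuration W Z C a b q p"
  unfolding configuration_def by (auto simp: Un_commute insert_commute)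

lemma configuration_exists:
  assumes H: "H \<in> \<H>" and ab: "a \<in> H" "b \<in> H" "a \<noteq> b" and Z: "Z \<subseteq> H" "a \<notin> Z" "b \<notin> Z" "card Z + 1 = t"
    and ne: "partner H (insert a Z) \<noteq> partner H (insert b Z)"
  obtains W C p q where "configuration Z W C a b p q"
proof -
  have fH: "finite H" "finite Z" using fin[OF H] Z(1) by (auto intro: finite_subset)
  have Ya: "insert a Z \<subseteq> H" "card (insert a Z) = t" and Yb: "insert b Z \<subseteq> H" "card (insert b Z) = t"
    using ab Z fH by auto
  define A where "A = partner H (insert a Z)"
  define B where "B = partner H (insert b Z)"
  define W where "W = H - Z - {a, b}"
  define C where "C = A \<inter> B"
  note A = partner_mem[OF H Ya, folded A_def]
  note B = partner_mem[OF H Yb, folded B_def]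
  have HW: "H = Z \<union> W \<union> {a, b}" "Z \<inter> W = {}" "a \<notin> W" "b \<notin> W" unfolding W_def using Z ab by auto
  have Wa: "H - insert a Z = insert b W" "H - insert b Z = insert a W" using HW Z ab by auto
  have cW: "card W + 1 = t"
  proof -
    have "finite W" unfolding W_def using fH by simp
    then show ?thesis using card_rest[OF H Ya] HW(4) unfolding Wa by simp
  qed
  \<comment> \<open>Two members with this intersection force
    \<open>card (A \<inter> B) + 1 \<ge> t\<close>. Different partners \<open>A\<close> and
    \<open>B\<close> therefore differ in one point each, \<open>p\<close> and
    \<open>q\<close>.\<close>
  have "(insert a Z \<union> A) \<inter> ((H - insert b Z) \<union> B) = insert a C"
    unfolding Wa C_def using A(3) B(3) HW Z by auto
  then have "t \<le> card (insert a C)" using inter[OF A(1) B(2)] by simp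
  moreover have fC: "finite C" "a \<notin> C" unfolding C_def using A(3,5) ab by auto
  ultimately have tC: "t \<le> card C + 1" by simp
  have "C \<noteq> A"
  proof
    assume "C = A"
    then have "A \<subseteq> B" unfolding C_def by blast
    then have "A = B" using A B by (metis card_subset_eq)
    then show False using ne unfolding A_def B_def by simp
  qed
  then have "C \<subset> A" unfolding C_def by blast
  then have "card C < t" using A by (metis psubset_card_mono)
  then have cC: "card C + 1 = t" using tC by simp
  have CAB: "C \<subseteq> A" "C \<subseteq> B" unfolding C_def by auto
  have "card (A - C) = 1" "card (B - C) = 1"
    using card_Diff_subset[OF fC(1) CAB(1)] card_Diff_subset[OF fC(1) CAB(2)] A(4) B(4) cC by simp_all
  then obtain p q where "A - C = {p}" "B - C = {q}" by (metis card_1_singletonE)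
  then have pq: "A = insert p C" "B = insert q C" "p \<notin> C" "q \<notin> C" "p \<noteq> q" unfolding C_def by auto
  have pqH: "p \<notin> H" "q \<notin> H" "C \<inter> H = {}" using A(3) B(3) pq by auto
  have m1: "Z \<union> C \<union> {a, p} \<in> \<H>" and m3: "W \<union> C \<union> {b, p} \<in> \<H>"
    using A(1,2) unfolding Wa pq by (simp_all add: insert_commute)
  have m2: "Z \<union> C \<union> {b, q} \<in> \<H>" and m4: "W \<union> C \<union> {a, q} \<in> \<H>"
    using B(1,2) unfolding Wa pq by (simp_all add: insert_commute)
  have dis: "a \<noteq> p" "a \<noteq> q" "b \<noteq> p" "b \<noteq> q" "p \<notin> Z" "q \<notin> Z" "p \<notin> W" "q \<notin> W" "a \<notin> C" "b \<notin> C"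
    "Z \<inter> C = {}" "W \<inter> C = {}"
    using pqH ab Z HW by auto
  have "(Z \<union> C \<union> {a, p}) \<inter> (W \<union> C \<union> {a, q}) = insert a C" using dis pq HW Z by auto
  then have "card ((Z \<union> C \<union> {a, p}) \<inter> (W \<union> C \<union> {a, q})) = t" using fC cC by simp
  from symdiff_mem[OF m1 m4 this]
  have m5: "(Z \<union> C \<union> {a, p}) - (W \<union> C \<union> {a, q}) \<union> ((W \<union> C \<union> {a, q}) - (Z \<union> C \<union> {a, p})) \<in> \<H>" .
  have "(Z \<union> C \<union> {a, p}) - (W \<union> C \<union> {a, q}) \<union> ((W \<union> C \<union> {a, q}) - (Z \<union> C \<union> {a, p})) = Z \<union> W \<union> {p, q}"
    using dis pq HW Z by auto
  then have "Z \<union> W \<union> {p, q} \<in> \<H>" using m5 by simp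
  then have "configuration Z W C a b p q"
    unfolding configuration_def using m1 m2 m3 m4 dis pq HW Z ab H cW cC fH fC by auto
  then show thesis using that by blast
qed

text \<open>Six members are given by the configuration, and the seventh,
  \<open>{a, b, p, q}\<close>, is a symmetric difference of two of them. The lines are their
  complements in the set of the seven points involved.\<close>

lemma configuration_fano:
  assumes "configuration Z W C a b p q" "t = 2"
  obtains V \<L> where "fano_plane V \<L>" "\<And>L. L \<in> \<L> \<Longrightarrow> V - L \<in> \<H>"
proof -
  have "card Z = 1" "card W = 1" "card C = 1" using assms unfolding configuration_def by auto
  then obtain z w c where zwc: "Z = {z}" "W = {w}" "C = {c}" by (metis card_1_singletonE)
  have d: "distinct [z, w, c, a, b, p, q]" using assms(1) unfolding configuration_def zwc by auto
  have ne: "z \<noteq> w" "z \<noteq> c" "z \<noteq> a" "z \<noteq> b" "z \<noteq> p" "z \<noteq> q" "w \<noteq> c" "w \<noteq> a" "w \<noteq> b"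
    "w \<noteq> p" "w \<noteq> q" "c \<noteq> a" "c \<noteq> b" "c \<noteq> p" "c \<noteq> q" "a \<noteq> b" "a \<noteq> p" "a \<noteq> q" "b \<noteq> p"
    "b \<noteq> q" "p \<noteq> q" using d by auto
  note [simp] = ne ne[symmetric]
  have m: "{z, w, a, b} \<in> \<H>" "{z, w, p, q} \<in> \<H>" "{z, c, a, p} \<in> \<H>" "{z, c, b, q} \<in> \<H>"
    "{w, c, b, p} \<in> \<H>" "{w, c, a, q} \<in> \<H>"
    using assms(1) unfolding configuration_def zwc by (simp_all add: insert_commute)
  have "{z, c, a, p} \<inter> {z, c, b, q} = {z, c}" using d by auto
  then have "card ({z, c, a, p} \<inter> {z, c, b, q}) = t" using d assms(2) by simp
  from symdiff_mem[OF m(3,4) this]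
  have m7: "({z, c, a, p} - {z, c, b, q}) \<union> ({z, c, b, q} - {z, c, a, p}) \<in> \<H>" .
  have "({z, c, a, p} - {z, c, b, q}) \<union> ({z, c, b, q} - {z, c, a, p}) = {a, b, p, q}"
    using d by auto
  then have m7: "{a, b, p, q} \<in> \<H>" using m7 by simp
  define V where "V = {z, w, c, a, b, p, q}"
  define \<L> where "\<L> = {{c, p, q}, {c, a, b}, {w, b, q}, {w, a, p}, {z, a, q}, {z, b, p}, {z, w, c}}"
  have "fano_plane V \<L>"
    unfolding fano_plane_def
  proof (intro conjI)
    show "card V = 7" unfolding V_def using d by simp
    have "distinct [{c, p, q}, {c, a, b}, {w, b, q}, {w, a, p}, {z, a, q}, {z, b, p}, {z, w, c}]"
      using d by (auto simp: set_eq_subset)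
    from distinct_card[OF this] show "card \<L> = 7" unfolding \<L>_def by simp
    show "\<forall>L\<in>\<L>. L \<subseteq> V \<and> card L = 3" unfolding \<L>_def V_def using d by simp
    show "\<forall>x\<in>V. \<forall>y\<in>V. x \<noteq> y \<longrightarrow> (\<exists>!L. L \<in> \<L> \<and> x \<in> L \<and> y \<in> L)"
    proof (intro ballI impI)
      fix x y assume xy: "x \<in> V" "y \<in> V" "x \<noteq> y"
      have e: "\<exists>L\<in>\<L>. x \<in> L \<and> y \<in> L"
        using xy unfolding V_def \<L>_def by auto
      have "L = L'" if "L \<in> \<L>" "L' \<in> \<L>" "x \<in> L \<inter> L'" "y \<in> L \<inter> L'" for L L'
      proof -
        have "x \<in> L" "x \<in> L'" "y \<in> L" "y \<in> L'" using that(3,4) by auto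
        with that(1,2) xy(3) show ?thesis
          unfolding \<L>_def by (elim insertE emptyE; simp) (elim disjE; simp)+
      qed
      then show "\<exists>!L. L \<in> \<L> \<and> x \<in> L \<and> y \<in> L" using e by blast
    qed
  qed
  moreover have "V - L \<in> \<H>" if "L \<in> \<L>" for L
  proof -
    have "V - {c, p, q} = {z, w, a, b}" "V - {c, a, b} = {z, w, p, q}" "V - {w, b, q} = {z, c, a, p}"
      "V - {w, a, p} = {z, c, b, q}" "V - {z, a, q} = {w, c, b, p}" "V - {z, b, p} = {w, c, a, q}"
      "V - {z, w, c} = {a, b, p, q}"
      by (simp_all add: V_def insert_Diff_if)
    with that m m7 show ?thesis unfolding \<L>_def by (elim insertE emptyE) simp_all
  qed
  ultimately show thesis using that by blast
qed

text \<open>The partner of the half \<open>(W - {v}) \<union> {a, b}\<close> contains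
  \<open>p\<close> and \<open>q\<close> by \<open>partner_superset\<close>. Its other t - 2 points
  lie in \<open>C\<close>, as comparison with \<open>W \<union> C \<union> {b, p}\<close> shows, so
  it omits a single point \<open>c\<close> of \<open>C\<close>. The symmetric difference with
  \<open>Z \<union> C \<union> {a, p}\<close> gives the last member.\<close>

lemma configuration_step:
  assumes conf: "configuration Z W C a b p q" and v: "v \<in> W"
  obtains c where "c \<in> C" "(W - {v}) \<union> {a, b, p, q} \<union> (C - {c}) \<in> \<H>"
    "Z \<union> (W - {v}) \<union> {b, q, c} \<in> \<H>"
proof -
  define H where "H = Z \<union> W \<union> {a, b}"
  have d: "distinct [a, b, p, q]" "Z \<inter> W = {}" "Z \<inter> C = {}" "W \<inter> C = {}"
    "(Z \<union> W \<union> C) \<inter> {a, b, p, q} = {}" "finite Z" "finite W" "finite C"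
    "card Z + 1 = t" "card W + 1 = t" "card C + 1 = t"
    and m0: "H \<in> \<H>" and m5: "Z \<union> W \<union> {p, q} \<in> \<H>" and m1: "Z \<union> C \<union> {a, p} \<in> \<H>"
    and m3: "W \<union> C \<union> {b, p} \<in> \<H>"
    using conf unfolding configuration_def H_def by auto
  define Y where "Y = (W - {v}) \<union> {a, b}"
  have cM: "card (W - {v}) + 2 = t" using d v by (simp add: card_Diff_subset) (metis Suc_pred card_gt_0_iff empty_iff)
  have Y: "Y \<subseteq> H" "card Y = t"
  proof -
    show "Y \<subseteq> H" unfolding Y_def H_def by auto
    have "card Y = card (W - {v}) + card {a, b}"
      unfolding Y_def by (rule card_Un_disjoint) (use d in auto)
    then show "card Y = t" using cM d by simp
  qed
  define A where "A = partner H Y"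
  note A = partner_mem[OF m0 Y, folded A_def]
  have "Z \<union> W \<union> {p, q} - H \<subseteq> A"
    unfolding A_def by (rule partner_superset[OF m0 Y m5]) (auto simp: H_def Y_def)
  then have pq: "p \<in> A" "q \<in> A" using d unfolding H_def by auto
  define N where "N = A - {p, q}"
  have AN: "A = N \<union> {p, q}" "p \<notin> N" "q \<notin> N" "finite N" "N \<inter> H = {}" unfolding N_def using pq A by auto
  have cN: "card N + 2 = t" using A(4) AN d by (simp add: AN(1))
  have "((H - Y) \<union> A) \<inter> (W \<union> C \<union> {b, p}) = {v, p} \<union> (N \<inter> C)"
    unfolding AN(1) H_def Y_def using d v AN(5) unfolding H_def by auto
  moreover have "card ({v, p} \<union> (N \<inter> C)) = 2 + card (N \<inter> C)"
  proof -
    have "v \<noteq> p" using v d by auto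
    then have "card {v, p} = 2" by simp
    moreover have "{v, p} \<inter> (N \<inter> C) = {}" using v d AN by auto
    ultimately show ?thesis using AN by (subst card_Un_disjoint) auto
  qed
  ultimately have "t \<le> 2 + card (N \<inter> C)" using inter[OF A(2) m3] by simp
  then have "card N \<le> card (N \<inter> C)" using cN by simp
  then have NC: "N \<subseteq> C" using AN(4) by (metis Int_lower1 Int_lower2 card_seteq)
  have "card (C - N) = 1" using NC cN d AN by (simp add: card_Diff_subset)
  then obtain c where c: "C - N = {c}" by (metis card_1_singletonE)
  then have c': "c \<in> C" "N = C - {c}" using NC by auto
  have L: "(W - {v}) \<union> {a, b, p, q} \<union> (C - {c}) \<in> \<H>"
  proof -
    have "Y \<union> A = (W - {v}) \<union> {a, b, p, q} \<union> (C - {c})" unfolding Y_def AN(1) c' by auto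
    then show ?thesis using A(1) by simp
  qed
  have i: "((W - {v}) \<union> {a, b, p, q} \<union> (C - {c})) \<inter> (Z \<union> C \<union> {a, p}) = {a, p} \<union> N"
    using d unfolding c' by auto
  have ap: "a \<noteq> p" "a \<notin> N" "p \<notin> N" using d AN(3) unfolding c' by auto
  have "card ({a, p} \<union> N) = t" using ap cN AN(4) by simp
  from symdiff_mem[OF L m1, unfolded i, OF this]
  have "((W - {v}) \<union> {a, b, p, q} \<union> (C - {c}) - (Z \<union> C \<union> {a, p})) \<union>
    ((Z \<union> C \<union> {a, p}) - ((W - {v}) \<union> {a, b, p, q} \<union> (C - {c}))) \<in> \<H>" .
  also have "((W - {v}) \<union> {a, b, p, q} \<union> (C - {c}) - (Z \<union> C \<union> {a, p})) \<union>
    ((Z \<union> C \<union> {a, p}) - ((W - {v}) \<union> {a, b, p, q} \<union> (C - {c}))) = Z \<union> (W - {v}) \<union> {b, q, c}"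
    using d c'(1) by auto
  finally show thesis using that c' L by blast
qed

text \<open>For \<open>t \<ge> 3\<close> some partner would have t + 1 points. By
  \<open>configuration_step\<close> with \<open>Z\<close> and \<open>W\<close> exchanged, each
  \<open>z\<close> in \<open>Z\<close> determines a point \<open>g z\<close>, and \<open>g\<close>
  is a bijection from \<open>Z\<close> to \<open>C\<close>.\<close>

lemma configuration_two:
  assumes conf: "configuration Z W C a b p q"
  shows "t = 2"
proof -
  have d: "distinct [a, b, p, q]" "Z \<inter> W = {}" "Z \<inter> C = {}" "W \<inter> C = {}"
    "(Z \<union> W \<union> C) \<inter> {a, b, p, q} = {}" "finite Z" "finite W" "finite C"
    "card Z + 1 = t" "card W + 1 = t" "card C + 1 = t"
    and m0: "Z \<union> W \<union> {a, b} \<in> \<H>" and m1: "Z \<union> C \<union> {a, p} \<in> \<H>" and m2: "Z \<union> C \<union> {b, q} \<in> \<H>"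
    using conf unfolding configuration_def by auto
  have "t \<noteq> 1"
  proof
    assume t1: "t = 1"
    then have "Z = {}" "C = {}" using d by auto
    then have "(Z \<union> C \<union> {a, p}) \<inter> (Z \<union> C \<union> {b, q}) = {}" using d by auto
    then show False using inter[OF m1 m2] t1 by simp
  qed
  moreover have "\<not> t \<ge> 3"
  proof
    assume t3: "t \<ge> 3"
    define H where "H = Z \<union> W \<union> {a, b}"
    have "\<forall>z\<in>Z. \<exists>c\<in>C. (Z - {z}) \<union> {a, b, q, p} \<union> (C - {c}) \<in> \<H> \<and> W \<union> (Z - {z}) \<union> {b, p, c} \<in> \<H>"
    proof
      fix z assume "z \<in> Z"
      from configuration_step[OF configuration_swap[OF conf] this]
      show "\<exists>c\<in>C. (Z - {z}) \<union> {a, b, q, p} \<union> (C - {c}) \<in> \<H> \<and> W \<union> (Z - {z}) \<union> {b, p, c} \<in> \<H>"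
        by metis
    qed
    then obtain g where g: "\<And>z. z \<in> Z \<Longrightarrow> g z \<in> C"
      "\<And>z. z \<in> Z \<Longrightarrow> (Z - {z}) \<union> {a, b, q, p} \<union> (C - {g z}) \<in> \<H>"
      "\<And>z. z \<in> Z \<Longrightarrow> W \<union> (Z - {z}) \<union> {b, p, g z} \<in> \<H>"
      by metis
    have inj: "inj_on g Z"
    proof (rule inj_onI, rule ccontr)
      fix z z' assume z: "z \<in> Z" "z' \<in> Z" "g z = g z'" "z \<noteq> z'"
      have gz: "g z' \<in> C" using g(1) z by auto
      \<comment> \<open>If \<open>g z = g z'\<close>, these two members share only t - 1
        points.\<close>
      have "(W \<union> (Z - {z}) \<union> {b, p, g z}) \<inter> ((Z - {z'}) \<union> {a, b, q, p} \<union> (C - {g z'}))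
        = (Z - {z, z'}) \<union> {b, p}"
        using d gz unfolding z(3) by auto
      then have "t \<le> card ((Z - {z, z'}) \<union> {b, p})"
        using inter[OF g(3)[OF z(1)] g(2)[OF z(2)]] by simp
      also have "\<dots> \<le> card (Z - {z, z'}) + card {b, p}" by (rule card_Un_le)
      also have "\<dots> \<le> card (Z - {z, z'}) + 2" by (simp add: card_insert_if)
      also have "card (Z - {z, z'}) = card Z - 2" using z d by (simp add: card_Diff_subset)
      finally show False using d(9) t3 by simp
    qed
    then have gC: "g ` Z = C"
      using d g(1) by (intro card_seteq) (auto simp: card_image)
    have "W \<noteq> {}" using d(10) t3 by auto
    then obtain v where v: "v \<in> W" by blast
    obtain c where c: "c \<in> C" "Z \<union> (W - {v}) \<union> {b, q, c} \<in> \<H>"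
      using configuration_step[OF conf v] by metis
    \<comment> \<open>For this \<open>z\<close>, the half \<open>Y\<close> contains what
      \<open>H\<close> loses to the member found for \<open>v\<close> and to the members found for
      all \<open>z' \<noteq> z\<close>. Its partner then contains \<open>q\<close>,
      \<open>c = g z\<close>, \<open>p\<close> and every \<open>g z'\<close>: all of
      \<open>C\<close> and two more points. The point \<open>p\<close> requires some
      \<open>z' \<noteq> z\<close>, hence \<open>t \<ge> 3\<close>.\<close>
    obtain z where z: "z \<in> Z" "g z = c" using c(1) gC by blast
    define Y where "Y = insert a (insert v (Z - {z}))"
    have mH: "H \<in> \<H>" using m0 unfolding H_def .
    have Y: "Y \<subseteq> H" "card Y = t"
    proof -
      show "Y \<subseteq> H" unfolding Y_def H_def using v by auto
      have "a \<notin> insert v (Z - {z})" "v \<notin> Z - {z}" using d v by auto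
      then have "card Y = card (Z - {z}) + 2" unfolding Y_def using d by simp
      also have "card (Z - {z}) = card Z - 1" using z by simp
      finally show "card Y = t" using d(9) t3 by simp
    qed
    define A where "A = partner H Y"
    have "Z \<union> (W - {v}) \<union> {b, q, c} - H \<subseteq> A"
      unfolding A_def by (rule partner_superset[OF mH Y c(2)]) (auto simp: H_def Y_def)
    then have qc: "q \<in> A" "c \<in> A" using d c(1) unfolding H_def by auto
    have other: "p \<in> A \<and> g z' \<in> A" if z': "z' \<in> Z" "z' \<noteq> z" for z'
    proof -
      have "W \<union> (Z - {z'}) \<union> {b, p, g z'} - H \<subseteq> A"
        unfolding A_def by (rule partner_superset[OF mH Y g(3)[OF z'(1)]]) (use z' in \<open>auto simp: H_def Y_def\<close>)
      then show ?thesis using d g(1)[OF z'(1)] unfolding H_def by auto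
    qed
    have "C \<subseteq> A" using other qc(2) z unfolding gC[symmetric] by (metis image_subsetI)
    moreover have "p \<in> A"
    proof -
      have "card (Z - {z}) = card Z - 1" using z by simp
      then have "card (Z - {z}) \<noteq> 0" using d(9) t3 by simp
      then have "Z - {z} \<noteq> {}" by (metis card.empty)
      then show ?thesis using other by blast
    qed
    ultimately have "insert p (insert q C) \<subseteq> A" using qc by blast
    then have "card (insert p (insert q C)) \<le> card A"
      using partner_mem(5)[OF mH Y] unfolding A_def by (intro card_mono)
    moreover have "card (insert p (insert q C)) = card C + 2" using d by simp
    ultimately show False using partner_mem(4)[OF mH Y] d(11) unfolding A_def by simp
  qed
  moreover have "t \<noteq> 0" using d(9) by simp
  ultimately show ?thesis by linarith
qed

theorem exchange_classification:
  assumes "\<H> \<noteq> {}"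
  shows "(\<exists>X. finite X \<and> card X = 3 * t \<and> (\<forall>G. G \<subseteq> X \<longrightarrow> card G = 2 * t \<longrightarrow> G \<in> \<H>)) \<or>
    (t = 2 \<and> (\<exists>V \<L>. fano_plane V \<L> \<and> (\<forall>L\<in>\<L>. V - L \<in> \<H>)))"
proof (cases "\<forall>H\<in>\<H>. \<forall>Y Y'. Y \<subseteq> H \<longrightarrow> card Y = t \<longrightarrow> Y' \<subseteq> H \<longrightarrow> card Y' = t \<longrightarrow> partner H Y = partner H Y'")
  case True
  then show ?thesis using constant_partner[OF assms] by blast
next
  case False
  then obtain H Y Y' where *: "H \<in> \<H>" "Y \<subseteq> H" "card Y = t" "Y' \<subseteq> H" "card Y' = t"
    "partner H Y \<noteq> partner H Y'" by blast
  obtain Z W C a b p q where conf: "configuration Z W C a b p q"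
    using nonconstant_adjacent[OF *] configuration_exists[OF *(1)] by metis
  have t2: "t = 2" using configuration_two[OF conf] .
  then show ?thesis using configuration_fano[OF conf t2] by metis
qed

end

section \<open>Robust sets\<close>

definition star :: "'a set set \<Rightarrow> 'a set \<Rightarrow> 'a set set" where
  "star \<G> S = {F \<in> \<G>. S \<subseteq> F}"

lemma star_empty [simp]: "star \<G> {} = \<G>"
  unfolding star_def by simp

lemma star_mono: "\<G> \<subseteq> \<G>' \<Longrightarrow> star \<G> S \<subseteq> star \<G>' S"
  unfolding star_def by auto

lemma star_subset_extensions: "\<G> \<subseteq> perm_sets n \<Longrightarrow> star \<G> S \<subseteq> extensions n S"
  unfolding star_def extensions_def by auto

lemma card_star_le:
  assumes "\<G> \<subseteq> perm_sets n"
  shows "card (star \<G> S) \<le> fact (n - card S)"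
  using card_mono[OF finite_extensions star_subset_extensions[OF assms]] card_extensions_le
  by (rule le_trans)

lemma card_UN_le_bound:
  fixes b :: real
  assumes "finite I" "\<And>i. i \<in> I \<Longrightarrow> real (card (A i)) \<le> b"
  shows "real (card (\<Union>i\<in>I. A i)) \<le> real (card I) * b"
proof -
  have "real (card (\<Union>i\<in>I. A i)) \<le> real (\<Sum>i\<in>I. card (A i))"
    by (rule of_nat_mono[OF card_UN_le[OF assms(1)]])
  also have "\<dots> \<le> real (card I) * b" using sum_bounded_above[of I "\<lambda>i. real (card (A i))" b] assms(2) by simp
  finally show ?thesis .
qed

lemma finite_maximizer:
  fixes g :: "'a \<Rightarrow> 'b :: linorder"
  assumes "finite A" "A \<noteq> {}"
  obtains x where "x \<in> A" "\<And>y. y \<in> A \<Longrightarrow> g y \<le> g x"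
proof -
  have "Max (g ` A) \<in> g ` A" using assms by simp
  then obtain x where "x \<in> A" "g x = Max (g ` A)" by auto
  then show thesis using that assms(1) by simp
qed

text \<open>Such a permutation contains one of at most \<open>m ^ k\<close> systems of
  representatives, each consisting of \<open>k\<close> distinct cells because the sets are
  disjoint.\<close>

lemma card_transversals_le:
  assumes fin: "\<And>i. i < k \<Longrightarrow> finite (P i) \<and> card (P i) \<le> m"
    and disj: "\<And>i j. i < k \<Longrightarrow> j < k \<Longrightarrow> i \<noteq> j \<Longrightarrow> P i \<inter> P j = {}"
  shows "card {F \<in> perm_sets n. \<forall>i<k. F \<inter> P i \<noteq> {}} \<le> m ^ k * fact (n - k)"
proof -
  define I where "I = PiE {..<k} P"
  have fI: "finite I" unfolding I_def using fin by (intro finite_PiE) auto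
  have cI: "card I \<le> m ^ k"
    unfolding I_def using fin prod_mono[of "{..<k}" "\<lambda>i. card (P i)" "\<lambda>_. m"] by (simp add: card_PiE)
  have cx: "card (x ` {..<k}) = k" if "x \<in> I" for x
  proof -
    have "inj_on x {..<k}"
    proof (rule inj_onI, rule ccontr)
      fix i j assume ij: "i \<in> {..<k}" "j \<in> {..<k}" "x i = x j" "i \<noteq> j"
      have "x i \<in> P i" "x j \<in> P j"
        using PiE_mem[OF that[unfolded I_def] ij(1)] PiE_mem[OF that[unfolded I_def] ij(2)] .
      moreover have "P i \<inter> P j = {}" using disj ij by simp
      ultimately show False using ij(3) by (metis disjoint_iff)
    qed
    then show ?thesis by (simp add: card_image)
  qed
  have "{F \<in> perm_sets n. \<forall>i<k. F \<inter> P i \<noteq> {}} \<subseteq> (\<Union>x\<in>I. extensions n (x ` {..<k}))"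
  proof
    fix F assume "F \<in> {F \<in> perm_sets n. \<forall>i<k. F \<inter> P i \<noteq> {}}"
    then have F: "F \<in> perm_sets n" "\<forall>i<k. \<exists>y. y \<in> F \<inter> P i" by auto
    then obtain x where x: "\<forall>i<k. x i \<in> F \<inter> P i" by metis
    have "restrict x {..<k} \<in> I" unfolding I_def using x by auto
    moreover have "F \<in> extensions n (restrict x {..<k} ` {..<k})"
      using F(1) x unfolding extensions_def by auto
    ultimately show "F \<in> (\<Union>x\<in>I. extensions n (x ` {..<k}))" by blast
  qed
  then have "card {F \<in> perm_sets n. \<forall>i<k. F \<inter> P i \<noteq> {}} \<le> card (\<Union>x\<in>I. extensions n (x ` {..<k}))"
    using fI by (intro card_mono) auto
  also have "\<dots> \<le> (\<Sum>x\<in>I. card (extensions n (x ` {..<k})))" by (rule card_UN_le[OF fI])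
  also have "\<dots> \<le> (\<Sum>x\<in>I. fact (n - k))"
  proof (rule sum_mono)
    fix x assume "x \<in> I"
    then show "card (extensions n (x ` {..<k})) \<le> fact (n - k)"
      using card_extensions_le[of n "x ` {..<k}"] cx by simp
  qed
  also have "\<dots> = card I * fact (n - k)" by simp
  also have "\<dots> \<le> m ^ k * fact (n - k)" using cI by (rule mult_right_mono) simp
  finally show ?thesis .
qed

section \<open>Potential, robustness and covers for a family of large diversity\<close>

locale intersecting_perms = large_n +
  fixes \<F> :: "(nat \<times> nat) set set"
  assumes perms: "\<F> \<subseteq> perm_sets n"
    and intersecting: "t_intersecting t \<F>"
    and diverse: "matching n T \<Longrightarrow> card T = t \<Longrightarrow>
      999 / 1000 * fact (n - 2 * t) \<le> real (card (avoiding \<F> T))"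
begin

abbreviation f :: real where "f \<equiv> fact (n - 2 * t)"

definition E :: real where "E = fact n * exception_rate n t"

definition bad :: "(nat \<times> nat) set \<Rightarrow> (nat \<times> nat) set set" where
  "bad S = {F \<in> \<F>. card (F \<inter> S) < t}"

lemma n_2t: "2 * t + 5 < n" "100 * (2 * t + 5) \<le> n" "real (n - 2 * t) = real n - 2 * real t"
proof -
  have "1502 * real t \<le> real n" using n_large by linarith
  then have "real (1502 * t) \<le> real n" by simp
  then have "1502 * t \<le> n" by linarith
  then show "2 * t + 5 < n" "100 * (2 * t + 5) \<le> n" "real (n - 2 * t) = real n - 2 * real t"
    using t_pos by (simp_all add: of_nat_diff)
qed

lemma f_pos: "f > 0" by simp

lemma E_nonneg: "E \<ge> 0" unfolding E_def exception_rate_def by simp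

lemma fact_le: "fact n \<le> real n ^ (2 * t) * f"
proof -
  have "fact n div fact (n - 2 * t) \<le> n ^ (2 * t)" by (rule fact_div_fact_le_pow) (use n_2t in simp)
  moreover have "(fact (n - 2 * t) :: nat) dvd fact n" by (rule fact_dvd) simp
  ultimately have "(fact n :: nat) \<le> n ^ (2 * t) * fact (n - 2 * t)"
    by (metis dvd_div_mult_self mult_le_mono1)
  then have "real (fact n) \<le> real (n ^ (2 * t) * fact (n - 2 * t))" by (rule of_nat_mono)
  then show ?thesis by simp
qed

lemma E_le: "E \<le> \<epsilon> * f"
proof -
  have "fact n * exception_rate n t \<le> (real n ^ (2 * t) * f) * exception_rate n t"
    by (rule mult_right_mono[OF fact_le]) (simp add: exception_rate_def)
  then show ?thesis unfolding E_def by (simp add: mult_ac)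
qed

lemma finite_family: "finite \<F>"
  using perms finite_perm_sets by (rule finite_subset)

lemma finite_bad [simp]: "finite (bad S)"
  unfolding bad_def using finite_family by simp

lemma finite_star [simp]: "\<G> \<subseteq> \<F> \<Longrightarrow> finite (star \<G> S)"
  unfolding star_def using finite_family by (auto intro: finite_subset)

lemma star_matching: "\<G> \<subseteq> \<F> \<Longrightarrow> star \<G> S \<noteq> {} \<Longrightarrow> matching n S"
  using perms matching_subset unfolding star_def perm_sets_iff[abs_def] 
  by (metis (no_types, lifting) empty_Collect_eq perm_sets_iff subsetD)

text \<open>The frequency of \<open>S\<close> relative to random permutations, discounted by
  \<open>w\<close> for each cell. At a maximizer one more cell raises the relative frequency by at
  most the factor \<open>w\<close>.\<close>

definition potential :: "(nat \<times> nat) set set \<Rightarrow> (nat \<times> nat) set \<Rightarrow> real" where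
  "potential \<G> S = real (card (star \<G> S)) / (w ^ card S * fact (n - card S))"

lemma potential_le:
  assumes "\<G> \<subseteq> \<F>"
  shows "potential \<G> S \<le> 1 / w ^ card S"
proof -
  have w: "w > 0" using w_ge by linarith
  have "real (card (star \<G> S)) \<le> real (fact (n - card S))"
    by (rule of_nat_mono, rule card_star_le) (use assms perms in auto)
  then show ?thesis unfolding potential_def using w by (simp add: field_simps)
qed

definition robust :: "(nat \<times> nat) set set \<Rightarrow> (nat \<times> nat) set \<Rightarrow> bool" where
  "robust \<G> S \<longleftrightarrow> star \<G> S \<noteq> {} \<and>
    (\<forall>x. x \<notin> S \<longrightarrow> real (n - card S) * real (card (star \<G> (insert x S))) \<le> w * real (card (star \<G> S)))"

text \<open>Maximizing over supersets of \<open>Q\<close> serves both covers, with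
  \<open>Q = {}\<close>, and petals, with \<open>Q\<close> heavy. Maximality is kept in the
  conclusion because it also bounds the size of \<open>S\<close> and the stars of other
  sets.\<close>

lemma robust_exists:
  assumes G: "\<G> \<subseteq> \<F>" and Q: "star \<G> Q \<noteq> {}"
  obtains S where "Q \<subseteq> S" "robust \<G> S"
    "\<And>S'. Q \<subseteq> S' \<Longrightarrow> star \<G> S' \<noteq> {} \<Longrightarrow> potential \<G> S' \<le> potential \<G> S"
proof -
  define \<S> where "\<S> = {S. Q \<subseteq> S \<and> star \<G> S \<noteq> {}}"
  have "\<S> \<subseteq> Pow ({1..n} \<times> {1..n})"
    using star_matching[OF G] unfolding \<S>_def matching_def by blast
  then have "finite \<S>" by (rule finite_subset) simp
  moreover have "\<S> \<noteq> {}" unfolding \<S>_def using Q by auto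
  ultimately obtain S where S: "S \<in> \<S>" and max: "\<And>S'. S' \<in> \<S> \<Longrightarrow> potential \<G> S' \<le> potential \<G> S"
    using finite_maximizer[of \<S> "potential \<G>"] by metis
  have w: "w > 0" using w_ge by linarith
  have "real (n - card S) * real (card (star \<G> (insert x S))) \<le> w * real (card (star \<G> S))"
    if x: "x \<notin> S" for x
  proof (cases "star \<G> (insert x S) = {}")
    case False
    have fS: "finite S" using S star_matching[OF G] matching_finite unfolding \<S>_def by blast
    have "card (insert x S) \<le> n" using star_matching[OF G False] by (rule matching_card_le)
    then have n: "n - card S = Suc (n - card S - 1)" using x fS by simp
    have "insert x S \<in> \<S>" using S False unfolding \<S>_def by auto
    then have p: "real (card (star \<G> (insert x S))) / (w ^ Suc (card S) * fact (n - card S - 1))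
      \<le> real (card (star \<G> S)) / (w ^ card S * fact (n - card S))"
      using max[of "insert x S"] x fS unfolding potential_def by simp
    define m where "m = n - card S - 1"
    have fm: "(fact (n - card S) :: real) = real (n - card S) * fact m"
    proof -
      have "n - card S = Suc m" using n unfolding m_def .
      then show ?thesis by simp
    qed
    define K where "K = w ^ card S * fact m"
    define d where "d = real (n - card S)"
    define c where "c = real (card (star \<G> S))"
    define c' where "c' = real (card (star \<G> (insert x S)))"
    have pos: "K > 0" "d > 0" unfolding K_def d_def using w n by auto
    have "c' / (w * K) \<le> c / (d * K)"
      using p unfolding fm m_def[symmetric] K_def d_def c_def c'_def by (simp add: mult_ac)
    then have "c' * (d * K) \<le> c * (w * K)"
      using pos w by (simp add: pos_divide_le_eq pos_le_divide_eq)
    then have "(d * c') * K \<le> (w * c) * K" by (simp only: mult_ac)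
    then have "d * c' \<le> w * c" using pos(1) by (rule mult_right_le_imp_le)
    then show ?thesis unfolding d_def c_def c'_def .
  qed (use w in simp)
  then have "robust \<G> S" using S unfolding robust_def \<S>_def by auto
  then show thesis using that S max unfolding \<S>_def by blast
qed

text \<open>A member with fewer than t cells in \<open>S\<close> meets every member of
  \<open>star \<G> S\<close> also outside \<open>S\<close>, so it is blocked in the sense of
  \<open>card_blocked_le\<close>. Robustness concerns \<open>\<G>\<close>, but the exceptional
  members are counted in all of \<open>\<F>\<close>.\<close>

lemma bad_robust:
  assumes G: "\<G> \<subseteq> \<F>" and S: "robust \<G> S" and small: "100 * card S \<le> n"
  shows "real (card (bad S)) \<le> E"
proof -
  have w: "w > 0" using w_ge by linarith
  have n: "n \<ge> 5" "n > 0" "n > card S" using n_2t small by auto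
  define d where "d = real (n - card S)"
  have d: "d \<ge> 99 / 100 * real n" "d > 0"
    unfolding d_def using small n by (auto simp: of_nat_diff)
  have bs: "bad S \<subseteq> {F \<in> perm_sets n. \<forall>A\<in>star \<G> S. \<not> A \<inter> F \<subseteq> S}"
  proof
    fix F assume F: "F \<in> bad S"
    then have F': "F \<in> \<F>" "card (F \<inter> S) < t" "finite F" unfolding bad_def using perms perm_sets_finite_mem by auto
    have "\<not> A \<inter> F \<subseteq> S" if A: "A \<in> star \<G> S" for A
    proof
      assume "A \<inter> F \<subseteq> S"
      then have "A \<inter> F \<subseteq> F \<inter> S" by blast
      then have "card (A \<inter> F) \<le> card (F \<inter> S)" using F'(3) by (intro card_mono) auto
      moreover have "t \<le> card (A \<inter> F)" using intersecting A G F'(1) unfolding t_intersecting_def star_def by auto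
      ultimately show False using F'(2) by simp
    qed
    then show "F \<in> {F \<in> perm_sets n. \<forall>A\<in>star \<G> S. \<not> A \<inter> F \<subseteq> S}" using F'(1) perms by auto
  qed
  have "real (card (bad S)) \<le> real (card {F \<in> perm_sets n. \<forall>A\<in>star \<G> S. \<not> A \<inter> F \<subseteq> S})"
    by (rule of_nat_mono, rule card_mono[OF _ bs]) simp
  also have "\<dots> \<le> fact n * exp (- 2 * (11 / 30)\<^sup>2 / (n * (2 * (w / d))\<^sup>2))"
  proof (rule card_blocked_le)
    show "star \<G> S \<subseteq> extensions n S" by (rule star_subset_extensions) (use G perms in auto)
    show "star \<G> S \<noteq> {}" using S unfolding robust_def by simp
    fix x assume x: "x \<notin> S"
    have "d * real (card (star \<G> (insert x S))) \<le> w * real (card (star \<G> S))"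
      using S x unfolding robust_def d_def by blast
    moreover have "star \<G> (insert x S) = {A \<in> star \<G> S. x \<in> A}" unfolding star_def by auto
    ultimately show "real (card {A \<in> star \<G> S. x \<in> A}) \<le> w / d * real (card (star \<G> S))"
      using d(2) by (simp add: field_simps)
  qed (use n w d in auto)
  \<comment> \<open>The constant 242/900 times (99/100)^2 divided by 25 is slightly above
    1/95.\<close>
  also have "\<dots> \<le> fact n * exp (- (real n / (95 * 9 ^ (t - 1))))"
  proof -
    have w2: "w\<^sup>2 = 25 / 4 * 9 ^ (t - 1)"
      unfolding spread_const_def by (simp add: power2_eq_square flip: power_mult_distrib)
    have "2 * (11 / 30)\<^sup>2 / (n * (2 * (w / d))\<^sup>2) = 242 / 900 * d\<^sup>2 / (25 * real n * 9 ^ (t - 1))"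
    proof -
      have "2 * (11 / 30)\<^sup>2 / (n * (2 * (w / d))\<^sup>2) = 242 / 900 * d\<^sup>2 / (4 * real n * w\<^sup>2)"
        using d(2) n by (simp add: power_mult_distrib power_divide)
      then show ?thesis unfolding w2 by simp
    qed
    also have "\<dots> \<ge> 242 / 900 * (99 / 100 * real n)\<^sup>2 / (25 * real n * 9 ^ (t - 1))"
      using d n by (intro divide_right_mono mult_left_mono power_mono) auto
    also have "242 / 900 * (99 / 100 * real n)\<^sup>2 / (25 * real n * 9 ^ (t - 1))
      = (242 / 900 * (99 / 100)\<^sup>2 / 25) * (real n / 9 ^ (t - 1))"
      using n by (simp add: power2_eq_square)
    also have "\<dots> \<ge> 1 / 95 * (real n / 9 ^ (t - 1))"
      by (rule mult_right_mono) (auto simp: power2_eq_square)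
    finally have "real n / (95 * 9 ^ (t - 1)) \<le> 2 * (11 / 30)\<^sup>2 / (n * (2 * (w / d))\<^sup>2)" by simp
    then show ?thesis by simp
  qed
  finally show ?thesis unfolding E_def exception_rate_def .
qed

text \<open>A member with t cells \<open>T\<close> in \<open>S\<close> and t cells \<open>T'\<close>
  in \<open>R T\<close> contains \<open>T \<union> T'\<close>, which has 2t cells because
  \<open>R T\<close> avoids \<open>T\<close>. All other members are exceptional for \<open>S\<close>
  or for one of the sets \<open>R T\<close>.\<close>

lemma cover_le:
  assumes G: "\<G> \<subseteq> \<F>" and S: "finite S" "card S \<le> q" "real (card (bad S)) \<le> E"
    and R: "\<And>T. matching n T \<Longrightarrow> card T = t \<Longrightarrow>
      finite (R T) \<and> card (R T) \<le> q \<and> R T \<inter> T = {} \<and> real (card (bad (R T))) \<le> E"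
    and M: "\<And>Q. card Q = 2 * t \<Longrightarrow> real (card (star \<G> Q)) \<le> M"
  shows "real (card \<G>) \<le> (1 + real (q choose t)) * E + real (q choose t) ^ 2 * M"
proof -
  define I where "I = {T. T \<subseteq> S \<and> card T = t \<and> matching n T}"
  define J where "J T = {T'. T' \<subseteq> R T \<and> card T' = t}" for T
  have M0: "M \<ge> 0"
  proof -
    obtain Q :: "(nat \<times> nat) set" where "card Q = 2 * t"
      using infinite_arbitrarily_large[of UNIV "2 * t"] by (metis finite_prod infinite_UNIV_nat)
    then show ?thesis using M[of Q] by (metis of_nat_0_le_iff order_trans)
  qed
  have fI: "finite I" unfolding I_def using S(1) by auto
  have cI: "card I \<le> (q choose t)"
  proof -
    have "card I \<le> card {T. T \<subseteq> S \<and> card T = t}" unfolding I_def using S(1) by (intro card_mono) auto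
    also have "\<dots> = (card S choose t)" using n_subsets[OF S(1)] .
    also have "\<dots> \<le> (q choose t)" using S(2) by (rule binomial_right_mono)
    finally show ?thesis .
  qed
  have J: "finite (J T)" "card (J T) \<le> (q choose t)" if "T \<in> I" for T
  proof -
    have r: "finite (R T)" "card (R T) \<le> q" using R[of T] that unfolding I_def by auto
    show "finite (J T)" unfolding J_def using r(1) by auto
    have "card (J T) = (card (R T) choose t)" unfolding J_def using n_subsets[OF r(1)] .
    then show "card (J T) \<le> (q choose t)" using r(2) by (simp add: binomial_right_mono)
  qed
  have "\<G> \<subseteq> bad S \<union> (\<Union>T\<in>I. bad (R T)) \<union> (\<Union>T\<in>I. \<Union>T'\<in>J T. star \<G> (T \<union> T'))"
  proof
    fix F assume F: "F \<in> \<G>"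
    have mF: "F \<in> \<F>" "matching n F" using F G perms unfolding perm_sets_iff[symmetric] by (auto simp: perm_sets_iff)
    show "F \<in> bad S \<union> (\<Union>T\<in>I. bad (R T)) \<union> (\<Union>T\<in>I. \<Union>T'\<in>J T. star \<G> (T \<union> T'))"
    proof (cases "t \<le> card (F \<inter> S)")
      case True
      then obtain T where T: "T \<subseteq> F \<inter> S" "card T = t" using obtain_subset_with_card_n by metis
      have TI: "T \<in> I" unfolding I_def using T matching_subset[OF mF(2), of T] by auto
      show ?thesis
      proof (cases "t \<le> card (F \<inter> R T)")
        case True
        then obtain T' where T': "T' \<subseteq> F \<inter> R T" "card T' = t" using obtain_subset_with_card_n by metis
        then have "T' \<in> J T" "F \<in> star \<G> (T \<union> T')" unfolding J_def star_def using F T by auto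
        then show ?thesis using TI by blast
      next
        case False
        then have "F \<in> bad (R T)" unfolding bad_def using mF by simp
        then show ?thesis using TI by blast
      qed
    next
      case False
      then show ?thesis unfolding bad_def using mF by simp
    qed
  qed
  then have "card \<G> \<le> card (bad S \<union> (\<Union>T\<in>I. bad (R T)) \<union> (\<Union>T\<in>I. \<Union>T'\<in>J T. star \<G> (T \<union> T')))"
    using fI J(1) G by (intro card_mono) auto
  also have "\<dots> \<le> card (bad S) + card (\<Union>T\<in>I. bad (R T)) + card (\<Union>T\<in>I. \<Union>T'\<in>J T. star \<G> (T \<union> T'))"
    by (intro order_trans[OF card_Un_le] add_mono card_Un_le order_refl)
  finally have "real (card \<G>) \<le> real (card (bad S)) + real (card (\<Union>T\<in>I. bad (R T)))
      + real (card (\<Union>T\<in>I. \<Union>T'\<in>J T. star \<G> (T \<union> T')))" by linarith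
  moreover have "real (card (\<Union>T\<in>I. bad (R T))) \<le> real (q choose t) * E"
  proof -
    have "real (card (\<Union>T\<in>I. bad (R T))) \<le> real (card I) * E"
      by (rule card_UN_le_bound[OF fI]) (use R in \<open>auto simp: I_def\<close>)
    also have "\<dots> \<le> real (q choose t) * E" using cI E_nonneg by (intro mult_right_mono) auto
    finally show ?thesis .
  qed
  moreover have "real (card (\<Union>T\<in>I. \<Union>T'\<in>J T. star \<G> (T \<union> T'))) \<le> real (q choose t) ^ 2 * M"
  proof -
    have "real (card (\<Union>T\<in>I. \<Union>T'\<in>J T. star \<G> (T \<union> T'))) \<le> real (card I) * (real (q choose t) * M)"
    proof (rule card_UN_le_bound[OF fI])
      fix T assume T: "T \<in> I"
      have "real (card (\<Union>T'\<in>J T. star \<G> (T \<union> T'))) \<le> real (card (J T)) * M"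
      proof (rule card_UN_le_bound[OF J(1)[OF T]])
        fix T' assume T': "T' \<in> J T"
        have r: "finite (R T)" "R T \<inter> T = {}" "finite T"
          using R[of T] T S(1) unfolding I_def by (auto intro: finite_subset)
        have "card (T \<union> T') = card T + card T'"
          using r T' unfolding J_def by (intro card_Un_disjoint) (auto intro: finite_subset)
        then have "card (T \<union> T') = 2 * t" using T T' unfolding I_def J_def by simp
        then show "real (card (star \<G> (T \<union> T'))) \<le> M" by (rule M)
      qed
      also have "\<dots> \<le> real (q choose t) * M" using J(2)[OF T] M0 by (intro mult_right_mono) auto
      finally show "real (card (\<Union>T'\<in>J T. star \<G> (T \<union> T'))) \<le> real (q choose t) * M" .
    qed
    also have "\<dots> \<le> real (q choose t) * (real (q choose t) * M)"
      using cI M0 by (intro mult_right_mono mult_nonneg_nonneg) auto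
    finally show ?thesis by (simp add: power2_eq_square mult_ac)
  qed
  ultimately show ?thesis using S(3) unfolding distrib_right by linarith
qed

lemma avoiding_subset: "avoiding \<F> T \<subseteq> \<F>"
  unfolding avoiding_def by auto

lemma star_avoiding_disjoint: "star (avoiding \<F> T) S \<noteq> {} \<Longrightarrow> S \<inter> T = {}"
  unfolding star_def avoiding_def by blast

text \<open>Comparison with the empty set, whose potential is of order at least n^(-2t) by the
  diversity bound, limits the size of the maximizer.\<close>

lemma robust_avoiding:
  assumes T: "matching n T" "card T = t"
  obtains S where "robust (avoiding \<F> T) S" "w ^ card S \<le> 11 / 10 * real n ^ (2 * t)" "finite S"
    "real (card (bad S)) \<le> E"
    "\<And>S'. star (avoiding \<F> T) S' \<noteq> {} \<Longrightarrow> potential (avoiding \<F> T) S' \<le> potential (avoiding \<F> T) S"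
proof -
  define \<G> where "\<G> = avoiding \<F> T"
  have GF: "\<G> \<subseteq> \<F>" unfolding \<G>_def by (rule avoiding_subset)
  have big: "999 / 1000 * f \<le> real (card \<G>)" unfolding \<G>_def by (rule diverse[OF T])
  then have "real (card \<G>) > 0" using f_pos by (meson less_le_trans mult_pos_pos zero_less_divide_iff zero_less_numeral)
  then have ne: "star \<G> {} \<noteq> {}" by auto
  obtain S where S: "robust \<G> S" "\<And>S'. star \<G> S' \<noteq> {} \<Longrightarrow> potential \<G> S' \<le> potential \<G> S"
    using robust_exists[OF GF ne] by (metis empty_subsetI)
  have w: "w ^ card S > 0" using w_ge by simp
  have "potential \<G> {} \<le> 1 / w ^ card S" using S(2)[OF ne] potential_le[OF GF, of S] by linarith
  then have "real (card \<G>) / fact n \<le> 1 / w ^ card S" unfolding potential_def by simp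
  then have "real (card \<G>) * w ^ card S \<le> fact n" using w by (simp add: field_simps)
  moreover have "999 / 1000 * f * w ^ card S \<le> real (card \<G>) * w ^ card S"
    using big w by (intro mult_right_mono) auto
  moreover note fact_le
  ultimately have "999 / 1000 * f * w ^ card S \<le> real n ^ (2 * t) * f" by linarith
  then have "f * (999 / 1000 * w ^ card S) \<le> f * real n ^ (2 * t)" by (simp only: mult_ac)
  then have "999 / 1000 * w ^ card S \<le> real n ^ (2 * t)" using f_pos by (simp only: mult_le_cancel_left_pos)
  moreover have "real n ^ (2 * t) \<ge> 0" by simp
  ultimately have b: "w ^ card S \<le> 11 / 10 * real n ^ (2 * t)" by linarith
  have "finite S" using S(1) star_matching[OF GF] matching_finite unfolding robust_def by blast
  moreover have "real (card (bad S)) \<le> E" by (rule bad_robust[OF GF S(1) size_small[OF b]])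
  ultimately show thesis using that S b unfolding \<G>_def by blast
qed

text \<open>At most \<open>N\<close> sets cover the members avoiding a t-set up to
  \<open>f / 20\<close>. With fewer than \<open>f / (2 * N)\<close> members in each of them, only
  about half of the required number would be reached.\<close>

definition heavy :: "(nat \<times> nat) set \<Rightarrow> bool" where
  "heavy Q \<longleftrightarrow> card Q = 2 * t \<and> f \<le> 2 * N * real (card (star \<F> Q))"

lemma heavy_avoiding:
  assumes T: "matching n T" "card T = t"
  shows "\<exists>Q. heavy Q \<and> Q \<inter> T = {}"
proof -
  have "\<exists>S. robust (avoiding \<F> T) S \<and> w ^ card S \<le> 11 / 10 * real n ^ (2 * t) \<and> finite S \<and>
    real (card (bad S)) \<le> E \<and> (\<forall>S'. star (avoiding \<F> T) S' \<noteq> {} \<longrightarrow>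
      potential (avoiding \<F> T) S' \<le> potential (avoiding \<F> T) S)"
    if "matching n T" "card T = t" for T
    by (rule robust_avoiding[OF that]) blast
  then obtain R where R: "\<And>T. matching n T \<Longrightarrow> card T = t \<Longrightarrow> robust (avoiding \<F> T) (R T) \<and>
    w ^ card (R T) \<le> 11 / 10 * real n ^ (2 * t) \<and> finite (R T) \<and> real (card (bad (R T))) \<le> E \<and>
    (\<forall>S'. star (avoiding \<F> T) S' \<noteq> {} \<longrightarrow> potential (avoiding \<F> T) S' \<le> potential (avoiding \<F> T) (R T))"
    by metis
  have disj: "R T \<inter> T = {}" if "matching n T" "card T = t" for T
    using R[OF that] star_avoiding_disjoint unfolding robust_def by blast
  define \<T> where "\<T> = {T. matching n T \<and> card T = t}"
  have "\<T> \<subseteq> Pow ({1..n} \<times> {1..n})" unfolding \<T>_def matching_def by auto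
  then have "finite \<T>" by (rule finite_subset) simp
  moreover have "\<T> \<noteq> {}" unfolding \<T>_def using T by auto
  \<comment> \<open>The maximal size \<open>q\<close> bounds all sets in the cover. Since it is
    attained at \<open>T0\<close>, the potential that bounds the stars in the family avoiding
    \<open>T0\<close> carries the full discount \<open>w ^ q\<close>.\<close>
  ultimately obtain T0 where "T0 \<in> \<T>" "\<And>T. T \<in> \<T> \<Longrightarrow> card (R T) \<le> card (R T0)"
    using finite_maximizer[of \<T> "\<lambda>T. card (R T)"] by metis
  then have T0: "matching n T0" "card T0 = t"
    and max: "\<And>T. matching n T \<Longrightarrow> card T = t \<Longrightarrow> card (R T) \<le> card (R T0)"
    by (auto simp: \<T>_def)
  define q where "q = card (R T0)"
  have cover: "real (card (avoiding \<F> T')) \<le> (1 + real (q choose t)) * E + real (q choose t) ^ 2 * M"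
    if "matching n T'" "card T' = t" "\<And>Q. card Q = 2 * t \<Longrightarrow> real (card (star (avoiding \<F> T') Q)) \<le> M" for T' M
    using R max disj that avoiding_subset unfolding q_def by (intro cover_le[of _ "R T'" _ R]) auto
  have err: "(1 + real (q choose t)) * E \<le> 1 / 20 * f"
  proof -
    have "(1 + real (q choose t)) * E \<le> (1 + real (q choose t)) * (\<epsilon> * f)"
      using E_le by (intro mult_left_mono) auto
    also have "\<dots> = ((1 + real (q choose t)) * \<epsilon>) * f" by simp
    also have "\<dots> \<le> 1 / 20 * f"
      using R[OF T0] by (intro mult_right_mono exception_cover) (auto simp: q_def)
    finally show ?thesis .
  qed
  have w: "w > 0" using w_ge by linarith
  have "q \<le> 2 * t + 3"
  proof (rule ccontr)
    assume "\<not> q \<le> 2 * t + 3"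
    then have q: "q \<ge> 2 * t + 4" by simp
    \<comment> \<open>Bounds the star of every 2t-set in the family avoiding \<open>T0\<close>. At
      most the square of \<open>q choose t\<close> such stars reach 93/100 of \<open>f\<close> by
      \<open>choose_square_le\<close>, and 93/100 + 1/20 is below 999/1000.\<close>
    define M where "M = f / w ^ (q - 2 * t)"
    have "real (card (star (avoiding \<F> T0) Q)) \<le> M" if Q: "card Q = 2 * t" for Q
    proof (cases "star (avoiding \<F> T0) Q = {}")
      case False
      have "potential (avoiding \<F> T0) Q \<le> 1 / w ^ q"
        using R[OF T0] False potential_le[OF avoiding_subset, of T0 "R T0"] unfolding q_def by fastforce
      then have "real (card (star (avoiding \<F> T0) Q)) / (w ^ (2 * t) * f) \<le> 1 / (w ^ (2 * t) * w ^ (q - 2 * t))"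
        unfolding potential_def Q using q by (simp flip: power_add)
      then show ?thesis unfolding M_def using w by (simp add: field_simps)
    qed (use w in \<open>simp add: M_def\<close>)
    from cover[OF T0 this] have "999 / 1000 * f \<le> 1 / 20 * f + real (q choose t) ^ 2 * M"
      using diverse[OF T0] err by linarith
    also have "real (q choose t) ^ 2 * M \<le> (93 / 100 * w ^ (q - 2 * t)) * M"
      using choose_square_le[OF q] w by (intro mult_right_mono) (auto simp: M_def)
    also have "\<dots> = 93 / 100 * f" unfolding M_def using w by simp
    finally show False using f_pos by simp
  qed
  then have "(q choose t) \<le> (2 * t + 3 choose t)" by (rule binomial_right_mono)
  then have qN: "real (q choose t) ^ 2 \<le> N" unfolding cover_bound_def by (intro power_mono) auto
  have N0: "N > 0" using N_ge by linarith
  show ?thesis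
  proof (rule ccontr)
    assume none: "\<not> ?thesis"
    have "real (card (star (avoiding \<F> T) Q)) \<le> f / (2 * N)" if Q: "card Q = 2 * t" for Q
    proof (rule ccontr)
      assume a: "\<not> real (card (star (avoiding \<F> T) Q)) \<le> f / (2 * N)"
      have "star (avoiding \<F> T) Q \<noteq> {}"
      proof
        assume "star (avoiding \<F> T) Q = {}"
        then show False using a N0 by simp
      qed
      then have "Q \<inter> T = {}" by (rule star_avoiding_disjoint)
      moreover have "card (star (avoiding \<F> T) Q) \<le> card (star \<F> Q)"
        by (intro card_mono star_mono avoiding_subset) simp
      then have "real (card (star (avoiding \<F> T) Q)) \<le> real (card (star \<F> Q))" by simp
      then have "f / (2 * N) \<le> real (card (star \<F> Q))" using a by linarith
      then have "heavy Q" unfolding heavy_def using Q N0 by (simp add: field_simps)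
      ultimately show False using none by blast
    qed
    from cover[OF T this] have "999 / 1000 * f \<le> 1 / 20 * f + real (q choose t) ^ 2 * (f / (2 * N))"
      using diverse[OF T] err by linarith
    also have "real (q choose t) ^ 2 * (f / (2 * N)) \<le> N * (f / (2 * N))"
      using qN N0 by (intro mult_right_mono) auto
    also have "\<dots> = 1 / 2 * f" using N0 by simp
    finally show False using f_pos by simp
  qed
qed

end

section \<open>Heavy sets\<close>

context intersecting_perms
begin

lemma N_pos: "N > 0"
  using N_ge by linarith

lemma heavy_finite: "heavy Q \<Longrightarrow> finite Q"
  unfolding heavy_def using t_pos by (intro card_ge_0_finite) simp

lemma heavy_star: "heavy Q \<Longrightarrow> star \<F> Q \<noteq> {}"
proof
  assume "heavy Q" "star \<F> Q = {}"
  then have "f \<le> 0" unfolding heavy_def by simp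
  then show False using f_pos by linarith
qed

lemma heavy_matching: "heavy Q \<Longrightarrow> matching n Q"
  using star_matching[OF order_refl heavy_star] .

lemma fact_pred: "fact (n - 2 * t) = (real n - 2 * real t) * fact (n - 2 * t - 1)"
proof -
  have "n - 2 * t = Suc (n - 2 * t - 1)" using n_2t by simp
  then have "(fact (n - 2 * t) :: real) = real (n - 2 * t) * fact (n - 2 * t - 1)"
    by (metis fact_Suc of_nat_id)
  then show ?thesis using n_2t(3) by simp
qed

text \<open>\<open>X\<close> stands for the union of the earlier petals. The members through
  \<open>Q\<close> that miss \<open>X\<close> still number \<open>f / (4 * N)\<close>, so a
  maximizer above \<open>Q\<close> adds at most 5 cells. It misses \<open>X\<close> because it lies
  in a member that does.\<close>

lemma heavy_petal:
  assumes Q: "heavy Q" and X: "finite X" "card X \<le> 5 * (2 * t + 1)" "X \<inter> Q = {}"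
  obtains S where "Q \<subseteq> S" "finite (S - Q)" "card (S - Q) \<le> 5" "S \<inter> X = {}" "real (card (bad S)) \<le> E"
proof -
  define \<G> where "\<G> = avoiding \<F> X"
  have GF: "\<G> \<subseteq> \<F>" unfolding \<G>_def by (rule avoiding_subset)
  define g :: real where "g = fact (n - 2 * t - 1)"
  have g: "f = (real n - 2 * real t) * g" "g > 0" unfolding g_def fact_pred by simp_all
  have fQ: "finite Q" "card Q = 2 * t" using heavy_finite[OF Q] Q unfolding heavy_def by auto
  have lower: "f \<le> 4 * N * real (card (star \<G> Q))"
  proof -
    have "star \<F> Q \<subseteq> star \<G> Q \<union> (\<Union>x\<in>X. extensions n (insert x Q))"
      using perms unfolding star_def \<G>_def avoiding_def extensions_def by auto
    then have "card (star \<F> Q) \<le> card (star \<G> Q \<union> (\<Union>x\<in>X. extensions n (insert x Q)))"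
      using X(1) GF by (intro card_mono) auto
    also have "\<dots> \<le> card (star \<G> Q) + card (\<Union>x\<in>X. extensions n (insert x Q))" by (rule card_Un_le)
    finally have "real (card (star \<F> Q)) \<le> real (card (star \<G> Q)) + real (card (\<Union>x\<in>X. extensions n (insert x Q)))"
      by linarith
    also have "real (card (\<Union>x\<in>X. extensions n (insert x Q))) \<le> real (card X) * g"
    proof (rule card_UN_le_bound[OF X(1)])
      fix x assume "x \<in> X"
      then have "x \<notin> Q" using X(3) by blast
      then have "card (insert x Q) = 2 * t + 1" using fQ by simp
      then have "card (extensions n (insert x Q)) \<le> fact (n - 2 * t - 1)"
        using card_extensions_le[of n "insert x Q"] by simp
      from of_nat_mono[OF this, where 'a = real] show "real (card (extensions n (insert x Q))) \<le> g"
        unfolding g_def by simp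
    qed
    also have "real (card X) * g \<le> real (5 * (2 * t + 1)) * g"
      using X(2) g(2) by (intro mult_right_mono of_nat_mono) auto
    finally have "2 * N * real (card (star \<F> Q)) \<le> 2 * N * (real (card (star \<G> Q)) + real (5 * (2 * t + 1)) * g)"
      using N_pos by (intro mult_left_mono) auto
    then have "f \<le> 2 * N * real (card (star \<G> Q)) + 1 / 2 * (20 * real (2 * t + 1) * N) * g"
      using Q unfolding heavy_def by (simp add: algebra_simps)
    also have "\<dots> \<le> 2 * N * real (card (star \<G> Q)) + 1 / 2 * (real n - 2 * real t) * g"
      using deletions_small g(2) by (intro add_left_mono mult_right_mono mult_left_mono) auto
    finally show ?thesis unfolding g(1) by simp
  qed
  have ne: "star \<G> Q \<noteq> {}"
  proof
    assume "star \<G> Q = {}"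
    then show False using lower f_pos by simp
  qed
  obtain S where S: "Q \<subseteq> S" "robust \<G> S"
    "\<And>S'. Q \<subseteq> S' \<Longrightarrow> star \<G> S' \<noteq> {} \<Longrightarrow> potential \<G> S' \<le> potential \<G> S"
    using robust_exists[OF GF ne] by metis
  have Sne: "star \<G> S \<noteq> {}" using S(2) unfolding robust_def by simp
  then have fS: "finite S" using star_matching[OF GF] matching_finite by blast
  have w: "w > 1" using w_ge by linarith
  have "potential \<G> Q \<le> 1 / w ^ card S" using S(3)[OF order_refl ne] potential_le[OF GF, of S] by linarith
  moreover have sQ: "card S = 2 * t + card (S - Q)"
    using fS S(1) fQ by (simp add: card_Diff_subset) (metis card_mono le_add_diff_inverse)
  ultimately have "real (card (star \<G> Q)) / (w ^ (2 * t) * f) \<le> 1 / (w ^ (2 * t) * w ^ card (S - Q))"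
    unfolding potential_def fQ(2) by (simp add: power_add)
  then have "real (card (star \<G> Q)) * w ^ card (S - Q) \<le> f" using w by (simp add: field_simps)
  also note lower
  finally have "real (card (star \<G> Q)) * w ^ card (S - Q) \<le> real (card (star \<G> Q)) * (4 * N)" by (simp add: mult_ac)
  moreover have "real (card (star \<G> Q)) > 0" using ne GF by (simp add: card_gt_0_iff)
  ultimately have "w ^ card (S - Q) \<le> 4 * N" by (simp only: mult_le_cancel_left_pos)
  also note petal_power
  finally have "card (S - Q) < 6" using w by (simp add: power_strict_increasing_iff)
  then have c5: "card (S - Q) \<le> 5" by simp
  have "100 * card S \<le> n" using n_2t(2) sQ c5 by simp
  from bad_robust[OF GF S(2) this] have "real (card (bad S)) \<le> E" .
  moreover have "S \<inter> X = {}" using star_avoiding_disjoint Sne unfolding \<G>_def by blast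
  ultimately show thesis using that S(1) c5 fS by blast
qed

lemma heavy_sunflower:
  assumes Q: "heavy Q" and "k \<le> 2 * t + 2"
  shows "\<exists>S. (\<forall>i<k. Q \<subseteq> S i \<and> finite (S i - Q) \<and> card (S i - Q) \<le> 5 \<and> real (card (bad (S i))) \<le> E) \<and>
    (\<forall>i<k. \<forall>j<k. i \<noteq> j \<longrightarrow> (S i - Q) \<inter> (S j - Q) = {})"
  using assms(2)
proof (induction k)
  case (Suc k)
  then obtain S where S: "\<forall>i<k. Q \<subseteq> S i \<and> finite (S i - Q) \<and> card (S i - Q) \<le> 5 \<and> real (card (bad (S i))) \<le> E"
    "\<forall>i<k. \<forall>j<k. i \<noteq> j \<longrightarrow> (S i - Q) \<inter> (S j - Q) = {}" by auto
  define X where "X = (\<Union>i<k. S i - Q)"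
  have "card X \<le> (\<Sum>i<k. card (S i - Q))" unfolding X_def by (rule card_UN_le) simp
  also have "\<dots> \<le> (\<Sum>i<k. 5)" using S(1) by (intro sum_mono) auto
  also have "\<dots> \<le> 5 * (2 * t + 1)" using Suc(2) by simp
  finally have "card X \<le> 5 * (2 * t + 1)" .
  moreover have "finite X" unfolding X_def by (rule finite_UN_I) (use S(1) in auto)
  moreover have "X \<inter> Q = {}" unfolding X_def by blast
  ultimately obtain S' where S': "Q \<subseteq> S'" "finite (S' - Q)" "card (S' - Q) \<le> 5" "S' \<inter> X = {}" "real (card (bad S')) \<le> E"
    using heavy_petal[OF Q] by metis
  have new: "(S' - Q) \<inter> (S i - Q) = {}" if "i < k" for i
    using S'(4) that unfolding X_def by blast
  show ?case
  proof (intro exI[of _ "S(k := S')"] conjI allI impI)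
    fix i assume "i < Suc k"
    then show "Q \<subseteq> (S(k := S')) i" "finite ((S(k := S')) i - Q)" "card ((S(k := S')) i - Q) \<le> 5"
      "real (card (bad ((S(k := S')) i))) \<le> E"
      using S(1) S' by (auto simp: less_Suc_eq)
  next
    fix i j assume "i < Suc k" "j < Suc k" "i \<noteq> j"
    then show "((S(k := S')) i - Q) \<inter> ((S(k := S')) j - Q) = {}"
      using S(2) new[of i] new[of j] by (cases "i = k"; cases "j = k") (simp_all add: Int_commute)
  qed
qed simp

text \<open>A member of the family meeting Q in fewer than t cells is exceptional for one of the petals
  or meets all of them outside Q.\<close>

lemma bad_heavy:
  assumes Q: "heavy Q"
  shows "N * real (card (bad Q)) \<le> 3 / 10 * f"
proof -
  define k where "k = 2 * t + 2"
  obtain S where S: "\<And>i. i < k \<Longrightarrow> Q \<subseteq> S i \<and> finite (S i - Q) \<and> card (S i - Q) \<le> 5 \<and> real (card (bad (S i))) \<le> E"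
    and disj: "\<And>i j. i < k \<Longrightarrow> j < k \<Longrightarrow> i \<noteq> j \<Longrightarrow> (S i - Q) \<inter> (S j - Q) = {}"
    using heavy_sunflower[OF Q order_refl] unfolding k_def by blast
  define B where "B = {F \<in> perm_sets n. \<forall>i<k. F \<inter> (S i - Q) \<noteq> {}}"
  have "bad Q \<subseteq> (\<Union>i<k. bad (S i)) \<union> B"
  proof
    fix F assume F: "F \<in> bad Q"
    then have F': "F \<in> \<F>" "F \<in> perm_sets n" "card (F \<inter> Q) < t" unfolding bad_def using perms by auto
    show "F \<in> (\<Union>i<k. bad (S i)) \<union> B"
    proof (cases "\<exists>i<k. F \<in> bad (S i)")
      case False
      have "F \<inter> (S i - Q) \<noteq> {}" if i: "i < k" for i
      proof
        assume "F \<inter> (S i - Q) = {}"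
        then have "F \<inter> S i = F \<inter> Q" using S[OF i] by blast
        then have "F \<in> bad (S i)" using F' unfolding bad_def by simp
        then show False using False i by blast
      qed
      then have "F \<in> B" unfolding B_def using F'(2) by simp
      then show ?thesis by simp
    qed auto
  qed
  moreover have "finite B" unfolding B_def by simp
  ultimately have "card (bad Q) \<le> card ((\<Union>i<k. bad (S i)) \<union> B)" by (intro card_mono) auto
  also have "\<dots> \<le> card (\<Union>i<k. bad (S i)) + card B" by (rule card_Un_le)
  finally have "real (card (bad Q)) \<le> real (card (\<Union>i<k. bad (S i))) + real (card B)" by linarith
  also have "real (card (\<Union>i<k. bad (S i))) \<le> real k * E"
    using card_UN_le_bound[of "{..<k}" "\<lambda>i. bad (S i)" E] S by simp
  finally have b: "real (card (bad Q)) \<le> real k * E + real (card B)" by simp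
  have "N * real (card B) \<le> 1 / 10 * f"
  proof -
    have "card B \<le> 5 ^ k * fact (n - k)"
      unfolding B_def by (rule card_transversals_le) (use S disj in auto)
    then have "real (card B) \<le> real (5 ^ k * fact (n - k))" by (rule of_nat_mono)
    then have "N * real (card B) \<le> N * (5 ^ k * fact (n - k))"
      using N_pos by (intro mult_left_mono) auto
    also have "\<dots> = (5 ^ (2 * t + 2) * N) * fact (n - 2 * t - 2)" unfolding k_def by simp
    also have "\<dots> \<le> (1 / 10 * ((real n - 2 * real t) * (real n - 2 * real t - 1))) * fact (n - 2 * t - 2)"
      by (rule mult_right_mono[OF transversals_small]) simp
    also have "\<dots> = 1 / 10 * ((real n - 2 * real t) * ((real n - 2 * real t - 1) * fact (n - 2 * t - 2)))" by simp
    also have "(real n - 2 * real t - 1) * fact (n - 2 * t - 2) = fact (n - 2 * t - 1)"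
    proof -
      have "n - 2 * t - 1 = Suc (n - 2 * t - 2)" using n_2t by simp
      then have "(fact (n - 2 * t - 1) :: real) = real (n - 2 * t - 1) * fact (n - 2 * t - 2)"
        by (metis fact_Suc of_nat_id)
      moreover have "real (n - 2 * t - 1) = real n - 2 * real t - 1" using n_2t by (simp add: of_nat_diff)
      ultimately show ?thesis by simp
    qed
    finally show ?thesis unfolding fact_pred .
  qed
  moreover have "N * (real k * E) \<le> 1 / 5 * f"
  proof -
    have "N * (real k * E) \<le> N * (real k * (\<epsilon> * f))"
      using E_le N_pos by (intro mult_left_mono) auto
    also have "\<dots> = (real (2 * t + 2) * \<epsilon> * N) * f" unfolding k_def by (simp only: mult_ac)
    also have "\<dots> \<le> 1 / 5 * f" by (rule mult_right_mono[OF exception_petals]) simp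
    finally show ?thesis .
  qed
  moreover have "N * real (card (bad Q)) \<le> N * (real k * E + real (card B))"
    using b N_pos by (intro mult_left_mono) auto
  ultimately show ?thesis unfolding distrib_left by linarith
qed

text \<open>Otherwise each member through \<open>Q'\<close> lies in \<open>bad Q\<close> or contains
  a cell of \<open>Q - Q'\<close>. These kinds amount to at most 3/10 and 1/20 of
  \<open>f / N\<close>, less than the share 1/2 of a heavy set.\<close>

lemma heavy_intersecting:
  assumes Q: "heavy Q" and Q': "heavy Q'"
  shows "t \<le> card (Q \<inter> Q')"
proof (rule ccontr)
  assume small: "\<not> t \<le> card (Q \<inter> Q')"
  define g :: real where "g = fact (n - 2 * t - 1)"
  have g: "f = (real n - 2 * real t) * g" "g > 0" unfolding g_def fact_pred by simp_all
  have fQ: "finite Q" "card Q = 2 * t" "finite Q'" "card Q' = 2 * t"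
    using heavy_finite[OF Q] heavy_finite[OF Q'] Q Q' unfolding heavy_def by auto
  have "star \<F> Q' \<subseteq> bad Q \<union> (\<Union>x\<in>Q - Q'. extensions n (insert x Q'))"
  proof
    fix F assume F: "F \<in> star \<F> Q'"
    show "F \<in> bad Q \<union> (\<Union>x\<in>Q - Q'. extensions n (insert x Q'))"
    proof (cases "F \<in> bad Q")
      case False
      then have c: "t \<le> card (F \<inter> Q)" using F unfolding bad_def star_def by auto
      have "\<not> F \<inter> Q \<subseteq> Q'"
      proof
        assume "F \<inter> Q \<subseteq> Q'"
        then have "card (F \<inter> Q) \<le> card (Q \<inter> Q')" using fQ by (intro card_mono) auto
        then show False using c small by simp
      qed
      then show ?thesis using F perms unfolding star_def extensions_def by auto
    qed simp
  qed
  then have "card (star \<F> Q') \<le> card (bad Q \<union> (\<Union>x\<in>Q - Q'. extensions n (insert x Q')))"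
    using fQ by (intro card_mono) auto
  also have "\<dots> \<le> card (bad Q) + card (\<Union>x\<in>Q - Q'. extensions n (insert x Q'))" by (rule card_Un_le)
  finally have "real (card (star \<F> Q')) \<le> real (card (bad Q)) + real (card (\<Union>x\<in>Q - Q'. extensions n (insert x Q')))"
    by linarith
  also have "real (card (\<Union>x\<in>Q - Q'. extensions n (insert x Q'))) \<le> real (card (Q - Q')) * g"
  proof (rule card_UN_le_bound)
    fix x assume "x \<in> Q - Q'"
    then have "card (insert x Q') = 2 * t + 1" using fQ by auto
    then have "card (extensions n (insert x Q')) \<le> fact (n - 2 * t - 1)"
      using card_extensions_le[of n "insert x Q'"] by simp
    from of_nat_mono[OF this, where 'a = real] show "real (card (extensions n (insert x Q'))) \<le> g"
      unfolding g_def by simp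
  qed (use fQ in simp)
  also have "real (card (Q - Q')) * g \<le> real (2 * t + 1) * g"
  proof -
    have "card (Q - Q') \<le> card Q" using fQ by (intro card_mono) auto
    then show ?thesis using fQ g(2) by (intro mult_right_mono) auto
  qed
  finally have "N * real (card (star \<F> Q')) \<le> N * (real (card (bad Q)) + real (2 * t + 1) * g)"
    using N_pos by (intro mult_left_mono) auto
  also have "\<dots> = N * real (card (bad Q)) + 1 / 20 * ((20 * real (2 * t + 1) * N) * g)"
    unfolding distrib_left by simp
  also have "\<dots> \<le> 3 / 10 * f + 1 / 20 * ((real n - 2 * real t) * g)"
    using deletions_small g(2) by (intro add_mono bad_heavy[OF Q] mult_left_mono mult_right_mono) auto
  also have "\<dots> < 1 / 2 * f" using f_pos unfolding g(1)[symmetric] by simp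
  finally show False using Q' unfolding heavy_def by simp
qed

sublocale exchange_family t "Collect heavy"
proof
  fix H assume H: "H \<in> Collect heavy"
  then show "finite H \<and> card H = 2 * t" using heavy_finite unfolding heavy_def by auto
  fix K assume "K \<in> Collect heavy"
  then show "t \<le> card (H \<inter> K)" using H heavy_intersecting by simp
next
  fix H T assume "H \<in> Collect heavy" "T \<subseteq> H" "card T = t"
  then show "\<exists>K\<in>Collect heavy. K \<inter> T = {}"
    using heavy_avoiding[of T] matching_subset[OF heavy_matching, of H T] by auto
qed

text \<open>Both sets consist of \<open>Q - T\<close> and its partner.\<close>

lemma heavy_avoiding_unique:
  assumes Q: "heavy Q" and T: "T \<subseteq> Q" "card T = t"
    and K: "heavy K" "K \<inter> T = {}" and K': "heavy K'" "K' \<inter> T = {}"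
  shows "K = K'"
proof -
  define Y where "Y = Q - T"
  have Y: "Y \<subseteq> Q" "card Y = t" "Q - Y = T"
    unfolding Y_def using card_rest[of Q T] Q T by auto
  have QC: "Q \<in> Collect heavy" using Q by simp
  have k: "K \<inter> Q = Y" "K - Q = partner Q Y"
    using avoid_inter[OF QC Y(1,2), of K] partner_eq[OF QC Y(1,2), of K] K Y(3) by simp_all
  have k': "K' \<inter> Q = Y" "K' - Q = partner Q Y"
    using avoid_inter[OF QC Y(1,2), of K'] partner_eq[OF QC Y(1,2), of K'] K' Y(3) by simp_all
  show ?thesis using k k' by blast
qed

text \<open>A member avoiding \<open>T\<close> and not in \<open>bad Q\<close> contains
  \<open>Q - T\<close>; if also not in \<open>bad P\<close>, it contains a t-subset \<open>Y\<close>
  of \<open>P\<close>. The 2t-set \<open>(Q - T) \<union> Y\<close> avoids \<open>T\<close>, so it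
  is \<open>K\<close> or not heavy. The latter, at most \<open>N / 5\<close> sets, account for at
  most \<open>f / 10\<close> members, and nearly all the rest goes through \<open>K\<close>.\<close>

lemma heavy_dense_aux:
  assumes Q: "heavy Q" and T: "T \<subseteq> Q" "card T = t" and K: "heavy K" "K \<inter> T = {}"
  shows "real (card (star \<F> K)) > 19 / 30 * f"
proof -
  have fQ: "finite Q" "card Q = 2 * t" using heavy_finite[OF Q] Q unfolding heavy_def by auto
  have cY: "card (Q - T) = t" using card_rest[of Q T] Q T by simp
  have mT: "matching n T" "matching n (Q - T)"
    using matching_subset[OF heavy_matching[OF Q]] T(1) by auto
  obtain P where P: "heavy P" "P \<inter> (Q - T) = {}" using heavy_avoiding[OF mT(2) cY] by auto
  have fP: "finite P" "card P = 2 * t" using heavy_finite[OF P(1)] P(1) unfolding heavy_def by auto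
  define \<G> where "\<G> = avoiding \<F> T"
  have GF: "\<G> \<subseteq> \<F>" unfolding \<G>_def by (rule avoiding_subset)
  define I where "I = {Y. Y \<subseteq> P \<and> card Y = t \<and> \<not> heavy ((Q - T) \<union> Y)}"
  have fI: "finite I" unfolding I_def using fP by auto
  have "card I \<le> card {Y. Y \<subseteq> P \<and> card Y = t}" unfolding I_def using fP by (intro card_mono) auto
  also have "\<dots> = (2 * t choose t)" using n_subsets[OF fP(1)] fP(2) by simp
  finally have cI: "real (card I) \<le> N / 5" using central_le by linarith
  have "\<G> \<subseteq> bad Q \<union> bad P \<union> star \<F> K \<union> (\<Union>Y\<in>I. star \<F> ((Q - T) \<union> Y))"
  proof
    fix F assume F: "F \<in> \<G>"
    then have F': "F \<in> \<F>" "F \<inter> T = {}" unfolding \<G>_def avoiding_def by auto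
    show "F \<in> bad Q \<union> bad P \<union> star \<F> K \<union> (\<Union>Y\<in>I. star \<F> ((Q - T) \<union> Y))"
    proof (cases "F \<in> bad Q \<or> F \<in> bad P")
      case False
      then have c: "t \<le> card (F \<inter> Q)" "t \<le> card (F \<inter> P)" using F' unfolding bad_def by auto
      have "F \<inter> Q \<subseteq> Q - T" using F' by blast
      then have "F \<inter> Q = Q - T" using c(1) cY fQ by (metis card_seteq finite_Diff)
      then have sub: "Q - T \<subseteq> F" by blast
      obtain Y where Y: "Y \<subseteq> F \<inter> P" "card Y = t" using c(2) obtain_subset_with_card_n by metis
      show ?thesis
      proof (cases "heavy ((Q - T) \<union> Y)")
        case True
        have "((Q - T) \<union> Y) \<inter> T = {}" using Y F' by blast
        then have "(Q - T) \<union> Y = K" using heavy_avoiding_unique[OF Q T True _ K] by simp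
        then show ?thesis using sub Y F' unfolding star_def by blast
      next
        case False
        then have "Y \<in> I" "F \<in> star \<F> ((Q - T) \<union> Y)"
          unfolding I_def star_def using Y sub F' by auto
        then show ?thesis by blast
      qed
    qed auto
  qed
  then have "card \<G> \<le> card (bad Q \<union> bad P \<union> star \<F> K \<union> (\<Union>Y\<in>I. star \<F> ((Q - T) \<union> Y)))"
    using fI by (intro card_mono) auto
  also have "\<dots> \<le> card (bad Q) + card (bad P) + card (star \<F> K) + card (\<Union>Y\<in>I. star \<F> ((Q - T) \<union> Y))"
    by (intro order_trans[OF card_Un_le] add_mono order_refl card_Un_le)
  finally have "real (card \<G>) \<le> real (card (bad Q)) + real (card (bad P)) + real (card (star \<F> K))
    + real (card (\<Union>Y\<in>I. star \<F> ((Q - T) \<union> Y)))" by linarith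
  moreover have "real (card (\<Union>Y\<in>I. star \<F> ((Q - T) \<union> Y))) \<le> real (card I) * (f / (2 * N))"
  proof (rule card_UN_le_bound[OF fI])
    fix Y assume Y: "Y \<in> I"
    have fY: "finite Y" using Y fP unfolding I_def by (auto intro: finite_subset)
    have "(Q - T) \<inter> Y = {}" using Y P(2) unfolding I_def by blast
    then have "card ((Q - T) \<union> Y) = 2 * t"
      using Y cY fQ fY unfolding I_def by (simp add: card_Un_disjoint)
    then have "\<not> f \<le> 2 * N * real (card (star \<F> ((Q - T) \<union> Y)))"
      using Y unfolding I_def heavy_def by simp
    then show "real (card (star \<F> ((Q - T) \<union> Y))) \<le> f / (2 * N)" using N_pos by (simp add: field_simps)
  qed
  moreover have "real (card I) * (f / (2 * N)) \<le> N / 5 * (f / (2 * N))"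
    using cI N_pos by (intro mult_right_mono) auto
  moreover have "N / 5 * (f / (2 * N)) = 1 / 10 * f" using N_pos by simp
  moreover have "real (card (bad Q)) \<le> 3 / 250 * f" if "heavy Q" for Q
  proof -
    have "25 * real (card (bad Q)) \<le> N * real (card (bad Q))" by (intro mult_right_mono N_ge) simp
    also have "\<dots> \<le> 3 / 10 * f" by (rule bad_heavy[OF that])
    finally show ?thesis by simp
  qed
  note this[OF Q] this[OF P(1)]
  moreover have "999 / 1000 * f \<le> real (card \<G>)" unfolding \<G>_def by (rule diverse[OF mT(1) T(2)])
  ultimately have "real (card (star \<F> K)) \<ge> 999 / 1000 * f - 3 / 250 * f - 3 / 250 * f - 1 / 10 * f" by linarith
  then show ?thesis using f_pos by linarith
qed

text \<open>Every heavy \<open>H\<close> arises as the unique heavy set avoiding a half of another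
  one: exchange a half of \<open>H\<close> for its partner \<open>A\<close>; then \<open>H\<close>
  avoids \<open>A\<close>.\<close>

lemma heavy_dense:
  assumes H: "heavy H"
  shows "real (card (star \<F> H)) > 19 / 30 * f"
proof -
  have HC: "H \<in> Collect heavy" using H by simp
  obtain T where T: "T \<subseteq> H" "card T = t"
    using size[OF HC] obtain_subset_with_card_n[of t H] by auto
  have HT: "H - T \<subseteq> H" "card (H - T) = t" using card_rest[OF HC T] by auto
  define A where "A = partner H (H - T)"
  note A = partner_mem[OF HC HT, folded A_def]
  have K: "heavy ((H - T) \<union> A)" using A(1) by simp
  show ?thesis
    by (rule heavy_dense_aux[OF K _ A(4) H]) (use A(3) in auto)
qed

text \<open>If \<open>F\<close> met \<open>H\<close> in fewer than t cells, no extension of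
  \<open>H\<close> meeting \<open>F\<close> only inside \<open>H\<close> could belong to
  \<open>\<F>\<close>. These are at least 11/30 of all extensions, while more than 19/30 are
  members.\<close>

lemma heavy_transversal:
  assumes H: "heavy H" and F: "F \<in> \<F>"
  shows "t \<le> card (F \<inter> H)"
proof (rule ccontr)
  assume small: "\<not> t \<le> card (F \<inter> H)"
  have mF: "matching n F" "finite F" using F perms perm_sets_finite_mem by (auto simp: perm_sets_iff)
  have cH: "card H = 2 * t" using H unfolding heavy_def by simp
  define \<B> where "\<B> = {G \<in> extensions n H. G \<inter> F \<subseteq> H}"
  have lower: "11 / 30 * f \<le> real (card \<B>)"
    using card_avoiding_ge[OF heavy_matching[OF H] mF(1)] n_2t(1) unfolding \<B>_def cH by simp
  have "star \<F> H \<inter> \<B> = {}"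
  proof -
    have "False" if G: "G \<in> \<F>" "G \<inter> F \<subseteq> H" for G
    proof -
      have "t \<le> card (G \<inter> F)" using intersecting G(1) F unfolding t_intersecting_def by simp
      also have "\<dots> \<le> card (F \<inter> H)" using G(2) mF(2) by (intro card_mono) auto
      finally show False using small by simp
    qed
    then show ?thesis unfolding star_def \<B>_def by blast
  qed
  then have "card (star \<F> H) + card \<B> = card (star \<F> H \<union> \<B>)"
    unfolding \<B>_def by (intro card_Un_disjoint[symmetric]) auto
  also have "\<dots> \<le> card (extensions n H)"
    using star_subset_extensions[OF perms] unfolding \<B>_def by (intro card_mono) auto
  also have "\<dots> = fact (n - 2 * t)" using card_extensions[OF heavy_matching[OF H]] cH by simp
  finally have "card (star \<F> H) + card \<B> \<le> fact (n - 2 * t)" .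
  from of_nat_mono[OF this, where 'a = real]
  have "real (card (star \<F> H)) + real (card \<B>) \<le> f" by simp
  then show False using heavy_dense[OF H] lower by linarith
qed

lemma heavy_exists: "Collect heavy \<noteq> {}"
proof -
  have "card {1..n} \<ge> t" using n_2t by simp
  then obtain A where A: "A \<subseteq> {1..n}" "card A = t" using obtain_subset_with_card_n by metis
  define T where "T = (\<lambda>i. (i, i)) ` A"
  have "matching n T" unfolding matching_def T_def using A(1) by (auto simp: inj_on_def)
  moreover have "card T = t" unfolding T_def using A(2) by (simp add: card_image inj_on_def)
  ultimately show ?thesis using heavy_avoiding by blast
qed

lemma pairs_matching:
  assumes "\<And>x y. x \<in> V \<Longrightarrow> y \<in> V \<Longrightarrow> \<exists>H. heavy H \<and> x \<in> H \<and> y \<in> H"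
  shows "matching n V"
proof (rule matchingI_pairs)
  fix x y assume "x \<in> V" "y \<in> V"
  then obtain H where "heavy H" "x \<in> H" "y \<in> H" using assms by blast
  then show "matching n {x, y}" using matching_subset[OF heavy_matching, of H "{x, y}"] by simp
qed

end

section \<open>The extremal families\<close>

text \<open>If \<open>F\<close> had fewer than 2t points in \<open>X\<close>, removing t points,
  taken from \<open>F\<close> when it has that many in \<open>X\<close>, would leave a 2t-set with
  fewer than t points of \<open>F\<close>.\<close>

lemma subset_meets_two_thirds:
  assumes X: "finite X" "card X = 3 * t"
    and meets: "\<And>G. G \<subseteq> X \<Longrightarrow> card G = 2 * t \<Longrightarrow> t \<le> card (F \<inter> G)"
  shows "2 * t \<le> card (F \<inter> X)"
proof (rule ccontr)
  assume c: "\<not> 2 * t \<le> card (F \<inter> X)"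
  have t0: "t > 0" using c by (cases t) auto
  have fFX: "finite (F \<inter> X)" using X(1) by simp
  obtain C where C: "C \<subseteq> X" "card C = t" "card (F \<inter> (X - C)) < t"
  proof (cases "t \<le> card (F \<inter> X)")
    case True
    then obtain C where C: "C \<subseteq> F \<inter> X" "card C = t" using obtain_subset_with_card_n by metis
    have "F \<inter> (X - C) = (F \<inter> X) - C" by blast
    then have "card (F \<inter> (X - C)) = card (F \<inter> X) - t"
      using card_Diff_subset[OF finite_subset[OF C(1) fFX] C(1)] C(2) by simp
    then show thesis using that[of C] C c t0 by auto
  next
    case False
    obtain C where C: "C \<subseteq> X" "card C = t" using X obtain_subset_with_card_n[of t X] by auto
    have "card (F \<inter> (X - C)) \<le> card (F \<inter> X)" using fFX by (intro card_mono) auto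
    then show thesis using that[of C] C False by simp
  qed
  have "card (X - C) = 2 * t" using C X by (simp add: card_Diff_subset finite_subset)
  then show False using meets[of "X - C"] C(3) by simp
qed

section \<open>Lines of a Fano plane\<close>

lemma fano_line_unique:
  assumes "fano_plane V \<L>" "L \<in> \<L>" "L' \<in> \<L>" "x \<noteq> y" "x \<in> L" "y \<in> L" "x \<in> L'" "y \<in> L'"
  shows "L = L'"
proof -
  have "x \<in> V" "y \<in> V" using assms unfolding fano_plane_def by blast+
  then have "\<exists>!L. L \<in> \<L> \<and> x \<in> L \<and> y \<in> L" using assms(1,4) unfolding fano_plane_def by blast
  then show ?thesis using assms by blast
qed

lemma fano_finite:
  assumes "fano_plane V \<L>"
  shows "finite V" "finite \<L>" "L \<in> \<L> \<Longrightarrow> finite L"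
  using assms unfolding fano_plane_def by (auto intro: card_ge_0_finite finite_subset)

lemma fano_lines_through:
  assumes F: "fano_plane V \<L>" and x: "x \<in> V"
  shows "card {L \<in> \<L>. x \<in> L} = 3"
proof -
  define P where "P = {L \<in> \<L>. x \<in> L}"
  have P: "finite P" "\<And>L. L \<in> P \<Longrightarrow> card (L - {x}) = 2 \<and> finite (L - {x})"
    using fano_finite[OF F] F unfolding P_def fano_plane_def by auto
  have "V - {x} = (\<Union>L\<in>P. L - {x})"
  proof (intro set_eqI iffI)
    fix y assume y: "y \<in> V - {x}"
    then obtain L where "L \<in> \<L>" "x \<in> L" "y \<in> L" using F x unfolding fano_plane_def by blast
    then show "y \<in> (\<Union>L\<in>P. L - {x})" using y unfolding P_def by blast
  next
    fix y assume "y \<in> (\<Union>L\<in>P. L - {x})"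
    then show "y \<in> V - {x}" using F unfolding P_def fano_plane_def by blast
  qed
  moreover have "card (\<Union>L\<in>P. L - {x}) = (\<Sum>L\<in>P. card (L - {x}))"
  proof (rule card_UN_disjoint[OF P(1)])
    show "\<forall>L\<in>P. finite (L - {x})" using P(2) by blast
    show "\<forall>L\<in>P. \<forall>L'\<in>P. L \<noteq> L' \<longrightarrow> (L - {x}) \<inter> (L' - {x}) = {}"
      using fano_line_unique[OF F] unfolding P_def by blast
  qed
  moreover have "(\<Sum>L\<in>P. card (L - {x})) = card P * 2" using P(2) by simp
  moreover have "card (V - {x}) = 6" using F x fano_finite[OF F] unfolding fano_plane_def by simp
  ultimately have "card P * 2 = 6" by simp
  then show ?thesis unfolding P_def by simp
qed

lemma fano_line_avoiding_pair:
  assumes F: "fano_plane V \<L>" and xy: "x \<in> V" "y \<in> V"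
  shows "\<exists>L\<in>\<L>. x \<notin> L \<and> y \<notin> L"
proof (rule ccontr)
  assume "\<not> ?thesis"
  then have "\<L> \<subseteq> {L \<in> \<L>. x \<in> L} \<union> {L \<in> \<L>. y \<in> L}" by blast
  then have "card \<L> \<le> card ({L \<in> \<L>. x \<in> L} \<union> {L \<in> \<L>. y \<in> L})"
    using fano_finite[OF F] by (intro card_mono) auto
  also have "\<dots> \<le> 6"
    using card_Un_le[of "{L \<in> \<L>. x \<in> L}" "{L \<in> \<L>. y \<in> L}"] fano_lines_through[OF F] xy by simp
  finally show False using F unfolding fano_plane_def by simp
qed

text \<open>Each point lies on three lines, and three of these incidences are repetitions along the
  sides of the triangle. So at most 3 + 2 + 1 = 6 of the seven lines meet it.\<close>

lemma fano_line_avoiding_triangle: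
  assumes F: "fano_plane V \<L>" and V: "x \<in> V" "y \<in> V" "z \<in> V" and xy: "x \<noteq> y"
    and nc: "\<And>L. L \<in> \<L> \<Longrightarrow> x \<in> L \<Longrightarrow> y \<in> L \<Longrightarrow> z \<notin> L"
  shows "\<exists>L\<in>\<L>. x \<notin> L \<and> y \<notin> L \<and> z \<notin> L"
proof (rule ccontr)
  assume none: "\<not> ?thesis"
  define P where "P u = {L \<in> \<L>. u \<in> L}" for u
  have fin: "finite (P u)" for u unfolding P_def using fano_finite[OF F] by simp
  have c: "card (P x) = 3" "card (P y) = 3" "card (P z) = 3"
    unfolding P_def using fano_lines_through[OF F] V by auto
  obtain A where A: "A \<in> \<L>" "x \<in> A" "y \<in> A" using F V xy unfolding fano_plane_def by blast
  have zx: "z \<noteq> x" "z \<noteq> y" using nc[OF A] A by auto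
  obtain B where B: "B \<in> \<L>" "x \<in> B" "z \<in> B" using F V zx unfolding fano_plane_def by blast
  obtain C where C: "C \<in> \<L>" "y \<in> C" "z \<in> C" using F V zx unfolding fano_plane_def by blast
  have BC: "B \<noteq> C" using nc B C by blast
  have "\<L> \<subseteq> P x \<union> (P y - {A}) \<union> (P z - {B, C})"
    using none A B C unfolding P_def by blast
  then have "card \<L> \<le> card (P x \<union> (P y - {A}) \<union> (P z - {B, C}))"
    using fin by (intro card_mono) auto
  also have "\<dots> \<le> card (P x) + card (P y - {A}) + card (P z - {B, C})"
    by (intro order_trans[OF card_Un_le] add_mono order_refl card_Un_le)
  also have "card (P y - {A}) = 2" using A c fin unfolding P_def by simp
  also have "card (P z - {B, C}) = 1"
  proof -
    have "{B, C} \<subseteq> P z" unfolding P_def using B C by auto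
    then show ?thesis using c BC by (simp add: card_Diff_subset)
  qed
  finally show False using F c unfolding fano_plane_def by simp
qed

text \<open>Otherwise \<open>V - G\<close> lies in no line and so contains three noncollinear
  points. A line \<open>L\<close> avoiding them has four points in its complement, of which
  \<open>G\<close> contains at most one.\<close>

lemma fano_contains_line_complement:
  assumes F: "fano_plane V \<L>" and meets: "\<And>L. L \<in> \<L> \<Longrightarrow> 2 \<le> card (G \<inter> (V - L))"
  shows "\<exists>L\<in>\<L>. V - L \<subseteq> G"
proof (rule ccontr)
  assume none: "\<not> ?thesis"
  have miss: "\<exists>z\<in>V - G. z \<notin> L" if "L \<in> \<L>" for L using none that by blast
  have "\<L> \<noteq> {}" using F unfolding fano_plane_def by auto
  then obtain L0 where "L0 \<in> \<L>" by blast
  then obtain x where x: "x \<in> V - G" using miss by blast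
  then obtain L1 where L1: "L1 \<in> \<L>" "x \<in> L1"
    using fano_lines_through[OF F, of x] by (metis (no_types, lifting) DiffD1 card.empty empty_Collect_eq numeral_3_eq_3 nat.distinct(1))
  then obtain y where y: "y \<in> V - G" "x \<noteq> y" using miss by blast
  obtain A where A: "A \<in> \<L>" "x \<in> A" "y \<in> A" using F x y unfolding fano_plane_def by blast
  then obtain z where z: "z \<in> V - G" "z \<notin> A" using miss by blast
  have nc: "z \<notin> L" if "L \<in> \<L>" "x \<in> L" "y \<in> L" for L
    using fano_line_unique[OF F that(1) A(1) y(2) that(2,3) A(2,3)] z(2) by simp
  obtain L where L: "L \<in> \<L>" "x \<notin> L" "y \<notin> L" "z \<notin> L"
    using fano_line_avoiding_triangle[OF F _ _ _ y(2) nc] x y z by blast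
  have zxy: "z \<noteq> x" "z \<noteq> y" using z A by auto
  have sub: "{x, y, z} \<subseteq> V - L" using x y z L by auto
  have "card (V - L) = 4" using F L(1) fano_finite[OF F] unfolding fano_plane_def by (simp add: card_Diff_subset)
  moreover have "card {x, y, z} = 3" using zxy y(2) by simp
  ultimately have "card ((V - L) - {x, y, z}) = 1" using sub by (simp add: card_Diff_subset)
  moreover have "G \<inter> (V - L) \<subseteq> (V - L) - {x, y, z}" using x y z by blast
  ultimately have "card (G \<inter> (V - L)) \<le> 1"
    using fano_finite[OF F] by (metis card_mono finite_Diff)
  then show False using meets[OF L(1)] by simp
qed

text \<open>Each of the t cells of \<open>T\<close> removes at most
  \<open>fact (n - 2 * t - 1)\<close> permutations, so the prescribed diversity is nearly its
  leading term.\<close>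

lemma (in large_n) card_extensions_avoiding_ge:
  assumes "card Y = 2 * t" "matching n Y" "card T = t" "finite T" "Y \<inter> T = {}"
  shows "999 / 1000 * fact (n - 2 * t) \<le> real (card {F \<in> extensions n Y. F \<inter> T = {}})"
proof -
  have fY: "finite Y" using matching_finite[OF assms(2)] .
  define g :: real where "g = fact (n - 2 * t - 1)"
  have nt: "1502 * real t \<le> real n" using n_large by linarith
  then have nt': "real (1502 * t) \<le> real n" by simp
  then have nt'': "1502 * t \<le> n" by linarith
  have "n - 2 * t = Suc (n - 2 * t - 1)" using nt'' t_pos by simp
  then have "(fact (n - 2 * t) :: real) = real (n - 2 * t) * g"
    unfolding g_def by (metis fact_Suc of_nat_id)
  also have "real (n - 2 * t) = real n - 2 * real t" using nt'' by (simp add: of_nat_diff)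
  finally have f: "(fact (n - 2 * t) :: real) = (real n - 2 * real t) * g" .
  have g0: "g > 0" unfolding g_def by simp
  have "extensions n Y \<subseteq> {F \<in> extensions n Y. F \<inter> T = {}} \<union> (\<Union>x\<in>T. extensions n (insert x Y))"
    unfolding extensions_def by auto
  then have "card (extensions n Y) \<le> card ({F \<in> extensions n Y. F \<inter> T = {}} \<union> (\<Union>x\<in>T. extensions n (insert x Y)))"
    using assms(4) by (intro card_mono) auto
  also have "\<dots> \<le> card {F \<in> extensions n Y. F \<inter> T = {}} + card (\<Union>x\<in>T. extensions n (insert x Y))"
    by (rule card_Un_le)
  finally have "real (card (extensions n Y)) \<le> real (card {F \<in> extensions n Y. F \<inter> T = {}})
    + real (card (\<Union>x\<in>T. extensions n (insert x Y)))" by linarith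
  also have "real (card (\<Union>x\<in>T. extensions n (insert x Y))) \<le> real (card T) * g"
  proof (rule card_UN_le_bound[OF assms(4)])
    fix x assume "x \<in> T"
    then have "x \<notin> Y" using assms(5) by blast
    then have "card (insert x Y) = 2 * t + 1" using assms(1) fY by simp
    then have "card (extensions n (insert x Y)) \<le> fact (n - 2 * t - 1)"
      using card_extensions_le[of n "insert x Y"] by simp
    from of_nat_mono[OF this, where 'a = real] show "real (card (extensions n (insert x Y))) \<le> g"
      unfolding g_def by simp
  qed
  finally have "fact (n - 2 * t) \<le> real (card {F \<in> extensions n Y. F \<inter> T = {}}) + real t * g"
    using card_extensions[OF assms(2)] assms(1,3) by simp
  moreover have "1000 * (real t * g) \<le> fact (n - 2 * t)"
  proof -
    have "1000 * real t \<le> real n - 2 * real t" using nt by linarith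
    then have "(1000 * real t) * g \<le> (real n - 2 * real t) * g" using g0 by (intro mult_right_mono) auto
    then show ?thesis unfolding f by simp
  qed
  ultimately show ?thesis by linarith
qed

lemma diversity_le:
  assumes "matching n T" "card T = t"
  shows "diversity n t \<F> \<le> card (avoiding \<F> T)"
proof -
  have "{T. partial_perm n T \<and> card T = t} \<subseteq> Pow ({1..n} \<times> {1..n})"
    unfolding partial_perm_iff matching_def by auto
  then have "finite {T. partial_perm n T \<and> card T = t}" by (rule finite_subset) simp
  then have "finite {card (avoiding \<F> T) | T. partial_perm n T \<and> card T = t}" by simp
  moreover have "card (avoiding \<F> T) \<in> {card (avoiding \<F> T) | T. partial_perm n T \<and> card T = t}"
    using assms unfolding partial_perm_iff by blast
  ultimately show ?thesis unfolding diversity_def by (rule Min_le)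
qed

theorem theorem1p4:
  fixes n t :: nat and \<F> :: "(nat \<times> nat) set set"
  assumes "t \<ge> 1"
    and "\<F> \<subseteq> perm_sets n"
    and "t_intersecting t \<F>"
    and "int (diversity n t \<F>) =
           (\<Sum>i=0..t. (-1) ^ i * int (t choose i) * fact (n - 2 * t - i))"
    and "n \<ge> 130 * (t + 1) * (8 * t) ^ t"
  shows "(\<exists>X. partial_perm n X \<and> card X = 3 * t \<and>
            {F \<in> perm_sets n. card (F \<inter> X) = 2 * t} \<subseteq> \<F> \<and>
            \<F> \<subseteq> {F \<in> perm_sets n. card (F \<inter> X) \<ge> 2 * t}) \<or>
         (t = 2 \<and>
          (\<exists>V \<L>. fano_plane V \<L> \<and> partial_perm n V \<and>
            {F \<in> perm_sets n. \<exists>L \<in> \<L>. V - L \<subseteq> F \<and> card (F \<inter> L) \<le> 1} \<subseteq> \<F> \<and>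
            \<F> \<subseteq> {F \<in> perm_sets n. \<exists>L \<in> \<L>. V - L \<subseteq> F}))"
proof -
  interpret large_n n t by unfold_locales (use assms in auto)
  have exact: "card {F \<in> extensions n Y. F \<inter> T = {}} = diversity n t \<F>"
    if "matching n (Y \<union> T)" "Y \<inter> T = {}" "card Y = 2 * t" "card T = t" for Y T
  proof -
    have "int (card {F \<in> extensions n Y. F \<inter> T = {}}) = int (diversity n t \<F>)"
      unfolding card_extensions_avoiding[OF that(1,2,4)] that(3) assms(4) ..
    then show ?thesis by simp
  qed
  have large: "999 / 1000 * fact (n - 2 * t) \<le> real (diversity n t \<F>)"
  proof -
    have "1502 * real t \<le> real n" using n_large by linarith
    then have "real (1502 * t) \<le> real n" by simp
    then have "1502 * t \<le> n" by linarith
    \<comment> \<open>Any disjoint \<open>Y\<close> and \<open>T\<close> inside one permutation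
      would do; the diagonal supplies a pair at which the prescribed value can be estimated.\<close>
    define d :: "nat \<Rightarrow> nat \<times> nat" where "d i = (i, i)" for i
    define Y where "Y = d ` {1..2 * t}"
    define T where "T = d ` {2 * t + 1..3 * t}"
    have inj: "inj_on d A" for A unfolding d_def by (simp add: inj_on_def)
    have m: "matching n (Y \<union> T)"
      unfolding matching_def Y_def T_def d_def using \<open>1502 * t \<le> n\<close> by (auto simp: inj_on_def)
    have c: "card Y = 2 * t" "card T = t" unfolding Y_def T_def by (simp_all add: card_image inj)
    have YT: "Y \<inter> T = {}" unfolding Y_def T_def d_def by auto
    show ?thesis
      using card_extensions_avoiding_ge[OF c(1) _ c(2) _ YT] matching_subset[OF m, of Y]
        matching_finite[OF m] exact[OF m YT c] by simp
  qed
  interpret intersecting_perms n t \<F>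
  proof
    fix T assume "matching n T" "card T = t"
    from diversity_le[OF this, of \<F>]
    have "real (diversity n t \<F>) \<le> real (card (avoiding \<F> T))" by simp
    then show "999 / 1000 * fact (n - 2 * t) \<le> real (card (avoiding \<F> T))" using large by linarith
  qed (use assms in auto)
  \<comment> \<open>If all members avoiding \<open>T\<close> contain \<open>Y\<close>, their number
    is at most that of the permutations containing \<open>Y\<close> and avoiding \<open>T\<close>.
    The diversity gives the same number as a lower bound, so every such permutation is a
    member.\<close>
  have complete: "{F \<in> extensions n Y. F \<inter> T = {}} \<subseteq> \<F>"
    if m: "matching n (Y \<union> T)" and d: "Y \<inter> T = {}" "card Y = 2 * t" "card T = t"
      and sub: "\<And>G. G \<in> \<F> \<Longrightarrow> G \<inter> T = {} \<Longrightarrow> Y \<subseteq> G" for Y T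
  proof -
    have "avoiding \<F> T \<subseteq> {F \<in> extensions n Y. F \<inter> T = {}}"
      using perms sub unfolding avoiding_def extensions_def by auto
    moreover have "card {F \<in> extensions n Y. F \<inter> T = {}} \<le> card (avoiding \<F> T)"
      using exact[OF m d] diversity_le[OF matching_subset[OF m, of T] d(3)] by simp
    ultimately have "avoiding \<F> T = {F \<in> extensions n Y. F \<inter> T = {}}"
      by (intro card_seteq) auto
    then show ?thesis using avoiding_subset by blast
  qed
  from exchange_classification[OF heavy_exists] show ?thesis
  proof (elim disjE exE conjE)
    fix X assume X: "finite X" "card X = 3 * t" and all: "\<forall>G. G \<subseteq> X \<longrightarrow> card G = 2 * t \<longrightarrow> G \<in> Collect heavy"
    have mX: "matching n X"
    proof (rule pairs_matching)
      fix x y assume xy: "x \<in> X" "y \<in> X"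
      have "card {x, y} \<le> 2 * t" using t_pos by (simp add: card_insert_if)
      then obtain G where "{x, y} \<subseteq> G" "G \<subseteq> X" "card G = 2 * t"
        using exists_subset_between[of "{x, y}" "2 * t" X] X xy by auto
      then show "\<exists>H. heavy H \<and> x \<in> H \<and> y \<in> H" using all by blast
    qed
    have upper: "2 * t \<le> card (F \<inter> X)" if "F \<in> \<F>" for F
      by (rule subset_meets_two_thirds[OF X]) (use all heavy_transversal[OF _ that] in blast)
    have "F \<in> \<F>" if F: "F \<in> perm_sets n" "card (F \<inter> X) = 2 * t" for F
    proof -
      \<comment> \<open>A member avoiding these t points meets \<open>X\<close> inside
        \<open>F \<inter> X\<close>; since it has at least 2t points in \<open>X\<close>, it
        contains \<open>F \<inter> X\<close>.\<close>
      define T where "T = X - F"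
      have YT: "(F \<inter> X) \<union> T = X" "(F \<inter> X) \<inter> T = {}" unfolding T_def by auto
      have "card T = card X - card (F \<inter> X)"
        unfolding T_def using card_Diff_subset_Int[of X F] X(1) by (simp add: Int_commute)
      then have cT: "card T = t" using X(2) F(2) by simp
      have sub: "F \<inter> X \<subseteq> G" if G: "G \<in> \<F>" "G \<inter> T = {}" for G
      proof -
        have "G \<inter> X \<subseteq> F \<inter> X" using G(2) unfolding T_def by blast
        then have "G \<inter> X = F \<inter> X" using upper[OF G(1)] F(2) X(1) by (metis card_seteq finite_Int)
        then show ?thesis by blast
      qed
      have m: "matching n ((F \<inter> X) \<union> T)" unfolding YT(1) by (rule mX)
      have "{G \<in> extensions n (F \<inter> X). G \<inter> T = {}} \<subseteq> \<F>"
        by (rule complete[OF m YT(2) F(2) cT sub])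
      moreover have "F \<in> {G \<in> extensions n (F \<inter> X). G \<inter> T = {}}"
        using F(1) unfolding extensions_def T_def by blast
      ultimately show ?thesis by blast
    qed
    then have "{F \<in> perm_sets n. card (F \<inter> X) = 2 * t} \<subseteq> \<F>" by blast
    moreover have "\<F> \<subseteq> {F \<in> perm_sets n. card (F \<inter> X) \<ge> 2 * t}" using perms upper by blast
    moreover have "partial_perm n X" using mX by (simp add: partial_perm_iff)
    ultimately show ?thesis using X(2) by (intro disjI1 exI[of _ X] conjI)
  next
    fix V \<L> assume t2: "t = 2" and fano: "fano_plane V \<L>" and all: "\<forall>L\<in>\<L>. V - L \<in> Collect heavy"
    have mV: "matching n V"
    proof (rule pairs_matching)
      fix x y assume xy: "x \<in> V" "y \<in> V"
      then obtain L where "L \<in> \<L>" "x \<notin> L" "y \<notin> L" using fano_line_avoiding_pair[OF fano] by blast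
      then show "\<exists>H. heavy H \<and> x \<in> H \<and> y \<in> H" using all xy by blast
    qed
    have upper: "\<exists>L\<in>\<L>. V - L \<subseteq> F" if "F \<in> \<F>" for F
      by (rule fano_contains_line_complement[OF fano])
         (use all heavy_transversal[OF _ that] t2 in auto)
    have "F \<in> \<F>" if F: "F \<in> perm_sets n" "L \<in> \<L>" "V - L \<subseteq> F" "card (F \<inter> L) \<le> 1" for F L
    proof -
      have L: "L \<subseteq> V" "card L = 3" "finite L" "card V = 7"
        using fano F(2) fano_finite[OF fano] unfolding fano_plane_def by auto
      have "card (L - F) = card L - card (L \<inter> F)" using L(3) by (intro card_Diff_subset_Int) simp
      then have "2 \<le> card (L - F)" using F(4) L(2) by (simp add: Int_commute)
      \<comment> \<open>As \<open>F\<close> has at most one of the three points of \<open>L\<close>,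
        two remain for \<open>T\<close>. They lie on no other line, so \<open>L\<close> is the only
        line whose complement can be contained in a member avoiding \<open>T\<close>.\<close>
      then obtain T where T: "T \<subseteq> L - F" "card T = 2" using obtain_subset_with_card_n by metis
      obtain x y where xy: "T = {x, y}" "x \<noteq> y" using T(2) by (meson card_2_iff)
      have sub: "V - L \<subseteq> G" if G: "G \<in> \<F>" "G \<inter> T = {}" for G
      proof -
        obtain L' where L': "L' \<in> \<L>" "V - L' \<subseteq> G" using upper[OF G(1)] by blast
        have "x \<in> L'" "y \<in> L'" "x \<in> L" "y \<in> L" using G(2) L'(2) T(1) L(1) unfolding xy by blast+
        then have "L = L'" using fano_line_unique[OF fano F(2) L'(1) xy(2)] by blast
        then show ?thesis using L'(2) by simp
      qed
      have m: "matching n ((V - L) \<union> T)" by (rule matching_subset[OF mV]) (use T(1) L(1) in blast)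
      have d: "(V - L) \<inter> T = {}" using T by blast
      have c: "card (V - L) = 2 * t" using L t2 by (simp add: card_Diff_subset)
      have cT: "card T = t" using T(2) t2 by simp
      have "{G \<in> extensions n (V - L). G \<inter> T = {}} \<subseteq> \<F>"
        by (rule complete[OF m d c cT sub])
      moreover have "F \<in> {G \<in> extensions n (V - L). G \<inter> T = {}}"
        using F(1,3) T(1) unfolding extensions_def by blast
      ultimately show ?thesis by blast
    qed
    then have "{F \<in> perm_sets n. \<exists>L\<in>\<L>. V - L \<subseteq> F \<and> card (F \<inter> L) \<le> 1} \<subseteq> \<F>" by blast
    moreover have "\<F> \<subseteq> {F \<in> perm_sets n. \<exists>L\<in>\<L>. V - L \<subseteq> F}" using perms upper by blast
    moreover have "partial_perm n V" using mV by (simp add: partial_perm_iff)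
    ultimately show ?thesis
      using t2 fano by (intro disjI2 conjI exI[of _ V] exI[of _ \<L>])
  qed
qed

end
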